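(* Let $f:\Sigma\to\mathcal{Z}$ be a regular umbilic-free Legendre map with curvature subbundles $T_1,T_2$ and osculating sphere complexes $L_1,L_2$, and let $i\in\{1,2\}$. (1) For a non-zero $\mathfrak{q}\in\mathbb{R}^{4,2}$, the leaves of $T_i$ project to planar curvature lines in any space form with space form vector $\mathfrak{q}$ if and only if $L_i\perp\mathfrak{q}$. (2) The leaves of $T_i$ are orthogonally intersected spherical curvature lines in a Riemannian conformal geometry with timelike point sphere complex $\mathfrak{p}$ if and only if $L_i\perp\mathfrak{p}$.
   Context: Let $\mathbb{R}^{4,2}$ be $\mathbb{R}^6$ with a symmetric bilinear form $(\cdot,\cdot)$ of signature $(4,2)$, $\mathcal{L}$ its light cone, $\mathcal{Z}$ the Grassmannian of totally isotropic 2-planes, and $\wedge^2\mathbb{R}^{4,2}\cong\mathfrak{o}(4,2)$ via $(a\wedge b)c=(a,c)b-(b,c)a$. $\Sigma$ is a simply connected 2-manifold. A smooth map $f:\Sigma\to\mathcal{Z}$ is identified with a rank 2 null subbundle of $\Sigma\times\mathbb{R}^{4,2}$; $f^{(1)}$ is the set of sections and derivatives of sections of $f$. $f$ is a Legendre map if $f^{(1)}\le f^\perp$ and, for any $x$, if $X\in T_x\Sigma$ satisfies $d\sigma(X)\in f$ for all $\sigma\in\Gamma f$, then $X=0$. $f$ is umbilic-free if there are rank 1 subbundles (curvature sphere congruences) $s_1,s_2\le f$ with $s_1\cap s_2=\{0\}$ and rank 1 curvature subbundles $T_1,T_2\le T\Sigma$ with $d_X\sigma_i\in\Gamma f$ for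 $\sigma_i\in\Gamma s_i$, $X\in\Gamma T_i$; the leaves of $T_i$ are the curvature lines. $f$ is regular if $s_1,s_2:\Sigma\to\mathbb{P}(\mathcal{L})$ are immersions. Osculating complexes: $S_1=\langle\sigma_1,d_Y\sigma_1,d_Yd_Y\sigma_1\rangle$, $S_2=\langle\sigma_2,d_X\sigma_2,d_Xd_X\sigma_2\rangle$ for nowhere-zero $\sigma_i\in\Gamma s_i$, $X\in\Gamma T_1$, $Y\in\Gamma T_2$ give an orthogonal splitting of the trivial bundle; write $d=\mathcal{D}+\mathcal{N}$, $\mathcal{D}$ the sum of the induced connections, $\mathcal{N}\in\Omega^1(S_1\wedge S_2)$. $L_i$ is the unique spacelike rank 1 subbundle of $S_i$ with $\mathcal{N}L_i=0$; one has $L_i\perp f$. Geometry: a (unit) timelike vector $\mathfrak{p}$ (point sphere complex) defines a Riemannian conformal geometry $\langle\mathfrak{p}\rangle^\perp\cong\mathbb{R}^{4,1}$, in which $f$ projects to $\Lambda=f\cap\langle\mathfrak{p}\rangle^\perp$. Spheres are elements $\nu\in\mathbb{P}(\mathcal{L})$ not in $\langle\mathfrak{p}\rangle^\perp$, up to orientation the spacelike lines $S=\pi_{\mathfrak{p}}(\nu)$ with $\pi_{\mathfrak{p}}$ the orthogonal projection to $\langle\mathfrak{p}\rangle^\perp$. The leaves of $T_i$ are spherical curvature lines in this geometry if there is $\nu:\Sigma\to\mathbb{P}(\mathcal{L})$ constant along them with $\Lambda\perp\nu$ (only the transversal case $\nu\cap f^\perp=\{0\}$ is considered). They are orthogonally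 intersected if the spheres $S=\pi_{\mathfrak{p}}(\nu)$ meet the surface orthogonally, i.e. $S\perp f$. A non-zero $\mathfrak{q}\in\langle\mathfrak{p}\rangle^\perp$ (space form vector) defines the space form $\mathfrak{Q}^3=\{y\in\mathcal{L}:(y,\mathfrak{q})=-1,(y,\mathfrak{p})=0\}$, in which spherical curvature lines are planar if the spheres $\nu$ containing them are planes (complete totally geodesic surfaces) of $\mathfrak{Q}^3$, i.e. $\nu\perp\mathfrak{q}$. *)

theory Defs
  imports "HOL-Analysis.Analysis"
begin

section \<open>Smooth surfaces\<close>

text \<open>
  \<open>Ck_on k S f\<close> is meant for open \<open>S\<close> in a finite-dimensional space, where continuity of all
  iterated directional derivatives up to order \<open>k\<close> is the same as being of class \<open>C^k\<close>.
\<close>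

primrec Ck_on ::
    "nat \<Rightarrow> 'a::euclidean_space set \<Rightarrow> ('a \<Rightarrow> 'b::euclidean_space) \<Rightarrow> bool" where
  "Ck_on 0 S f \<longleftrightarrow> continuous_on S f"
| "Ck_on (Suc k) S f \<longleftrightarrow>
     (\<forall>x\<in>S. f differentiable (at x)) \<and>
     (\<forall>w. Ck_on k S (\<lambda>x. frechet_derivative f (at x) w))"

definition smooth_on :: "'a::euclidean_space set \<Rightarrow> ('a \<Rightarrow> 'b::euclidean_space) \<Rightarrow> bool" where
  "smooth_on S f \<longleftrightarrow> (\<forall>k. Ck_on k S f)"

text \<open>
  A chart is a pair of its domain and its coordinate map; the values of the coordinate map
  outside the domain are irrelevant. The surface is the whole type \<open>'a\<close>.
\<close>

type_synonym 'a chart = "'a set \<times> ('a \<Rightarrow> real^2)"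

definition chart_inv :: "'a chart \<Rightarrow> real^2 \<Rightarrow> 'a" where
  "chart_inv c = inv_into (fst c) (snd c)"

definition smooth_surface ::
    "('a::{t2_space, second_countable_topology}) chart set \<Rightarrow> bool" where
  "smooth_surface A \<longleftrightarrow>
     (\<Union>c\<in>A. fst c) = UNIV \<and>
     (\<forall>c\<in>A. open (fst c) \<and> open (snd c ` fst c) \<and>
        homeomorphism (fst c) (snd c ` fst c) (snd c) (chart_inv c)) \<and>
     (\<forall>c\<in>A. \<forall>c'\<in>A. smooth_on (snd c ` (fst c \<inter> fst c')) (snd c' \<circ> chart_inv c))"

definition smooth_map ::
    "('a::topological_space) chart set \<Rightarrow> 'a set \<Rightarrow> ('a \<Rightarrow> 'b::euclidean_space) \<Rightarrow> bool" where
  "smooth_map A U g \<longleftrightarrow> (\<forall>c\<in>A. smooth_on (snd c ` (fst c \<inter> U)) (g \<circ> chart_inv c))"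

text \<open>
  A tangent vector at \<open>x\<close> is given by its components in all charts around \<open>x\<close>, which are
  related by the derivatives of the coordinate changes. The components in charts not
  containing \<open>x\<close> are set to zero, so that \<open>\<lambda>_. 0\<close> is the zero vector of every tangent space.
\<close>

type_synonym 'a tvec = "'a chart \<Rightarrow> real^2"

definition tangent_space :: "'a chart set \<Rightarrow> 'a \<Rightarrow> 'a tvec set" where
  "tangent_space A x = {v.
     (\<forall>c. c \<notin> A \<or> x \<notin> fst c \<longrightarrow> v c = 0) \<and>
     (\<forall>c\<in>A. \<forall>c'\<in>A. x \<in> fst c \<and> x \<in> fst c' \<longrightarrow>
        v c' = frechet_derivative (snd c' \<circ> chart_inv c) (at (snd c x)) (v c))}"

text \<open>The derivative \<open>d\<^sub>v g\<close> at \<open>x\<close>; by the chain rule the choice of chart does not matter.\<close>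

definition dder ::
    "'a chart set \<Rightarrow> ('a \<Rightarrow> 'b::euclidean_space) \<Rightarrow> 'a \<Rightarrow> 'a tvec \<Rightarrow> 'b" where
  "dder A g x v = (let c = (SOME c. c \<in> A \<and> x \<in> fst c)
     in frechet_derivative (g \<circ> chart_inv c) (at (snd c x)) (v c))"

definition dfield ::
    "'a chart set \<Rightarrow> ('a \<Rightarrow> 'a tvec) \<Rightarrow> ('a \<Rightarrow> 'b::euclidean_space) \<Rightarrow> 'a \<Rightarrow> 'b" where
  "dfield A X g = (\<lambda>x. dder A g x (X x))"

definition vector_field ::
    "('a::topological_space) chart set \<Rightarrow> 'a set \<Rightarrow> ('a \<Rightarrow> 'a tvec) \<Rightarrow> bool" where
  "vector_field A U X \<longleftrightarrow>
     (\<forall>x\<in>U. X x \<in> tangent_space A x) \<and>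
     (\<forall>c\<in>A. smooth_on (snd c ` (fst c \<inter> U)) (\<lambda>z. X (chart_inv c z) c))"

definition tangent_line_bundle ::
    "('a::topological_space) chart set \<Rightarrow> ('a \<Rightarrow> 'a tvec set) \<Rightarrow> bool" where
  "tangent_line_bundle A T \<longleftrightarrow>
     (\<forall>x. \<exists>U X. open U \<and> x \<in> U \<and> vector_field A U X \<and>
        (\<forall>y\<in>U. X y \<noteq> (\<lambda>_. 0) \<and> T y = {\<lambda>c. r *\<^sub>R X y c | r. True}))"

definition tangent_sections ::
    "('a::topological_space) chart set \<Rightarrow> 'a set \<Rightarrow> ('a \<Rightarrow> 'a tvec set) \<Rightarrow> ('a \<Rightarrow> 'a tvec) set" where
  "tangent_sections A U T = {X. vector_field A U X \<and> (\<forall>x\<in>U. X x \<in> T x)}"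

text \<open>
  The leaf of the rank 1 distribution \<open>T\<close> through \<open>x\<close> consists of the points of all regular
  integral curves through \<open>x\<close>.
\<close>

definition integral_curve ::
    "('a::topological_space) chart set \<Rightarrow> ('a \<Rightarrow> 'a tvec set) \<Rightarrow> (real \<Rightarrow> 'a) \<Rightarrow> real set \<Rightarrow> bool" where
  "integral_curve A T \<gamma> I \<longleftrightarrow> continuous_on I \<gamma> \<and>
     (\<forall>t\<in>I. \<exists>v\<in>T (\<gamma> t). v \<noteq> (\<lambda>_. 0) \<and>
        (\<forall>c\<in>A. \<gamma> t \<in> fst c \<longrightarrow> ((snd c \<circ> \<gamma>) has_vector_derivative v c) (at t)))"

definition leaf ::
    "('a::topological_space) chart set \<Rightarrow> ('a \<Rightarrow> 'a tvec set) \<Rightarrow> 'a \<Rightarrow> 'a set" where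
  "leaf A T x = {y. \<exists>\<gamma> a b t t'. integral_curve A T \<gamma> {a<..<b} \<and>
     t \<in> {a<..<b} \<and> t' \<in> {a<..<b} \<and> \<gamma> t = x \<and> \<gamma> t' = y}"

section \<open>The space of signature (4,2)\<close>

type_synonym R42 = "(real^4) \<times> (real^2)"

definition lform :: "R42 \<Rightarrow> R42 \<Rightarrow> real" where
  "lform u w = fst u \<bullet> fst w - snd u \<bullet> snd w"

definition perp :: "R42 set \<Rightarrow> R42 set" where
  "perp W = {u. \<forall>w\<in>W. lform u w = 0}"

definition timelike :: "R42 \<Rightarrow> bool" where
  "timelike u \<longleftrightarrow> lform u u < 0"

definition totally_isotropic :: "R42 set \<Rightarrow> bool" where
  "totally_isotropic W \<longleftrightarrow> (\<forall>u\<in>W. \<forall>w\<in>W. lform u w = 0)"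

definition spacelike_space :: "R42 set \<Rightarrow> bool" where
  "spacelike_space W \<longleftrightarrow> (\<forall>u\<in>W. u \<noteq> 0 \<longrightarrow> lform u u > 0)"

text \<open>Orthogonal projection onto a subspace on which the form is non-degenerate.\<close>

definition oproj :: "R42 set \<Rightarrow> R42 \<Rightarrow> R42" where
  "oproj W u = (THE w. w \<in> W \<and> u - w \<in> perp W)"

section \<open>Subbundles of the trivial bundle\<close>

definition subbundle ::
    "('a::topological_space) chart set \<Rightarrow> nat \<Rightarrow> ('a \<Rightarrow> R42 set) \<Rightarrow> bool" where
  "subbundle A k E \<longleftrightarrow>
     (\<forall>x. \<exists>U e. open U \<and> x \<in> U \<and> (\<forall>j<k. smooth_map A U (e j)) \<and>
        (\<forall>y\<in>U. E y = span ((\<lambda>j. e j y) ` {..<k}) \<and> dim (E y) = k))"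

text \<open>
  Smooth maps into the Grassmannian of totally isotropic 2-planes are null subbundles of rank 2,
  smooth maps into the projective light cone are null subbundles of rank 1.
\<close>

definition null_subbundle ::
    "('a::topological_space) chart set \<Rightarrow> nat \<Rightarrow> ('a \<Rightarrow> R42 set) \<Rightarrow> bool" where
  "null_subbundle A k E \<longleftrightarrow> subbundle A k E \<and> (\<forall>x. totally_isotropic (E x))"

text \<open>Sections are taken over arbitrary open sets, that is, bundles are identified with their sheaves of sections.\<close>

definition sections ::
    "('a::topological_space) chart set \<Rightarrow> 'a set \<Rightarrow> ('a \<Rightarrow> R42 set) \<Rightarrow> ('a \<Rightarrow> R42) set" where
  "sections A U E = {\<sigma>. smooth_map A U \<sigma> \<and> (\<forall>x\<in>U. \<sigma> x \<in> E x)}"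

text \<open>The values at \<open>x\<close> of sections of \<open>E\<close> and of their derivatives.\<close>

definition derived ::
    "('a::topological_space) chart set \<Rightarrow> ('a \<Rightarrow> R42 set) \<Rightarrow> 'a \<Rightarrow> R42 set" where
  "derived A E x =
     {\<sigma> x | \<sigma> U. open U \<and> x \<in> U \<and> \<sigma> \<in> sections A U E} \<union>
     {dder A \<sigma> x v | \<sigma> U v. open U \<and> x \<in> U \<and> \<sigma> \<in> sections A U E \<and> v \<in> tangent_space A x}"

text \<open>
  For a line bundle \<open>E\<close> this says that the corresponding map into projective space is an immersion,
  since its differential at \<open>x\<close> is the map sending \<open>v\<close> to \<open>\<sigma> x \<mapsto> d\<^sub>v \<sigma> mod E x\<close>.
\<close>

definition immersive ::
    "('a::topological_space) chart set \<Rightarrow> ('a \<Rightarrow> R42 set) \<Rightarrow> bool" where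
  "immersive A E \<longleftrightarrow>
     (\<forall>x. \<forall>v\<in>tangent_space A x.
        (\<forall>U \<sigma>. open U \<and> x \<in> U \<and> \<sigma> \<in> sections A U E \<longrightarrow> dder A \<sigma> x v \<in> E x) \<longrightarrow> v = (\<lambda>_. 0))"

section \<open>Legendre maps\<close>

definition legendre_map ::
    "('a::topological_space) chart set \<Rightarrow> ('a \<Rightarrow> R42 set) \<Rightarrow> bool" where
  "legendre_map A f \<longleftrightarrow>
     null_subbundle A 2 f \<and> (\<forall>x. derived A f x \<subseteq> perp (f x)) \<and> immersive A f"

text \<open>
  \<open>f\<close> is umbilic-free iff curvature sphere congruences \<open>s 1\<close>, \<open>s 2\<close> and curvature subbundles
  \<open>T 1\<close>, \<open>T 2\<close> with this property exist; other indices are irrelevant.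
\<close>

definition curvature_data ::
    "('a::topological_space) chart set \<Rightarrow> ('a \<Rightarrow> R42 set) \<Rightarrow>
     (nat \<Rightarrow> 'a \<Rightarrow> R42 set) \<Rightarrow> (nat \<Rightarrow> 'a \<Rightarrow> 'a tvec set) \<Rightarrow> bool" where
  "curvature_data A f s T \<longleftrightarrow>
     (\<forall>i\<in>{1,2}. subbundle A 1 (s i) \<and> (\<forall>x. s i x \<subseteq> f x)) \<and>
     (\<forall>x. s 1 x \<inter> s 2 x = {0}) \<and>
     (\<forall>i\<in>{1,2}. tangent_line_bundle A (T i)) \<and>
     (\<forall>i\<in>{1,2}. \<forall>U \<sigma> X. open U \<and> \<sigma> \<in> sections A U (s i) \<and> X \<in> tangent_sections A U (T i) \<longrightarrow>
        dfield A X \<sigma> \<in> sections A U f)"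

definition regular_legendre ::
    "('a::topological_space) chart set \<Rightarrow> (nat \<Rightarrow> 'a \<Rightarrow> R42 set) \<Rightarrow> bool" where
  "regular_legendre A s \<longleftrightarrow> (\<forall>i\<in>{1,2}. immersive A (s i))"

text \<open>
  The span of \<open>\<sigma>\<close>, \<open>d\<^sub>Y \<sigma>\<close>, \<open>d\<^sub>Y d\<^sub>Y \<sigma>\<close> at \<open>x\<close> does not depend on the nowhere-zero sections
  \<open>\<sigma>\<close> and \<open>Y\<close> chosen around \<open>x\<close>, so the union over all choices is just this span.
\<close>

definition complex_of ::
    "('a::topological_space) chart set \<Rightarrow> ('a \<Rightarrow> R42 set) \<Rightarrow> ('a \<Rightarrow> 'a tvec set) \<Rightarrow> 'a \<Rightarrow> R42 set" where
  "complex_of A s T x =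
     \<Union>{span {\<sigma> x, dfield A Y \<sigma> x, dfield A Y (dfield A Y \<sigma>) x} | \<sigma> Y U.
        open U \<and> x \<in> U \<and> \<sigma> \<in> sections A U s \<and> Y \<in> tangent_sections A U T \<and>
        (\<forall>y\<in>U. \<sigma> y \<noteq> 0 \<and> Y y \<noteq> (\<lambda>_. 0))}"

text \<open>For \<open>i \<in> {1,2}\<close> the other index is \<open>3 - i\<close>.\<close>

definition osculating_complex ::
    "('a::topological_space) chart set \<Rightarrow> (nat \<Rightarrow> 'a \<Rightarrow> R42 set) \<Rightarrow> (nat \<Rightarrow> 'a \<Rightarrow> 'a tvec set) \<Rightarrow>
     nat \<Rightarrow> 'a \<Rightarrow> R42 set" where
  "osculating_complex A s T i = complex_of A (s i) (T (3 - i))"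

text \<open>
  For a splitting of the trivial bundle into \<open>S 1\<close> and \<open>S 2\<close>: the sum \<open>\<D>\<close> of the induced
  connections, and \<open>\<N> = d - \<D>\<close>.
\<close>

definition split_conn ::
    "'a chart set \<Rightarrow> (nat \<Rightarrow> 'a \<Rightarrow> R42 set) \<Rightarrow> ('a \<Rightarrow> R42) \<Rightarrow> 'a \<Rightarrow> 'a tvec \<Rightarrow> R42" where
  "split_conn A S \<xi> x v = (\<Sum>i\<in>{1,2}. oproj (S i x) (dder A (\<lambda>y. oproj (S i y) (\<xi> y)) x v))"

definition split_form ::
    "'a chart set \<Rightarrow> (nat \<Rightarrow> 'a \<Rightarrow> R42 set) \<Rightarrow> ('a \<Rightarrow> R42) \<Rightarrow> 'a \<Rightarrow> 'a tvec \<Rightarrow> R42" where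
  "split_form A S \<xi> x v = dder A \<xi> x v - split_conn A S \<xi> x v"

definition osculating_sphere_complex ::
    "('a::topological_space) chart set \<Rightarrow> (nat \<Rightarrow> 'a \<Rightarrow> R42 set) \<Rightarrow> (nat \<Rightarrow> 'a \<Rightarrow> 'a tvec set) \<Rightarrow>
     nat \<Rightarrow> ('a \<Rightarrow> R42 set) \<Rightarrow> bool" where
  "osculating_sphere_complex A s T i L \<longleftrightarrow>
     subbundle A 1 L \<and>
     (\<forall>x. L x \<subseteq> osculating_complex A s T i x \<and> spacelike_space (L x)) \<and>
     (\<forall>U \<xi> x. open U \<and> x \<in> U \<and> \<xi> \<in> sections A U L \<longrightarrow>
        (\<forall>v\<in>tangent_space A x. split_form A (osculating_complex A s T) \<xi> x v = 0))"

section \<open>Spherical and planar curvature lines\<close>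

text \<open>
  \<open>\<nu>\<close> is a congruence of spheres of the conformal geometry of the timelike vector \<open>p\<close>, constant
  along the leaves of \<open>T\<close> and containing them: it is orthogonal to the projection
  \<open>f x \<inter> perp {p}\<close> of \<open>f\<close>. The last condition is transversality.
\<close>

definition sphere_congruence_along ::
    "('a::topological_space) chart set \<Rightarrow> ('a \<Rightarrow> R42 set) \<Rightarrow> ('a \<Rightarrow> 'a tvec set) \<Rightarrow> R42 \<Rightarrow>
     ('a \<Rightarrow> R42 set) \<Rightarrow> bool" where
  "sphere_congruence_along A f T p \<nu> \<longleftrightarrow>
     null_subbundle A 1 \<nu> \<and>
     (\<forall>x. \<not> \<nu> x \<subseteq> perp {p}) \<and>
     (\<forall>x. \<forall>y\<in>leaf A T x. \<nu> y = \<nu> x) \<and>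
     (\<forall>x. f x \<inter> perp {p} \<subseteq> perp (\<nu> x)) \<and>
     (\<forall>x. \<nu> x \<inter> perp (f x) = {0})"

text \<open>
  In the space form \<open>{y. lform y y = 0 \<and> lform y q = -1 \<and> lform y p = 0}\<close>, the sphere \<open>\<nu> x\<close> is a
  plane iff it is orthogonal to \<open>q\<close>.
\<close>

definition planar_curvature_lines ::
    "('a::topological_space) chart set \<Rightarrow> ('a \<Rightarrow> R42 set) \<Rightarrow> ('a \<Rightarrow> 'a tvec set) \<Rightarrow> R42 \<Rightarrow> R42 \<Rightarrow> bool" where
  "planar_curvature_lines A f T p q \<longleftrightarrow>
     (\<exists>\<nu>. sphere_congruence_along A f T p \<nu> \<and> (\<forall>x. \<nu> x \<subseteq> perp {q}))"

definition orthogonal_spherical_curvature_lines ::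
    "('a::topological_space) chart set \<Rightarrow> ('a \<Rightarrow> R42 set) \<Rightarrow> ('a \<Rightarrow> 'a tvec set) \<Rightarrow> R42 \<Rightarrow> bool" where
  "orthogonal_spherical_curvature_lines A f T p \<longleftrightarrow>
     (\<exists>\<nu>. sphere_congruence_along A f T p \<nu> \<and> (\<forall>x. oproj (perp {p}) ` \<nu> x \<subseteq> perp (f x)))"

end

theory Submission
  imports Defs
begin

text \<open>
  Write \<open>\<sigma>\<close>, \<open>\<tau>\<close> for local sections of the curvature sphere congruences with
  indices \<open>i\<close> and \<open>3 - i\<close>, and \<open>X\<close>, \<open>Y\<close> for sections of the
  corresponding curvature subbundles. The derivative of \<open>\<sigma>\<close> along \<open>X\<close> is a section of
  the Legendre map \<open>f = span {\<sigma>, \<tau>}\<close>, with nonzero component along \<open>\<tau>\<close> by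
  regularity. The argument rests on a description of the osculating sphere complex by derivatives in the direction of
  the curvature lines only (\<open>osculating_sphere_complex_eq\<close>): \<open>L i\<close> is the orthogonal
  complement of \<open>\<sigma>\<close>, \<open>\<tau>\<close> and the first three derivatives of
  \<open>\<tau>\<close> along \<open>X\<close>. It is derived from the orthogonality of the two osculating complexes,
  which in turn follows from the Legendre condition and the symmetry of second derivatives; this orthogonality also
  shows that the complexes do not depend on the chosen sections.

  Suppose that the curvature lines are planar, or orthogonally intersected spherical, with sphere congruence
  \<open>\<nu>\<close>, and let \<open>n\<close> be a section of \<open>\<nu>\<close>. Since \<open>\<nu>\<close> is
  constant along the leaves, which exist by the local existence theorem for ordinary differential equations, the
  derivative of \<open>n\<close> along \<open>X\<close> is a multiple of \<open>n\<close>. A suitable combination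
  \<open>m = n + t p\<close> with the point sphere complex is orthogonal to \<open>f\<close>, and its derivative is a
  multiple of \<open>m\<close>; in the planar case this is shown where \<open>p\<close> is not orthogonal to
  \<open>\<sigma>\<close>, which is a dense set. Differentiating the orthogonality relations along \<open>X\<close>
  shows that \<open>m\<close> is orthogonal to all vectors in the description above, hence spans \<open>L i\<close>.
  In the planar case \<open>m\<close> is orthogonal to \<open>q\<close> because \<open>n\<close> and \<open>p\<close>
  are, and in the spherical case \<open>m\<close> is the projection of \<open>n\<close> to the complement of
  \<open>p\<close>.

  Conversely, suppose that \<open>L i\<close> is orthogonal to a fixed nonzero vector \<open>q\<close>, and let
  \<open>l\<close> be a unit section of \<open>L i\<close>. By the same description the derivative of \<open>l\<close>
  along \<open>X\<close> is a combination of \<open>\<sigma>\<close> and \<open>l\<close>. If the coefficient of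
  \<open>\<sigma>\<close> were nonzero somewhere, it would be nonzero on an open set, on which \<open>q\<close> would
  be orthogonal to \<open>\<sigma>\<close>, hence, by differentiating, to \<open>\<tau>\<close> and to its
  derivatives; then \<open>q\<close> would lie in the spacelike line \<open>L i\<close>, to which it is orthogonal
  (\<open>hyperplane_imp_parallel\<close>). So \<open>l\<close> is constant along the curvature lines. The plane
  spanned by \<open>l\<close> and \<open>p\<close> has signature (1,1), and one of its two null lines is the required
  sphere congruence. The two null lines correspond to the two orientations of \<open>L i\<close>, and a global choice
  exists because the surface is simply connected.
\<close>

section \<open>Smooth maps on open sets\<close>

lemma has_frechet_derivative:
  "f differentiable (at x) \<Longrightarrow> (f has_derivative frechet_derivative f (at x)) (at x)"
  by (simp add: frechet_derivative_works)

lemma frechet_derivative_eqI: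
  "(f has_derivative D) (at x) \<Longrightarrow> frechet_derivative f (at x) u = D u"
  using frechet_derivative_at by metis

lemma Ck_on_Suc_imp: "Ck_on (Suc k) S f \<Longrightarrow> Ck_on k S f"
proof (induction k arbitrary: f)
  case 0
  then show ?case
    by (auto intro!: continuous_at_imp_continuous_on differentiable_imp_continuous_within)
next
  case (Suc k)
  from Suc.prems have "\<forall>x\<in>S. f differentiable (at x)"
    "\<And>w. Ck_on (Suc k) S (\<lambda>x. frechet_derivative f (at x) w)"
    by (auto simp del: Ck_on.simps simp: Ck_on.simps(2)[of "Suc k"])
  then show ?case using Suc.IH by simp
qed

lemma smooth_on_differentiable: "smooth_on S f \<Longrightarrow> x \<in> S \<Longrightarrow> f differentiable (at x)"
  unfolding smooth_on_def by (metis Ck_on.simps(2))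

lemma smooth_on_frechet_derivative:
  "smooth_on S f \<Longrightarrow> smooth_on S (\<lambda>x. frechet_derivative f (at x) w)"
  unfolding smooth_on_def by (metis Ck_on.simps(2))

lemma smooth_on_continuous_on: "smooth_on S f \<Longrightarrow> continuous_on S f"
  unfolding smooth_on_def by (metis Ck_on.simps(1))

lemma frechet_derivative_cong_open:
  assumes "open S" "x \<in> S" "\<And>y. y \<in> S \<Longrightarrow> f y = g y"
  shows "frechet_derivative f (at x) = frechet_derivative g (at x)"
proof -
  have "(f has_derivative D) (at x) \<longleftrightarrow> (g has_derivative D) (at x)" for D
    using assms has_derivative_transform_within_open[of _ D x UNIV S] by metis
  then show ?thesis unfolding frechet_derivative_def by presburger
qed

lemma differentiable_cong_open:
  assumes "open S" "x \<in> S" "\<And>y. y \<in> S \<Longrightarrow> f y = g y" "f differentiable (at x)"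
  shows "g differentiable (at x)"
  using assms has_derivative_transform_within_open[of f _ x UNIV S g]
  unfolding differentiable_def by metis

lemma Ck_on_cong:
  assumes "open S" "\<And>y. y \<in> S \<Longrightarrow> f y = g y" "Ck_on k S f"
  shows "Ck_on k S g"
  using assms(2,3)
proof (induction k arbitrary: f g)
  case 0
  then show ?case using continuous_on_cong by (metis Ck_on.simps(1))
next
  case (Suc k)
  have "Ck_on k S (\<lambda>x. frechet_derivative g (at x) w)" for w
    by (rule Suc.IH[of "\<lambda>x. frechet_derivative f (at x) w"])
      (use Suc.prems frechet_derivative_cong_open[OF assms(1), of _ f g] in auto)
  then show ?case using Suc.prems differentiable_cong_open[OF assms(1), of _ f g] by auto
qed

lemma smooth_on_cong:
  "open S \<Longrightarrow> (\<And>y. y \<in> S \<Longrightarrow> f y = g y) \<Longrightarrow> smooth_on S f \<Longrightarrow> smooth_on S g"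
  unfolding smooth_on_def using Ck_on_cong by blast

lemma Ck_on_subset: "Ck_on k S f \<Longrightarrow> T \<subseteq> S \<Longrightarrow> Ck_on k T f"
  by (induction k arbitrary: f) (auto intro: continuous_on_subset)

lemma smooth_on_subset: "smooth_on S f \<Longrightarrow> T \<subseteq> S \<Longrightarrow> smooth_on T f"
  unfolding smooth_on_def using Ck_on_subset by blast

lemma Ck_on_const: "Ck_on k S (\<lambda>x. c)"
  by (induction k arbitrary: c) auto

lemma smooth_on_const: "smooth_on S (\<lambda>x. c)"
  by (simp add: smooth_on_def Ck_on_const)

lemma frechet_derivative_add:
  assumes "f differentiable (at x)" "g differentiable (at x)"
  shows "frechet_derivative (\<lambda>x. f x + g x) (at x) w = frechet_derivative f (at x) w + frechet_derivative g (at x) w"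
  using frechet_derivative_at[OF has_derivative_add[OF assms[THEN has_frechet_derivative]]] by metis

lemma Ck_on_add:
  assumes "open S"
  shows "Ck_on k S f \<Longrightarrow> Ck_on k S g \<Longrightarrow> Ck_on k S (\<lambda>x. f x + g x)"
proof (induction k arbitrary: f g)
  case 0
  then show ?case by (simp add: continuous_on_add)
next
  case (Suc k)
  have "Ck_on k S (\<lambda>x. frechet_derivative (\<lambda>x. f x + g x) (at x) w)" for w
    by (rule Ck_on_cong[OF assms, of "\<lambda>x. frechet_derivative f (at x) w + frechet_derivative g (at x) w"])
      (use Suc in \<open>auto simp: frechet_derivative_add\<close>)
  then show ?case using Suc.prems by (auto intro: differentiable_add)
qed

lemma frechet_derivative_bilinear:
  assumes "bounded_bilinear h" "f differentiable (at x)" "g differentiable (at x)"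
  shows "frechet_derivative (\<lambda>x. h (f x) (g x)) (at x) w =
    h (f x) (frechet_derivative g (at x) w) + h (frechet_derivative f (at x) w) (g x)"
  using frechet_derivative_at[OF bounded_bilinear.FDERIV[OF assms(1)
    has_frechet_derivative[OF assms(2)] has_frechet_derivative[OF assms(3)]]]
  by metis

lemma Ck_on_bilinear:
  assumes "open S" "bounded_bilinear h"
  shows "Ck_on k S f \<Longrightarrow> Ck_on k S g \<Longrightarrow> Ck_on k S (\<lambda>x. h (f x) (g x))"
proof (induction k arbitrary: f g)
  case 0
  then show ?case by (simp add: bounded_bilinear.continuous_on[OF assms(2)])
next
  case (Suc k)
  note fg = Ck_on_Suc_imp[OF Suc.prems(1)] Ck_on_Suc_imp[OF Suc.prems(2)]
  have "Ck_on k S (\<lambda>x. frechet_derivative (\<lambda>x. h (f x) (g x)) (at x) w)" for w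
    by (rule Ck_on_cong[OF assms(1), of "\<lambda>x. h (f x) (frechet_derivative g (at x) w) +
          h (frechet_derivative f (at x) w) (g x)"])
      (use Suc fg in \<open>auto simp: frechet_derivative_bilinear[OF assms(2)] intro!: Ck_on_add[OF assms(1)]\<close>)
  then show ?case
    using Suc.prems
    by (auto intro!: differentiableI[OF bounded_bilinear.FDERIV[OF assms(2) has_frechet_derivative has_frechet_derivative]])
qed

lemma smooth_on_add: "open S \<Longrightarrow> smooth_on S f \<Longrightarrow> smooth_on S g \<Longrightarrow> smooth_on S (\<lambda>x. f x + g x)"
  unfolding smooth_on_def using Ck_on_add by blast

lemma smooth_on_bilinear:
  "open S \<Longrightarrow> bounded_bilinear h \<Longrightarrow> smooth_on S f \<Longrightarrow> smooth_on S g \<Longrightarrow> smooth_on S (\<lambda>x. h (f x) (g x))"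
  unfolding smooth_on_def using Ck_on_bilinear by blast

lemma smooth_on_sum:
  "open S \<Longrightarrow> (\<And>i. i \<in> I \<Longrightarrow> smooth_on S (f i)) \<Longrightarrow> smooth_on S (\<lambda>x. \<Sum>i\<in>I. f i x)"
  by (induction I rule: infinite_finite_induct) (auto intro: smooth_on_add smooth_on_const)

lemma Ck_on_inverse:
  fixes f :: "'a::euclidean_space \<Rightarrow> real"
  assumes "open S" "\<And>x. x \<in> S \<Longrightarrow> f x \<noteq> 0"
  shows "Ck_on k S f \<Longrightarrow> Ck_on k S (\<lambda>x. inverse (f x))"
proof (induction k)
  case 0
  then show ?case using assms by (auto intro!: continuous_on_inverse)
next
  case (Suc k)
  have IH: "Ck_on k S (\<lambda>x. inverse (f x))" using Suc Ck_on_Suc_imp by blast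
  have d: "((\<lambda>x. inverse (f x)) has_derivative
      (\<lambda>w. - (inverse (f x) * frechet_derivative f (at x) w * inverse (f x)))) (at x)" if "x \<in> S" for x
    using Suc.prems that assms(2)
    by (auto intro!: Deriv.has_derivative_inverse has_frechet_derivative)
  have "Ck_on k S (\<lambda>x. frechet_derivative (\<lambda>x. inverse (f x)) (at x) w)" for w
  proof (rule Ck_on_cong[OF assms(1)])
    show "Ck_on k S (\<lambda>x. (-1) * (inverse (f x) * frechet_derivative f (at x) w * inverse (f x)))"
      using Suc.prems IH
      by (intro Ck_on_bilinear[OF assms(1) bounded_bilinear_mult] Ck_on_const) auto
  qed (use frechet_derivative_at[OF d] in \<open>auto simp: fun_eq_iff\<close>)
  then show ?case using d by (auto simp: differentiable_def)
qed

lemma Ck_on_sqrt: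
  fixes f :: "'a::euclidean_space \<Rightarrow> real"
  assumes "open S" "\<And>x. x \<in> S \<Longrightarrow> f x > 0"
  shows "Ck_on k S f \<Longrightarrow> Ck_on k S (\<lambda>x. sqrt (f x))"
proof (induction k)
  case 0
  then show ?case by (auto intro!: continuous_on_real_sqrt)
next
  case (Suc k)
  have IH: "Ck_on k S (\<lambda>x. sqrt (f x))" using Suc Ck_on_Suc_imp by blast
  have inv: "Ck_on k S (\<lambda>x. inverse (sqrt (f x)))"
    by (rule Ck_on_inverse[OF assms(1) _ IH]) (use assms(2) in force)
  have d: "((\<lambda>x. sqrt (f x)) has_derivative
      (\<lambda>w. frechet_derivative f (at x) w * (inverse (sqrt (f x)) / 2))) (at x)" if "x \<in> S" for x
    using Suc.prems that assms(2)
    by (auto intro!: has_derivative_compose[OF has_frechet_derivative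
        DERIV_real_sqrt[unfolded has_field_derivative_def], THEN has_derivative_eq_rhs] simp: fun_eq_iff)
  have "Ck_on k S (\<lambda>x. frechet_derivative (\<lambda>x. sqrt (f x)) (at x) w)" for w
  proof (rule Ck_on_cong[OF assms(1)])
    show "Ck_on k S (\<lambda>x. frechet_derivative f (at x) w * (inverse (sqrt (f x)) * (1/2)))"
      using Suc.prems inv
      by (intro Ck_on_bilinear[OF assms(1) bounded_bilinear_mult] Ck_on_const) auto
  qed (use frechet_derivative_at[OF d] in \<open>auto simp: fun_eq_iff\<close>)
  then show ?case using d by (auto simp: differentiable_def)
qed

lemma smooth_on_inverse:
  fixes f :: "'a::euclidean_space \<Rightarrow> real"
  shows "open S \<Longrightarrow> (\<And>x. x \<in> S \<Longrightarrow> f x \<noteq> 0) \<Longrightarrow> smooth_on S f \<Longrightarrow> smooth_on S (\<lambda>x. inverse (f x))"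
  unfolding smooth_on_def using Ck_on_inverse by blast

lemma smooth_on_sqrt:
  fixes f :: "'a::euclidean_space \<Rightarrow> real"
  shows "open S \<Longrightarrow> (\<And>x. x \<in> S \<Longrightarrow> f x > 0) \<Longrightarrow> smooth_on S f \<Longrightarrow> smooth_on S (\<lambda>x. sqrt (f x))"
  unfolding smooth_on_def using Ck_on_sqrt by blast

lemma frechet_derivative_Basis:
  assumes "f differentiable (at x)"
  shows "frechet_derivative f (at x) v = (\<Sum>b\<in>Basis. (v \<bullet> b) *\<^sub>R frechet_derivative f (at x) b)"
proof -
  interpret linear "frechet_derivative f (at x)"
    using assms linear_frechet_derivative by blast
  have "frechet_derivative f (at x) v = frechet_derivative f (at x) (\<Sum>b\<in>Basis. (v \<bullet> b) *\<^sub>R b)"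
    by (simp add: euclidean_representation)
  then show ?thesis by (simp add: sum scale)
qed

lemma smooth_on_directional:
  assumes "open S" "smooth_on S f" "smooth_on S V"
  shows "smooth_on S (\<lambda>x. frechet_derivative f (at x) (V x))"
proof (rule smooth_on_cong[OF assms(1)])
  show "smooth_on S (\<lambda>x. \<Sum>b\<in>Basis. (V x \<bullet> b) *\<^sub>R frechet_derivative f (at x) b)"
    by (intro smooth_on_sum assms(1) smooth_on_bilinear[OF assms(1) bounded_bilinear_scaleR]
        smooth_on_bilinear[OF assms(1) bounded_bilinear_inner] smooth_on_const
        smooth_on_frechet_derivative assms)
qed (metis frechet_derivative_Basis smooth_on_differentiable assms(2))

lemma mean_value_second_difference:
  fixes h :: "'a::euclidean_space \<Rightarrow> real"
  assumes "\<And>z. z \<in> ball x r \<Longrightarrow> h differentiable (at z)"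
    and "\<And>z. z \<in> ball x r \<Longrightarrow> (\<lambda>z. frechet_derivative h (at z) v) differentiable (at z)"
    and s: "0 < s" "s * (norm v + norm w) < r"
  obtains p where "norm (p - x) \<le> s * (norm v + norm w)"
    "h (x + s *\<^sub>R v + s *\<^sub>R w) - h (x + s *\<^sub>R v) - h (x + s *\<^sub>R w) + h x =
     s * s * frechet_derivative (\<lambda>z. frechet_derivative h (at z) v) (at p) w"
proof -
  define hv where "hv = (\<lambda>z. frechet_derivative h (at z) v)"
  have near: "norm (a *\<^sub>R v + b *\<^sub>R w) \<le> s * (norm v + norm w)" if "0 \<le> a" "a \<le> s" "0 \<le> b" "b \<le> s" for a b
  proof -
    have "norm (a *\<^sub>R v + b *\<^sub>R w) \<le> a * norm v + b * norm w"
      using norm_triangle_ineq[of "a *\<^sub>R v" "b *\<^sub>R w"] that by simp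
    also have "\<dots> \<le> s * norm v + s * norm w"
      using that by (intro add_mono mult_right_mono) auto
    finally show ?thesis by (simp add: algebra_simps)
  qed
  have inb: "x + a *\<^sub>R v + b *\<^sub>R w \<in> ball x r" if "0 \<le> a" "a \<le> s" "0 \<le> b" "b \<le> s" for a b
  proof -
    have "dist x (x + a *\<^sub>R v + b *\<^sub>R w) = norm (a *\<^sub>R v + b *\<^sub>R w)"
      by (metis add.assoc dist_norm norm_minus_commute add_diff_cancel_left')
    then show ?thesis using near[OF that] s(2) by simp
  qed
  define \<phi> where "\<phi> = (\<lambda>a. h (x + a *\<^sub>R v + s *\<^sub>R w) - h (x + a *\<^sub>R v + 0 *\<^sub>R w))"
  have D1: "((\<lambda>a. h (x + a *\<^sub>R v + b *\<^sub>R w)) has_real_derivative hv (x + a *\<^sub>R v + b *\<^sub>R w)) (at a)"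
    if "0 \<le> a" "a \<le> s" "0 \<le> b" "b \<le> s" for a b
  proof -
    have lin: "linear (frechet_derivative h (at (x + a *\<^sub>R v + b *\<^sub>R w)))"
      using assms(1)[OF inb[OF that]] linear_frechet_derivative by blast
    have "((\<lambda>a. h (x + a *\<^sub>R v + b *\<^sub>R w)) has_derivative
        (\<lambda>t. frechet_derivative h (at (x + a *\<^sub>R v + b *\<^sub>R w)) (t *\<^sub>R v))) (at a)"
      by (rule has_derivative_compose[where f="\<lambda>a. x + a *\<^sub>R v + b *\<^sub>R w",
            OF _ has_frechet_derivative[OF assms(1)[OF inb[OF that]]]])
        (auto intro!: derivative_eq_intros)
    then show ?thesis unfolding has_field_derivative_def hv_def
      by (rule has_derivative_eq_rhs) (auto simp: linear_cmul[OF lin])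
  qed
  have D2: "((\<lambda>b. hv (x + a *\<^sub>R v + b *\<^sub>R w)) has_real_derivative
      frechet_derivative hv (at (x + a *\<^sub>R v + b *\<^sub>R w)) w) (at b)"
    if "0 \<le> a" "a \<le> s" "0 \<le> b" "b \<le> s" for a b
  proof -
    note dv = assms(2)[OF inb[OF that], folded hv_def]
    have lin: "linear (frechet_derivative hv (at (x + a *\<^sub>R v + b *\<^sub>R w)))"
      using dv linear_frechet_derivative by blast
    have "((\<lambda>b. hv (x + a *\<^sub>R v + b *\<^sub>R w)) has_derivative
        (\<lambda>t. frechet_derivative hv (at (x + a *\<^sub>R v + b *\<^sub>R w)) (t *\<^sub>R w))) (at b)"
      by (rule has_derivative_compose[where f="\<lambda>b. x + a *\<^sub>R v + b *\<^sub>R w", OF _ has_frechet_derivative[OF dv]])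
        (auto intro!: derivative_eq_intros)
    then show ?thesis unfolding has_field_derivative_def
      by (rule has_derivative_eq_rhs) (auto simp: linear_cmul[OF lin])
  qed
  have "\<exists>a>0. a < s \<and> \<phi> s - \<phi> 0 = (s - 0) * (hv (x + a *\<^sub>R v + s *\<^sub>R w) - hv (x + a *\<^sub>R v + 0 *\<^sub>R w))"
    by (rule MVT2[OF s(1)]) (unfold \<phi>_def, intro DERIV_diff D1, use s in auto)
  then obtain a where a: "0 < a" "a < s"
    "\<phi> s - \<phi> 0 = s * (hv (x + a *\<^sub>R v + s *\<^sub>R w) - hv (x + a *\<^sub>R v + 0 *\<^sub>R w))" by auto
  have "\<exists>b>0. b < s \<and> hv (x + a *\<^sub>R v + s *\<^sub>R w) - hv (x + a *\<^sub>R v + 0 *\<^sub>R w) =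
      (s - 0) * frechet_derivative hv (at (x + a *\<^sub>R v + b *\<^sub>R w)) w"
    by (rule MVT2[OF s(1)]) (intro D2, use a s in auto)
  then obtain b where b: "0 < b" "b < s" "hv (x + a *\<^sub>R v + s *\<^sub>R w) - hv (x + a *\<^sub>R v + 0 *\<^sub>R w) =
      s * frechet_derivative hv (at (x + a *\<^sub>R v + b *\<^sub>R w)) w" by auto
  show ?thesis
  proof (rule that[of "x + a *\<^sub>R v + b *\<^sub>R w"])
    show "norm (x + a *\<^sub>R v + b *\<^sub>R w - x) \<le> s * (norm v + norm w)"
      using near[of a b] a b by (simp add: algebra_simps)
    show "h (x + s *\<^sub>R v + s *\<^sub>R w) - h (x + s *\<^sub>R v) - h (x + s *\<^sub>R w) + h x =
      s * s * frechet_derivative (\<lambda>z. frechet_derivative h (at z) v) (at (x + a *\<^sub>R v + b *\<^sub>R w)) w"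
      using a(3) b(3) unfolding \<phi>_def hv_def by simp
  qed
qed

text \<open>
  Second derivatives are symmetric: the second difference over a small parallelogram is, by the mean
  value theorem applied in each of the two orders, a value of either mixed derivative nearby.
\<close>

lemma second_derivative_symmetric_real:
  fixes h :: "'a::euclidean_space \<Rightarrow> real"
  assumes "open S" "smooth_on S h" "x \<in> S"
  shows "frechet_derivative (\<lambda>z. frechet_derivative h (at z) v) (at x) w =
         frechet_derivative (\<lambda>z. frechet_derivative h (at z) w) (at x) v" (is "?A v w x = ?A w v x")
proof -
  obtain r where r: "r > 0" "ball x r \<subseteq> S" using assms open_contains_ball by blast
  have d: "h differentiable (at z)" "(\<lambda>z. frechet_derivative h (at z) u) differentiable (at z)"
    if "z \<in> ball x r" for z u
    using that r(2) assms(2) smooth_on_differentiable smooth_on_frechet_derivative by blast+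
  define K where "K = norm v + norm w"
  define s where "s n = r / (2 * (K + 1) * Suc n)" for n
  have K: "K \<ge> 0" unfolding K_def by simp
  have s: "s n > 0" "s n * K < r" for n
  proof -
    show "s n > 0" unfolding s_def using r K by simp
    have "K < 1 * (K + 1)" by simp
    also have "\<dots> \<le> (2 * real (Suc n)) * (K + 1)" using K by (intro mult_right_mono) auto
    finally have "K < 2 * (K + 1) * real (Suc n)" by (simp only: mult.assoc mult.commute mult.left_commute)
    then have "r * K < r * (2 * (K + 1) * real (Suc n))" using r by simp
    moreover have "2 * (K + 1) * real (Suc n) > 0" using K by (intro mult_pos_pos) auto
    ultimately show "s n * K < r" unfolding s_def by (simp add: pos_divide_less_eq)
  qed
  have "\<exists>p q. norm (p - x) \<le> s n * K \<and> norm (q - x) \<le> s n * K \<and> ?A v w p = ?A w v q" for n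
  proof -
    obtain p where p: "norm (p - x) \<le> s n * (norm v + norm w)"
      "h (x + s n *\<^sub>R v + s n *\<^sub>R w) - h (x + s n *\<^sub>R v) - h (x + s n *\<^sub>R w) + h x = s n * s n * ?A v w p"
      by (rule mean_value_second_difference[of x r h v "s n" w]) (use d s K_def in auto)
    obtain q where q: "norm (q - x) \<le> s n * (norm w + norm v)"
      "h (x + s n *\<^sub>R w + s n *\<^sub>R v) - h (x + s n *\<^sub>R w) - h (x + s n *\<^sub>R v) + h x = s n * s n * ?A w v q"
      by (rule mean_value_second_difference[of x r h w "s n" v]) (use d s K_def in \<open>auto simp: add.commute\<close>)
    have "s n * s n * ?A v w p = s n * s n * ?A w v q"
      using p(2) q(2) by (simp add: algebra_simps)
    then have "?A v w p = ?A w v q" using s(1)[of n] by simp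
    then show ?thesis using p(1) q(1) unfolding K_def by (auto simp: add.commute)
  qed
  then obtain p q where pq: "\<And>n. norm (p n - x) \<le> s n * K" "\<And>n. norm (q n - x) \<le> s n * K"
    "\<And>n. ?A v w (p n) = ?A w v (q n)" by metis
  have sK: "(\<lambda>n. s n * K) \<longlonglongrightarrow> 0"
  proof -
    have "(\<lambda>n. (r * K / (2 * (K + 1))) * (1 / Suc n)) \<longlonglongrightarrow> (r * K / (2 * (K + 1))) * 0"
      by (intro tendsto_mult tendsto_const LIMSEQ_Suc[OF lim_1_over_n])
    then show ?thesis unfolding s_def by (simp add: divide_simps)
  qed
  have lim: "p \<longlonglongrightarrow> x" "q \<longlonglongrightarrow> x"
    using Lim_null_comparison[OF _ sK, of "\<lambda>n. p n - x"] Lim_null_comparison[OF _ sK, of "\<lambda>n. q n - x"]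
      pq(1,2) by (auto simp: LIM_zero_iff)
  have c: "isCont (?A v w) x" for v w
    using assms smooth_on_frechet_derivative[OF smooth_on_frechet_derivative[OF assms(2), of v], of w]
      smooth_on_continuous_on continuous_on_eq_continuous_at by blast
  have "(\<lambda>n. ?A v w (p n)) \<longlonglongrightarrow> ?A v w x" "(\<lambda>n. ?A w v (q n)) \<longlonglongrightarrow> ?A w v x"
    using isCont_tendsto_compose[OF c] lim by blast+
  then show ?thesis using pq(3) LIMSEQ_unique by simp
qed

lemma frechet_derivative_inner_const:
  assumes "f differentiable (at x)"
  shows "frechet_derivative (\<lambda>x. f x \<bullet> u) (at x) w = frechet_derivative f (at x) w \<bullet> u"
  using frechet_derivative_bilinear[OF bounded_bilinear_inner assms, of "\<lambda>x. u" w] by simp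

lemma second_derivative_symmetric:
  assumes "open S" "smooth_on S f" "x \<in> S"
  shows "frechet_derivative (\<lambda>z. frechet_derivative f (at z) v) (at x) w =
         frechet_derivative (\<lambda>z. frechet_derivative f (at z) w) (at x) v"
proof (rule euclidean_eqI)
  fix u :: 'b
  have eq: "frechet_derivative (\<lambda>z. frechet_derivative f (at z) v) (at x) w \<bullet> u =
      frechet_derivative (\<lambda>z. frechet_derivative (\<lambda>z. f z \<bullet> u) (at z) v) (at x) w" for v w
    using frechet_derivative_cong_open[OF assms(1,3), of "\<lambda>z. frechet_derivative f (at z) v \<bullet> u"
        "\<lambda>z. frechet_derivative (\<lambda>z. f z \<bullet> u) (at z) v"]
      frechet_derivative_inner_const smooth_on_differentiable smooth_on_frechet_derivative assms
    by metis
  show "frechet_derivative (\<lambda>z. frechet_derivative f (at z) v) (at x) w \<bullet> u =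
      frechet_derivative (\<lambda>z. frechet_derivative f (at z) w) (at x) v \<bullet> u"
    unfolding eq
    by (rule second_derivative_symmetric_real[OF assms(1) _ assms(3)])
      (intro smooth_on_bilinear[OF assms(1) bounded_bilinear_inner] assms smooth_on_const)
qed

text \<open>
  The commutator of two vector fields acts as a first-order derivative, along the Lie bracket
  \<open>D\<^sub>V W - D\<^sub>W V\<close>.
\<close>

lemma field_commutator:
  assumes S: "open S" "z \<in> S" and G: "smooth_on S G" and V: "smooth_on S V" and W: "smooth_on S W"
  shows "frechet_derivative (\<lambda>z. frechet_derivative G (at z) (W z)) (at z) (V z) =
         frechet_derivative (\<lambda>z. frechet_derivative G (at z) (V z)) (at z) (W z) +
         frechet_derivative G (at z) (frechet_derivative W (at z) (V z) - frechet_derivative V (at z) (W z))"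
proof -
  let ?DD = "\<lambda>b u. frechet_derivative (\<lambda>z. frechet_derivative G (at z) b) (at z) u"
  have dG: "(\<lambda>z. frechet_derivative G (at z) b) differentiable (at z)" for b
    using smooth_on_differentiable[OF smooth_on_frechet_derivative[OF G] S(2)] .
  have Gz: "G differentiable (at y)" if "y \<in> S" for y
    using smooth_on_differentiable[OF G that] .
  have one: "frechet_derivative (\<lambda>z. frechet_derivative G (at z) (W z)) (at z) u =
      frechet_derivative G (at z) (frechet_derivative W (at z) u) + (\<Sum>b\<in>Basis. (W z \<bullet> b) *\<^sub>R ?DD b u)"
    if W: "smooth_on S W" for W :: "'a \<Rightarrow> 'a" and u
  proof -
    have dW: "W differentiable (at z)" using smooth_on_differentiable[OF W S(2)] .
    have "frechet_derivative (\<lambda>z. frechet_derivative G (at z) (W z)) (at z) u =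
        frechet_derivative (\<lambda>z. \<Sum>b\<in>Basis. (W z \<bullet> b) *\<^sub>R frechet_derivative G (at z) b) (at z) u"
      by (rule fun_cong[OF frechet_derivative_cong_open[OF S]], rule frechet_derivative_Basis[OF Gz])
    also have "\<dots> = (\<Sum>b\<in>Basis. (W z \<bullet> b) *\<^sub>R ?DD b u + (frechet_derivative W (at z) u \<bullet> b) *\<^sub>R frechet_derivative G (at z) b)"
      by (rule frechet_derivative_eqI) (intro has_derivative_sum has_derivative_scaleR
          has_derivative_inner_left has_frechet_derivative dG dW)
    finally show ?thesis
      by (simp add: sum.distrib frechet_derivative_Basis[OF Gz[OF S(2)], symmetric])
  qed
  have "(\<Sum>b\<in>Basis. (W z \<bullet> b) *\<^sub>R ?DD b (V z)) = (\<Sum>b\<in>Basis. \<Sum>b'\<in>Basis. (W z \<bullet> b) *\<^sub>R (V z \<bullet> b') *\<^sub>R ?DD b b')"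
    by (subst frechet_derivative_Basis[OF dG, of _ "V z"]) (simp add: scaleR_sum_right)
  also have "\<dots> = (\<Sum>b'\<in>Basis. \<Sum>b\<in>Basis. (V z \<bullet> b') *\<^sub>R (W z \<bullet> b) *\<^sub>R ?DD b' b)"
    by (subst sum.swap) (simp add: mult.commute second_derivative_symmetric[OF S(1) G S(2)])
  also have "\<dots> = (\<Sum>b\<in>Basis. (V z \<bullet> b) *\<^sub>R ?DD b (W z))"
    by (subst frechet_derivative_Basis[OF dG, of _ "W z"]) (simp add: scaleR_sum_right)
  finally have sym: "(\<Sum>b\<in>Basis. (W z \<bullet> b) *\<^sub>R ?DD b (V z)) = (\<Sum>b\<in>Basis. (V z \<bullet> b) *\<^sub>R ?DD b (W z))" .
  have lin: "linear (frechet_derivative G (at z))"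
    using Gz[OF S(2)] linear_frechet_derivative by blast
  show ?thesis
    unfolding one[OF W] one[OF V] sym linear_diff[OF lin] by simp
qed

section \<open>Calculus on a surface\<close>

lemma bounded_bilinear_lform: "bounded_bilinear lform"
proof -
  have "bounded_linear (\<lambda>w :: R42. (fst w, - snd w))"
    by (intro bounded_linear_Pair bounded_linear_fst bounded_linear_minus bounded_linear_snd)
  from bounded_bilinear.comp[OF bounded_bilinear_inner bounded_linear_ident this]
  show ?thesis by (simp add: lform_def[abs_def] inner_prod_def)
qed

locale surface =
  fixes A :: "('a::{t2_space, second_countable_topology}) chart set"
  assumes surf: "smooth_surface A"
begin

lemma chart_exists: "\<exists>c\<in>A. x \<in> fst c"
  using surf unfolding smooth_surface_def by auto

lemma
  assumes "c \<in> A"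
  shows chart_open: "open (fst c)"
    and chart_image_open: "open (snd c ` fst c)"
    and chart_homeo: "homeomorphism (fst c) (snd c ` fst c) (snd c) (chart_inv c)"
  using surf assms unfolding smooth_surface_def by auto

lemma chart_inv_snd: "c \<in> A \<Longrightarrow> x \<in> fst c \<Longrightarrow> chart_inv c (snd c x) = x"
  using chart_homeo homeomorphism_apply1 by metis

lemma open_chart_image:
  assumes "c \<in> A" "open U"
  shows "open (snd c ` (fst c \<inter> U))"
proof -
  have eq: "snd c ` (fst c \<inter> U) = snd c ` fst c \<inter> chart_inv c -` U"
    using chart_inv_snd[OF assms(1)] by force
  have "continuous_on (snd c ` fst c) (chart_inv c)"
    using chart_homeo[OF assms(1)] homeomorphism_cont2 by blast
  then show ?thesis
    unfolding eq using continuous_open_preimage[OF _ chart_image_open[OF assms(1)] assms(2)] by blast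
qed

lemma chart_imageE:
  assumes "c \<in> A" "z \<in> snd c ` (fst c \<inter> U)"
  shows "chart_inv c z \<in> fst c" "chart_inv c z \<in> U" "snd c (chart_inv c z) = z"
  using assms chart_inv_snd[OF assms(1)] by auto

lemma smooth_map_chart:
  assumes "smooth_map A U g" "open U" "x \<in> U" "c \<in> A" "x \<in> fst c"
  shows "g \<circ> chart_inv c differentiable (at (snd c x))"
  using assms smooth_on_differentiable unfolding smooth_map_def by blast

lemma dder_cong:
  assumes "open U" "x \<in> U" "\<And>y. y \<in> U \<Longrightarrow> g y = h y"
  shows "dder A g x v = dder A h x v"
proof -
  define c where "c = (SOME c. c \<in> A \<and> x \<in> fst c)"
  have c: "c \<in> A" "x \<in> fst c"
    using someI_ex[of "\<lambda>c. c \<in> A \<and> x \<in> fst c"] chart_exists unfolding c_def by blast+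
  have "frechet_derivative (g \<circ> chart_inv c) (at (snd c x)) = frechet_derivative (h \<circ> chart_inv c) (at (snd c x))"
    by (rule frechet_derivative_cong_open[OF open_chart_image[OF c(1) assms(1)]])
      (use assms c chart_imageE[OF c(1)] in auto)
  then show ?thesis unfolding dder_def Let_def c_def by simp
qed

lemma tangent_spaceD:
  assumes "v \<in> tangent_space A x" "c \<in> A" "c' \<in> A" "x \<in> fst c" "x \<in> fst c'"
  shows "v c' = frechet_derivative (snd c' \<circ> chart_inv c) (at (snd c x)) (v c)"
  using assms unfolding tangent_space_def by blast

text \<open>
  By the chain rule the derivative along a tangent vector can be computed in any chart, whichever
  chart its definition selects.
\<close>

lemma dder_chart:
  assumes "smooth_map A U g" "open U" "x \<in> U" "c \<in> A" "x \<in> fst c" "v \<in> tangent_space A x"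
  shows "dder A g x v = frechet_derivative (g \<circ> chart_inv c) (at (snd c x)) (v c)"
proof -
  define c' where "c' = (SOME c. c \<in> A \<and> x \<in> fst c)"
  have c': "c' \<in> A" "x \<in> fst c'"
    using someI_ex[of "\<lambda>c. c \<in> A \<and> x \<in> fst c"] chart_exists unfolding c'_def by blast+
  let ?\<tau> = "snd c' \<circ> chart_inv c"
  let ?D = "snd c ` (fst c \<inter> (fst c' \<inter> U))"
  have D: "open ?D" "snd c x \<in> ?D"
    using open_chart_image[OF assms(4) open_Int[OF chart_open[OF c'(1)] assms(2)]] assms c' by auto
  have "smooth_on (snd c ` (fst c \<inter> fst c')) ?\<tau>"
    using surf assms(4) c'(1) unfolding smooth_surface_def by blast
  then have \<tau>: "?\<tau> differentiable (at (snd c x))"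
    by (rule smooth_on_differentiable) (use assms c' in auto)
  have \<tau>x: "?\<tau> (snd c x) = snd c' x"
    using chart_inv_snd assms by simp
  have g': "g \<circ> chart_inv c' differentiable (at (snd c' x))"
    using smooth_map_chart assms c' by blast
  have "((g \<circ> chart_inv c') \<circ> ?\<tau> has_derivative
      frechet_derivative (g \<circ> chart_inv c') (at (snd c' x)) \<circ> frechet_derivative ?\<tau> (at (snd c x))) (at (snd c x))"
    using diff_chain_at[OF has_frechet_derivative[OF \<tau>]] has_frechet_derivative[OF g'] \<tau>x by metis
  then have D: "(g \<circ> chart_inv c has_derivative
      frechet_derivative (g \<circ> chart_inv c') (at (snd c' x)) \<circ> frechet_derivative ?\<tau> (at (snd c x))) (at (snd c x))"
  proof (rule has_derivative_transform_within_open[OF _ D])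
    fix z assume "z \<in> ?D"
    then have "chart_inv c z \<in> fst c'" using chart_imageE(2)[OF assms(4)] by blast
    then show "((g \<circ> chart_inv c') \<circ> ?\<tau>) z = (g \<circ> chart_inv c) z"
      by (simp add: chart_inv_snd[OF c'(1)])
  qed
  have "frechet_derivative (g \<circ> chart_inv c) (at (snd c x)) (v c) =
      (frechet_derivative (g \<circ> chart_inv c') (at (snd c' x)) \<circ> frechet_derivative ?\<tau> (at (snd c x))) (v c)"
    by (rule frechet_derivative_eqI[OF D])
  also have "\<dots> = frechet_derivative (g \<circ> chart_inv c') (at (snd c' x)) (frechet_derivative ?\<tau> (at (snd c x)) (v c))"
    by (rule comp_apply)
  also have "frechet_derivative ?\<tau> (at (snd c x)) (v c) = v c'"
    using tangent_spaceD[OF assms(6,4) c'(1) assms(5) c'(2)] by (rule sym)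
  finally show ?thesis unfolding dder_def Let_def c'_def[symmetric] by (rule sym)
qed

lemma tangent_space_scaleR:
  assumes v: "v \<in> tangent_space A x"
  shows "(\<lambda>c. r *\<^sub>R v c) \<in> tangent_space A x"
  unfolding tangent_space_def mem_Collect_eq
proof (intro conjI allI ballI impI; (elim conjE)?)
  fix c assume "c \<notin> A \<or> x \<notin> fst c"
  then have "v c = 0" using v unfolding tangent_space_def by blast
  then show "r *\<^sub>R v c = 0" by simp
next
  fix c c' assume c: "c \<in> A" "c' \<in> A" "x \<in> fst c" "x \<in> fst c'"
  have "smooth_on (snd c ` (fst c \<inter> fst c')) (snd c' \<circ> chart_inv c)"
    using surf c unfolding smooth_surface_def by blast
  then have "snd c' \<circ> chart_inv c differentiable (at (snd c x))"
    by (rule smooth_on_differentiable) (use c in auto)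
  then have "linear (frechet_derivative (snd c' \<circ> chart_inv c) (at (snd c x)))"
    by (rule linear_frechet_derivative)
  then have "frechet_derivative (snd c' \<circ> chart_inv c) (at (snd c x)) (r *\<^sub>R v c) =
      r *\<^sub>R frechet_derivative (snd c' \<circ> chart_inv c) (at (snd c x)) (v c)"
    by (rule linear_cmul)
  also have "frechet_derivative (snd c' \<circ> chart_inv c) (at (snd c x)) (v c) = v c'"
    using tangent_spaceD[OF v c] by (rule sym)
  finally show "r *\<^sub>R v c' = frechet_derivative (snd c' \<circ> chart_inv c) (at (snd c x)) (r *\<^sub>R v c)"
    by (rule sym)
qed

lemma dder_scaleR:
  assumes "smooth_map A U g" "open U" "x \<in> U" "v \<in> tangent_space A x"
  shows "dder A g x (\<lambda>c. r *\<^sub>R v c) = r *\<^sub>R dder A g x v"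
proof -
  obtain c where c: "c \<in> A" "x \<in> fst c" using chart_exists by blast
  have "linear (frechet_derivative (g \<circ> chart_inv c) (at (snd c x)))"
    using smooth_map_chart[OF assms(1-3) c] linear_frechet_derivative by blast
  then show ?thesis
    using dder_chart[OF assms(1-3) c assms(4)] dder_chart[OF assms(1-3) c tangent_space_scaleR[OF assms(4)]]
    by (simp add: linear_cmul)
qed

lemma dder_add:
  assumes "smooth_map A U g" "smooth_map A U h" "open U" "x \<in> U"
  shows "dder A (\<lambda>y. g y + h y) x v = dder A g x v + dder A h x v"
proof -
  define c where "c = (SOME c. c \<in> A \<and> x \<in> fst c)"
  have c: "c \<in> A" "x \<in> fst c"
    using someI_ex[of "\<lambda>c. c \<in> A \<and> x \<in> fst c"] chart_exists unfolding c_def by blast+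
  show ?thesis unfolding dder_def Let_def c_def[symmetric]
    using frechet_derivative_add[OF smooth_map_chart[OF assms(1,3,4) c] smooth_map_chart[OF assms(2,3,4) c]]
    by (simp add: comp_def)
qed

lemma dder_const: "dder A (\<lambda>y. k) x v = 0"
  unfolding dder_def Let_def comp_def by simp

lemma dder_bilinear:
  assumes "bounded_bilinear b" "smooth_map A U g" "smooth_map A U h" "open U" "x \<in> U"
  shows "dder A (\<lambda>y. b (g y) (h y)) x v = b (g x) (dder A h x v) + b (dder A g x v) (h x)"
proof -
  define c where "c = (SOME c. c \<in> A \<and> x \<in> fst c)"
  have c: "c \<in> A" "x \<in> fst c"
    using someI_ex[of "\<lambda>c. c \<in> A \<and> x \<in> fst c"] chart_exists unfolding c_def by blast+
  show ?thesis unfolding dder_def Let_def c_def[symmetric]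
    using frechet_derivative_bilinear[OF assms(1) smooth_map_chart[OF assms(2,4,5) c] smooth_map_chart[OF assms(3,4,5) c]]
    by (simp add: comp_def chart_inv_snd[OF c])
qed

lemma smooth_map_subset: "smooth_map A U g \<Longrightarrow> V \<subseteq> U \<Longrightarrow> smooth_map A V g"
  unfolding smooth_map_def by (meson smooth_on_subset image_mono Int_mono order_refl)

lemma smooth_map_cong:
  assumes "open U" "\<And>y. y \<in> U \<Longrightarrow> g y = h y" "smooth_map A U g"
  shows "smooth_map A U h"
  unfolding smooth_map_def
proof
  fix c assume c: "c \<in> A"
  show "smooth_on (snd c ` (fst c \<inter> U)) (h \<circ> chart_inv c)"
    by (rule smooth_on_cong[OF open_chart_image[OF c assms(1)], of "g \<circ> chart_inv c"])
      (use assms c chart_inv_snd[OF c] in \<open>auto simp: smooth_map_def\<close>)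
qed

lemma smooth_map_const: "smooth_map A U (\<lambda>y. k)"
  unfolding smooth_map_def comp_def by (simp add: smooth_on_const)

lemma smooth_map_add:
  "open U \<Longrightarrow> smooth_map A U g \<Longrightarrow> smooth_map A U h \<Longrightarrow> smooth_map A U (\<lambda>y. g y + h y)"
  unfolding smooth_map_def comp_def by (simp add: smooth_on_add open_chart_image)

lemma smooth_map_bilinear:
  assumes "open U" "bounded_bilinear b" "smooth_map A U g" "smooth_map A U h"
  shows "smooth_map A U (\<lambda>y. b (g y) (h y))"
  unfolding smooth_map_def comp_def
proof
  fix c assume c: "c \<in> A"
  show "smooth_on (snd c ` (fst c \<inter> U)) (\<lambda>z. b (g (chart_inv c z)) (h (chart_inv c z)))"
    using assms(3,4) c
    by (intro smooth_on_bilinear[OF open_chart_image[OF c assms(1)] assms(2)])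
      (simp_all add: smooth_map_def comp_def)
qed

lemma smooth_map_inverse:
  fixes g :: "'a \<Rightarrow> real"
  assumes "open U" "\<And>y. y \<in> U \<Longrightarrow> g y \<noteq> 0" "smooth_map A U g"
  shows "smooth_map A U (\<lambda>y. inverse (g y))"
  unfolding smooth_map_def
proof
  fix c assume c: "c \<in> A"
  show "smooth_on (snd c ` (fst c \<inter> U)) ((\<lambda>y. inverse (g y)) \<circ> chart_inv c)"
    using smooth_on_inverse[OF open_chart_image[OF c assms(1)], of "g \<circ> chart_inv c"]
      assms(2)[OF chart_imageE(2)[OF c]] assms(3) c by (simp add: smooth_map_def comp_def)
qed

lemma smooth_map_sqrt:
  fixes g :: "'a \<Rightarrow> real"
  assumes "open U" "\<And>y. y \<in> U \<Longrightarrow> g y > 0" "smooth_map A U g"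
  shows "smooth_map A U (\<lambda>y. sqrt (g y))"
  unfolding smooth_map_def
proof
  fix c assume c: "c \<in> A"
  show "smooth_on (snd c ` (fst c \<inter> U)) ((\<lambda>y. sqrt (g y)) \<circ> chart_inv c)"
    using smooth_on_sqrt[OF open_chart_image[OF c assms(1)], of "g \<circ> chart_inv c"]
      assms(2)[OF chart_imageE(2)[OF c]] assms(3) c by (simp add: smooth_map_def comp_def)
qed

lemma smooth_map_local:
  assumes "\<And>x. x \<in> U \<Longrightarrow> \<exists>V. open V \<and> x \<in> V \<and> smooth_map A V g"
  shows "smooth_map A U g"
proof -
  have "Ck_on k (snd c ` (fst c \<inter> U)) (g \<circ> chart_inv c)" if c: "c \<in> A" for c k
  proof -
    define W where "W = \<Union>{V. open V \<and> smooth_map A V g}"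
    have loc: "\<exists>S. open S \<and> z \<in> S \<and> smooth_on S (g \<circ> chart_inv c)" if z: "z \<in> snd c ` (fst c \<inter> U)" for z
    proof -
      obtain V where "open V" "chart_inv c z \<in> V" "smooth_map A V g"
        using assms chart_imageE(2)[OF c z] by blast
      then show ?thesis
        using c open_chart_image[OF c, of V] chart_imageE[OF c z] unfolding smooth_map_def
        by (intro exI[of _ "snd c ` (fst c \<inter> V)"]) force
    qed
    have gen: "(\<And>z. z \<in> T \<Longrightarrow> \<exists>S. open S \<and> z \<in> S \<and> Ck_on k S F) \<Longrightarrow> Ck_on k T F"
      for T and F :: "real^2 \<Rightarrow> 'b"
    proof (induction k arbitrary: F)
      case 0
      then show ?case
        by (auto intro!: continuous_at_imp_continuous_on) (metis continuous_on_eq_continuous_at)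
    next
      case (Suc k)
      show ?case unfolding Ck_on.simps
      proof (intro conjI ballI allI)
        show "F differentiable at x" if "x \<in> T" for x using Suc.prems[OF that] by auto
        show "Ck_on k T (\<lambda>x. frechet_derivative F (at x) w)" for w
          by (rule Suc.IH) (use Suc.prems in fastforce)
      qed
    qed
    show ?thesis by (rule gen) (use loc in \<open>auto simp: smooth_on_def\<close>)
  qed
  then show ?thesis unfolding smooth_map_def smooth_on_def by blast
qed

lemma smooth_map_continuous_on:
  assumes "smooth_map A U g" "open U"
  shows "continuous_on U g"
proof -
  have "isCont g x" if x: "x \<in> U" for x
  proof -
    obtain c where c: "c \<in> A" "x \<in> fst c" using chart_exists by blast
    let ?D = "snd c ` (fst c \<inter> U)"
    have "continuous_on ?D (g \<circ> chart_inv c)"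
      using assms(1) c smooth_on_continuous_on unfolding smooth_map_def by blast
    moreover have "continuous_on (fst c \<inter> U) (snd c)"
      using homeomorphism_cont1[OF chart_homeo[OF c(1)]] continuous_on_subset by blast
    ultimately have "continuous_on (fst c \<inter> U) ((g \<circ> chart_inv c) \<circ> snd c)"
      by (rule continuous_on_compose[rotated])
    then have "continuous_on (fst c \<inter> U) g"
      by (rule continuous_on_eq) (use chart_inv_snd c in auto)
    then show ?thesis
      using continuous_on_eq_continuous_at open_Int[OF chart_open[OF c(1)] assms(2)] x c(2) by blast
  qed
  then show ?thesis by (simp add: continuous_at_imp_continuous_on)
qed

lemma vector_fieldD: "vector_field A U X \<Longrightarrow> x \<in> U \<Longrightarrow> X x \<in> tangent_space A x"
  unfolding vector_field_def by blast

lemma vector_field_subset: "vector_field A U X \<Longrightarrow> V \<subseteq> U \<Longrightarrow> vector_field A V X"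
  unfolding vector_field_def by (meson smooth_on_subset image_mono Int_mono order_refl subsetD)

lemma dfield_chart:
  assumes "smooth_map A U g" "open U" "vector_field A U X" "c \<in> A" "z \<in> snd c ` (fst c \<inter> U)"
  shows "(dfield A X g \<circ> chart_inv c) z = frechet_derivative (g \<circ> chart_inv c) (at z) (X (chart_inv c z) c)"
  using dder_chart[OF assms(1,2) _ assms(4) _ vector_fieldD[OF assms(3)]] chart_imageE[OF assms(4,5)]
  by (simp add: dfield_def)

lemma smooth_map_dfield:
  assumes "smooth_map A U g" "open U" "vector_field A U X"
  shows "smooth_map A U (dfield A X g)"
  unfolding smooth_map_def
proof
  fix c assume c: "c \<in> A"
  show "smooth_on (snd c ` (fst c \<inter> U)) (dfield A X g \<circ> chart_inv c)"
  proof (rule smooth_on_cong[OF open_chart_image[OF c assms(2)]])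
    show "smooth_on (snd c ` (fst c \<inter> U))
        (\<lambda>z. frechet_derivative (g \<circ> chart_inv c) (at z) (X (chart_inv c z) c))"
      using assms c unfolding smooth_map_def vector_field_def
      by (intro smooth_on_directional open_chart_image) auto
  qed (use dfield_chart[OF assms c] in auto)
qed

text \<open>
  Vector fields \<open>X\<close> and \<open>Y\<close> that are independent at a point span the tangent plane there, so the Lie
  bracket is a linear combination of them.
\<close>

lemma dfield_commute:
  assumes g: "smooth_map A U g" and U: "open U" "x \<in> U"
    and X: "vector_field A U X" and Y: "vector_field A U Y"
    and indep: "\<And>c. c \<in> A \<Longrightarrow> x \<in> fst c \<Longrightarrow> X x c \<noteq> 0 \<and> (\<forall>r. Y x c \<noteq> r *\<^sub>R X x c)"
  shows "\<exists>p q. dfield A X (dfield A Y g) x =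
      dfield A Y (dfield A X g) x + p *\<^sub>R dfield A X g x + q *\<^sub>R dfield A Y g x"
proof -
  obtain c where c: "c \<in> A" "x \<in> fst c" using chart_exists by blast
  let ?D = "snd c ` (fst c \<inter> U)" and ?G = "g \<circ> chart_inv c" and ?z = "snd c x"
  let ?V = "\<lambda>z. X (chart_inv c z) c" and ?W = "\<lambda>z. Y (chart_inv c z) c"
  have D: "open ?D" "?z \<in> ?D" using open_chart_image[OF c(1) U(1)] U c by auto
  have sm: "smooth_on ?D ?G" "smooth_on ?D ?V" "smooth_on ?D ?W"
    using g X Y c unfolding smooth_map_def vector_field_def by auto
  have inv: "chart_inv c ?z = x" using chart_inv_snd[OF c] .
  have two: "dfield A V (dfield A W g) x =
      frechet_derivative (\<lambda>z. frechet_derivative ?G (at z) (W (chart_inv c z) c)) (at ?z) (V (chart_inv c ?z) c)"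
    if V: "vector_field A U V" and W: "vector_field A U W" for V W
  proof -
    have "dfield A V (dfield A W g) x = frechet_derivative (dfield A W g \<circ> chart_inv c) (at ?z) (V (chart_inv c ?z) c)"
      using dfield_chart[OF smooth_map_dfield[OF g U(1) W] U(1) V c(1) D(2)] inv by simp
    also have "\<dots> = frechet_derivative (\<lambda>z. frechet_derivative ?G (at z) (W (chart_inv c z) c)) (at ?z) (V (chart_inv c ?z) c)"
      by (rule fun_cong[OF frechet_derivative_cong_open[OF D]], rule dfield_chart[OF g U(1) W c(1)])
    finally show ?thesis .
  qed
  have one: "dfield A V g x = frechet_derivative ?G (at ?z) (V x c)" if V: "vector_field A U V" for V
    using dfield_chart[OF g U(1) V c(1) D(2)] inv by simp
  define w where "w = frechet_derivative ?W (at ?z) (?V ?z) - frechet_derivative ?V (at ?z) (?W ?z)"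
  have "w \<in> span {X x c, Y x c}"
  proof -
    have "independent {Y x c, X x c}" "X x c \<noteq> Y x c"
      using indep[OF c] by (auto simp: independent_insert span_singleton) (metis scaleR_one)
    then have "dim {Y x c, X x c} = 2" by (metis dim_eq_card_independent card_2_iff)
    then have "dim {Y x c, X x c} = DIM(real^2)" by simp
    then have "span {Y x c, X x c} = UNIV" using dim_eq_full by blast
    then show ?thesis by (simp add: insert_commute)
  qed
  then obtain p q where pq: "w = p *\<^sub>R X x c + q *\<^sub>R Y x c"
    by (auto simp: span_breakdown_eq algebra_simps)
  have lin: "linear (frechet_derivative ?G (at ?z))"
    using smooth_on_differentiable[OF sm(1) D(2)] linear_frechet_derivative by blast
  have "frechet_derivative ?G (at ?z) w = p *\<^sub>R dfield A X g x + q *\<^sub>R dfield A Y g x"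
    unfolding pq one[OF X] one[OF Y] by (simp add: linear_add[OF lin] linear_cmul[OF lin])
  then have "dfield A X (dfield A Y g) x =
      dfield A Y (dfield A X g) x + (p *\<^sub>R dfield A X g x + q *\<^sub>R dfield A Y g x)"
    unfolding two[OF X Y] two[OF Y X] field_commutator[OF D sm] w_def by (rule arg_cong)
  then show ?thesis by (auto simp: add.assoc)
qed

lemma dder_along_curve:
  assumes g: "smooth_map A U g" "open U" and t: "isCont \<gamma> t" "\<gamma> t \<in> U"
    and c: "c \<in> A" "\<gamma> t \<in> fst c" and v: "v \<in> tangent_space A (\<gamma> t)"
    and d: "((snd c \<circ> \<gamma>) has_vector_derivative v c) (at t)"
  shows "((g \<circ> \<gamma>) has_vector_derivative dder A g (\<gamma> t) v) (at t)"
proof -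
  have ev: "\<forall>\<^sub>F s in nhds t. \<gamma> s \<in> fst c"
    using t(1) c(2) chart_open[OF c(1)] unfolding continuous_at tendsto_def
    by (auto simp: eventually_nhds_conv_at)
  have "((g \<circ> chart_inv c) \<circ> (snd c \<circ> \<gamma>) has_vector_derivative
      frechet_derivative (g \<circ> chart_inv c) (at (snd c (\<gamma> t))) (v c)) (at t)"
  proof -
    let ?D = "frechet_derivative (g \<circ> chart_inv c) (at (snd c (\<gamma> t)))"
    have "(g \<circ> chart_inv c has_derivative ?D) (at ((snd c \<circ> \<gamma>) t))"
      using has_frechet_derivative[OF smooth_map_chart[OF g t(2) c]] by simp
    from diff_chain_at[OF d[unfolded has_vector_derivative_def] this]
    show ?thesis unfolding has_vector_derivative_def
      by (rule has_derivative_eq_rhs)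
        (use linear_cmul[OF linear_frechet_derivative[OF smooth_map_chart[OF g t(2) c]]] in auto)
  qed
  then have "((g \<circ> chart_inv c) \<circ> (snd c \<circ> \<gamma>) has_vector_derivative dder A g (\<gamma> t) v) (at t)"
    using dder_chart[OF g t(2) c v] by simp
  then show ?thesis
    by (rule has_vector_derivative_cong_ev[THEN iffD1, rotated 2])
      (use ev chart_inv_snd[OF c(1)] c in \<open>auto elim!: eventually_mono\<close>)
qed

end

section \<open>Orthogonality in signature (4,2)\<close>

lemma lform_commute: "lform u w = lform w u"
  by (simp add: lform_def inner_commute)

lemma
  shows lform_add_left: "lform (u + u') w = lform u w + lform u' w"
    and lform_add_right: "lform w (u + u') = lform w u + lform w u'"
    and lform_diff_left: "lform (u - u') w = lform u w - lform u' w"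
    and lform_diff_right: "lform w (u - u') = lform w u - lform w u'"
    and lform_minus_left: "lform (- u) w = - lform u w"
    and lform_minus_right: "lform w (- u) = - lform w u"
    and lform_scaleR_left: "lform (r *\<^sub>R u) w = r * lform u w"
    and lform_scaleR_right: "lform w (r *\<^sub>R u) = r * lform w u"
    and lform_zero_left: "lform 0 w = 0"
    and lform_zero_right: "lform w 0 = 0"
  by (simp_all add: lform_def inner_add_left inner_add_right algebra_simps)

lemmas lform_simps = lform_add_left lform_add_right lform_diff_left lform_diff_right
  lform_minus_left lform_minus_right lform_scaleR_left lform_scaleR_right lform_zero_left lform_zero_right

lemma subspace_perp: "subspace (perp W)"
  unfolding subspace_def perp_def by (auto simp: lform_simps)

lemma perp_span: "perp (span W) = perp W"
proof
  show "perp (span W) \<subseteq> perp W" unfolding perp_def using span_base by blast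
  show "perp W \<subseteq> perp (span W)"
  proof
    fix u assume u: "u \<in> perp W"
    have "lform u w = 0" if "w \<in> span W" for w
      using that by (induction rule: span_induct_alt) (use u in \<open>auto simp: lform_simps perp_def\<close>)
    then show "u \<in> perp (span W)" unfolding perp_def by blast
  qed
qed

lemma lform_span_zero:
  "w \<in> span W \<Longrightarrow> (\<And>x. x \<in> W \<Longrightarrow> lform u x = 0) \<Longrightarrow> lform u w = 0"
  using perp_span[of W] unfolding perp_def by blast

lemma lform_span_pair:
  "w \<in> span {a, b} \<Longrightarrow> lform u a = 0 \<Longrightarrow> lform u b = 0 \<Longrightarrow> lform u w = 0"
  using lform_span_zero[of w "{a, b}" u] by blast

lemma dim_perp: "dim (perp W) + dim W = 6"
proof -
  define J where "J = (\<lambda>w :: R42. (fst w, - snd w))"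
  have J: "linear J" "inj J"
    by (auto simp: J_def inj_def linear_iff prod_eq_iff)
  have "perp W = {y \<in> UNIV. \<forall>x \<in> span (J ` W). orthogonal x y}"
  proof -
    have "perp W = {y. \<forall>x \<in> J ` W. orthogonal x y}"
      by (auto simp: perp_def J_def orthogonal_def inner_prod_def lform_def inner_commute)
    moreover have "(\<forall>x \<in> span (J ` W). orthogonal x y) \<longleftrightarrow> (\<forall>x \<in> J ` W. orthogonal x y)" for y
      by (meson orthogonal_commute orthogonal_to_span span_base)
    ultimately show ?thesis by (simp only: UNIV_I simp_thms)
  qed
  then have "dim (perp W) + dim (span (J ` W)) = dim (UNIV :: R42 set)"
    using dim_subspace_orthogonal_to_vectors[of "span (J ` W)" UNIV] by simp
  moreover have "dim (J ` W) = dim W"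
    using dim_image_eq[OF J(1), of W] J(2) by (metis inj_on_subset subset_UNIV)
  ultimately show ?thesis by simp
qed

lemma lform_nondegenerate:
  assumes "\<And>w. lform u w = 0" shows "u = 0"
proof -
  have "lform u (fst u, - snd u) = fst u \<bullet> fst u + snd u \<bullet> snd u" by (simp add: lform_def)
  then have "u \<bullet> u = 0" using assms by (simp add: inner_prod_def)
  then show ?thesis by simp
qed

text \<open>Two subspaces of complementary dimension that are orthogonal are each other's complements.\<close>

lemma span_eq_perpI:
  assumes "B \<subseteq> perp W" "dim B + dim W = 6"
  shows "span B = perp W"
proof -
  have "span B = span (perp W)"
    by (rule dim_eq_span) (use assms dim_perp[of W] in auto)
  then show ?thesis using span_eq_iff subspace_perp by metis
qed

lemma in_span_pair: "w \<in> span {a, b} \<longleftrightarrow> (\<exists>x y. w = x *\<^sub>R a + y *\<^sub>R b)"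
proof
  assume "w \<in> span {a, b}"
  then obtain x y where "w - x *\<^sub>R a - y *\<^sub>R b = 0"
    by (auto simp: span_breakdown_eq)
  then show "\<exists>x y. w = x *\<^sub>R a + y *\<^sub>R b" by (metis diff_add_cancel add.commute add_0)
qed (auto intro: span_add span_scale span_base)

text \<open>A nonzero pairing witnesses independence.\<close>

lemma independent_insert_perp:
  assumes "independent B" "\<forall>b\<in>B. lform w b = 0" "lform w x \<noteq> 0"
  shows "independent (insert x B)" "x \<notin> B"
proof -
  have "x \<notin> span B" using lform_span_zero assms by blast
  then show "independent (insert x B)" "x \<notin> B"
    using assms(1) span_base by (auto simp: independent_insert)
qed

text \<open>
  On the orthogonal complement of a totally isotropic plane the form is positive definite modulo the
  plane: subtracting an element of the plane, which is a graph over the negative definite summand,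
  makes the second component vanish.
\<close>

lemma isotropic_plane_positive:
  assumes iso: "lform \<sigma> \<sigma> = 0" "lform \<tau> \<tau> = 0" "lform \<sigma> \<tau> = 0"
    and indep: "independent {\<sigma>, \<tau>}" "\<sigma> \<noteq> \<tau>"
    and u: "lform u \<sigma> = 0" "lform u \<tau> = 0" "lform u u \<le> 0"
  shows "u \<in> span {\<sigma>, \<tau>}"
proof -
  have null0: "x = 0" if "lform x x \<le> 0" "snd x = 0" for x :: R42
  proof -
    have "fst x \<bullet> fst x \<le> 0" using that by (simp add: lform_def)
    then have "fst x = 0" by (metis inner_gt_zero_iff not_less)
    then show ?thesis using that by (simp add: prod_eq_iff)
  qed
  have iso': "lform w w = 0" "lform u w = 0" if w: "w \<in> span {\<sigma>, \<tau>}" for w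
  proof -
    obtain a b where w: "w = a *\<^sub>R \<sigma> + b *\<^sub>R \<tau>"
      using w unfolding in_span_pair by blast
    show "lform w w = 0" "lform u w = 0"
      unfolding w using iso u by (simp_all add: lform_simps lform_commute[of \<tau> \<sigma>])
  qed
  have inj: "inj_on snd (span {\<sigma>, \<tau>})"
  proof -
    have "x = 0" if "x \<in> span {\<sigma>, \<tau>}" "snd x = 0" for x
      using null0[of x] iso'(1)[OF that(1)] that by simp
    then show ?thesis
      using linear_inj_on_iff_eq_0[OF linear_snd subspace_span] by blast
  qed
  have "dim (snd ` {\<sigma>, \<tau>}) = dim {\<sigma>, \<tau>}"
    by (rule dim_image_eq[OF linear_snd inj])
  also have "\<dots> = DIM(real^2)"
    using indep by (simp add: dim_eq_card_independent)
  finally have "span (snd ` {\<sigma>, \<tau>}) = (UNIV :: (real^2) set)" using dim_eq_full by blast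
  then have "snd ` span {\<sigma>, \<tau>} = (UNIV :: (real^2) set)"
    by (simp only: linear_span_image[OF linear_snd])
  then have "snd u \<in> snd ` span {\<sigma>, \<tau>}" by blast
  then obtain w where w: "w \<in> span {\<sigma>, \<tau>}" "snd w = snd u" by auto
  have "lform (u - w) (u - w) \<le> 0"
    using iso'[OF w(1)] u(3) by (simp add: lform_simps lform_commute[of w u])
  moreover have "snd (u - w) = 0" using w by simp
  ultimately have "u - w = 0" by (rule null0)
  then show ?thesis using w by simp
qed


text \<open>
  For a totally isotropic plane \<open>f = span {\<sigma>, \<tau>}\<close> the quotient \<open>f\<^sup>\<bottom> / f\<close> is a Euclidean plane. If \<open>a\<close> and
  \<open>b\<close> are orthogonal there, then \<open>P\<close>, orthogonal to \<open>b\<close>, is a multiple of \<open>a\<close>, and \<open>Q\<close>, orthogonal to \<open>a\<close>, is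
  a multiple of \<open>b\<close>.
\<close>

lemma isotropic_plane_quotient_orthogonal:
  assumes iso: "lform \<sigma> \<sigma> = 0" "lform \<tau> \<tau> = 0" "lform \<sigma> \<tau> = 0"
    and indep: "independent {\<sigma>, \<tau>}" "\<sigma> \<noteq> \<tau>"
    and a: "lform \<sigma> a = 0" "lform \<tau> a = 0" "lform a a > 0"
    and b: "lform \<sigma> b = 0" "lform \<tau> b = 0" "lform b b > 0"
    and ab: "lform a b = 0"
    and P: "lform \<sigma> P = 0" "lform \<tau> P = 0" "lform b P = 0"
    and Q: "lform \<sigma> Q = 0" "lform \<tau> Q = 0" "lform a Q = 0"
  shows "lform P Q = 0"
proof -
  define c where "c = lform a P / lform a a"
  have b1: "independent {b, \<sigma>, \<tau>}" "b \<notin> {\<sigma>, \<tau>}"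
    using independent_insert_perp[OF indep(1), of b b] b by (auto simp: lform_commute)
  have a1: "independent {a, b, \<sigma>, \<tau>}" "a \<notin> {b, \<sigma>, \<tau>}"
    using independent_insert_perp[OF b1(1), of a a] a ab by (auto simp: lform_commute)
  have card: "card {a, b, \<sigma>, \<tau>} = 4" "card {\<sigma>, \<tau>} = 2"
    using a1(2) b1(2) indep(2) by auto
  have "span {\<sigma>, \<tau>} = perp {a, b, \<sigma>, \<tau>}"
  proof (rule span_eq_perpI)
    show "{\<sigma>, \<tau>} \<subseteq> perp {a, b, \<sigma>, \<tau>}"
      using iso a b by (auto simp: perp_def lform_commute)
    show "dim {\<sigma>, \<tau>} + dim {a, b, \<sigma>, \<tau>} = 6"
      using card by (simp add: dim_eq_card_independent a1(1) indep(1))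
  qed
  moreover have "P - c *\<^sub>R a \<in> perp {a, b, \<sigma>, \<tau>}"
  proof -
    have "lform (P - c *\<^sub>R a) a = 0"
      using a(3) by (simp add: c_def lform_diff_left lform_scaleR_left lform_commute[of P a])
    moreover have "lform (P - c *\<^sub>R a) b = 0" "lform (P - c *\<^sub>R a) \<sigma> = 0" "lform (P - c *\<^sub>R a) \<tau> = 0"
      using a P ab by (simp_all add: lform_diff_left lform_scaleR_left lform_commute[of P] lform_commute[of a \<sigma>] lform_commute[of a \<tau>])
    ultimately show ?thesis unfolding perp_def by blast
  qed
  ultimately have "P - c *\<^sub>R a \<in> span {\<sigma>, \<tau>}" by blast
  then have "lform Q (P - c *\<^sub>R a) = 0"
    by (rule lform_span_pair) (use Q in \<open>simp_all add: lform_commute[of Q]\<close>)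
  then show ?thesis using Q(3) by (simp add: lform_diff_right lform_scaleR_right lform_commute[of Q])
qed

context surface
begin

lemma smooth_map_lform:
  "open U \<Longrightarrow> smooth_map A U g \<Longrightarrow> smooth_map A U h \<Longrightarrow> smooth_map A U (\<lambda>y. lform (g y) (h y))"
  by (rule smooth_map_bilinear[OF _ bounded_bilinear_lform])

section \<open>Frames of a Legendre map\<close>

text \<open>Two sections with constant product: the derivative can be moved from one to the other.\<close>

lemma dder_orthogonal:
  assumes "open U" "smooth_map A U g" "smooth_map A U h" "\<And>y. y \<in> U \<Longrightarrow> lform (g y) (h y) = k" "x \<in> U"
  shows "lform (dder A g x v) (h x) = - lform (g x) (dder A h x v)"
proof -
  have "dder A (\<lambda>y. lform (g y) (h y)) x v = dder A (\<lambda>y. k) x v"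
    by (rule dder_cong[OF assms(1,5,4)])
  then have "lform (g x) (dder A h x v) + lform (dder A g x v) (h x) = 0"
    unfolding dder_bilinear[OF bounded_bilinear_lform assms(2,3,1,5)] dder_const .
  then show ?thesis by simp
qed

lemma dfield_orthogonal:
  assumes "open U" "smooth_map A U g" "smooth_map A U h" "\<And>y. y \<in> U \<Longrightarrow> lform (g y) (h y) = k" "x \<in> U"
  shows "lform (dfield A V g x) (h x) = - lform (g x) (dfield A V h x)"
  unfolding dfield_def by (rule dder_orthogonal[OF assms])

end

text \<open>
  Local sections \<open>\<sigma>\<close> and \<open>\<tau>\<close> of the two curvature sphere congruences together with local sections \<open>X\<close>
  and \<open>Y\<close> of the corresponding curvature subbundles. The Legendre map is \<open>span {\<sigma>, \<tau>}\<close>. The conditions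
  imply the same conditions with \<open>(\<sigma>, X)\<close> and \<open>(\<tau>, Y)\<close> exchanged.
\<close>

locale legendre_frame = surface A for A :: "('a::{t2_space, second_countable_topology}) chart set" +
  fixes U :: "'a set" and \<sigma> \<tau> :: "'a \<Rightarrow> R42" and X Y :: "'a \<Rightarrow> 'a tvec"
  assumes U: "open U"
    and \<sigma>_smooth: "smooth_map A U \<sigma>" and \<tau>_smooth: "smooth_map A U \<tau>"
    and X: "vector_field A U X" and Y: "vector_field A U Y"
    and null: "y \<in> U \<Longrightarrow> lform (\<sigma> y) (\<sigma> y) = 0" "y \<in> U \<Longrightarrow> lform (\<tau> y) (\<tau> y) = 0"
      "y \<in> U \<Longrightarrow> lform (\<sigma> y) (\<tau> y) = 0"
    and indep: "y \<in> U \<Longrightarrow> independent {\<sigma> y, \<tau> y}" "y \<in> U \<Longrightarrow> \<sigma> y \<noteq> \<tau> y"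
    and contact: "y \<in> U \<Longrightarrow> lform (dfield A X \<sigma> y) (\<tau> y) = 0" "y \<in> U \<Longrightarrow> lform (dfield A Y \<sigma> y) (\<tau> y) = 0"
    and curvature: "y \<in> U \<Longrightarrow> dfield A X \<sigma> y \<in> span {\<sigma> y, \<tau> y}" "y \<in> U \<Longrightarrow> dfield A Y \<tau> y \<in> span {\<sigma> y, \<tau> y}"
    and immersed: "y \<in> U \<Longrightarrow> dfield A Y \<sigma> y \<notin> span {\<sigma> y, \<tau> y}" "y \<in> U \<Longrightarrow> dfield A X \<tau> y \<notin> span {\<sigma> y, \<tau> y}"
    and regular: "y \<in> U \<Longrightarrow> dfield A X \<sigma> y \<notin> span {\<sigma> y}" "y \<in> U \<Longrightarrow> dfield A Y \<tau> y \<notin> span {\<tau> y}"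
begin

lemma swap: "legendre_frame A U \<tau> \<sigma> Y X"
proof
  have com: "{\<tau> y, \<sigma> y} = {\<sigma> y, \<tau> y}" for y by auto
  show "lform (dfield A Y \<tau> y) (\<sigma> y) = 0" "lform (dfield A X \<tau> y) (\<sigma> y) = 0" if "y \<in> U" for y
    using dfield_orthogonal[OF U \<sigma>_smooth \<tau>_smooth null(3) that] contact[OF that]
    by (simp_all add: lform_commute)
  show "lform (\<tau> y) (\<sigma> y) = 0" "independent {\<tau> y, \<sigma> y}" "\<tau> y \<noteq> \<sigma> y"
    "dfield A Y \<tau> y \<in> span {\<tau> y, \<sigma> y}" "dfield A X \<sigma> y \<in> span {\<tau> y, \<sigma> y}"
    "dfield A X \<tau> y \<notin> span {\<tau> y, \<sigma> y}" "dfield A Y \<sigma> y \<notin> span {\<tau> y, \<sigma> y}" if "y \<in> U" for y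
    unfolding com using null(3)[OF that] indep[OF that] curvature[OF that] immersed[OF that]
    by (simp_all add: lform_commute)
qed (use U \<sigma>_smooth \<tau>_smooth X Y null regular in blast)+

text \<open>
  The osculating complexes are spanned by \<open>\<sigma>\<close>, \<open>a\<close>, \<open>a2\<close> and by \<open>\<tau>\<close>, \<open>b\<close>, \<open>b2\<close> respectively; the third
  derivative \<open>b3\<close> singles out the osculating sphere complex in the former.
\<close>

abbreviation a where "a \<equiv> dfield A Y \<sigma>"
abbreviation a2 where "a2 \<equiv> dfield A Y a"
abbreviation b where "b \<equiv> dfield A X \<tau>"
abbreviation b2 where "b2 \<equiv> dfield A X b"
abbreviation b3 where "b3 \<equiv> dfield A X b2"

lemma smooth_X: "smooth_map A U g \<Longrightarrow> smooth_map A U (dfield A X g)"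
  and smooth_Y: "smooth_map A U g \<Longrightarrow> smooth_map A U (dfield A Y g)"
  using smooth_map_dfield U X Y by blast+

lemma orth: "smooth_map A U g \<Longrightarrow> smooth_map A U h \<Longrightarrow> (\<And>y. y \<in> U \<Longrightarrow> lform (g y) (h y) = 0) \<Longrightarrow>
    y \<in> U \<Longrightarrow> lform (dfield A V g y) (h y) = - lform (g y) (dfield A V h y)"
  by (rule dfield_orthogonal[OF U])

lemma commute:
  assumes "smooth_map A U g" "y \<in> U"
  obtains p q where "dfield A X (dfield A Y g) y =
      dfield A Y (dfield A X g) y + p *\<^sub>R dfield A X g y + q *\<^sub>R dfield A Y g y"
proof -
  have "X y c \<noteq> 0 \<and> (\<forall>r. Y y c \<noteq> r *\<^sub>R X y c)" if c: "c \<in> A" "y \<in> fst c" for c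
  proof (intro conjI allI notI)
    note dc = dder_chart[OF _ U assms(2) c vector_fieldD[OF _ assms(2)]]
    have lin: "linear (frechet_derivative (g \<circ> chart_inv c) (at (snd c y)))" if "smooth_map A U g" for g :: "'a \<Rightarrow> R42"
      using smooth_map_chart[OF that U assms(2) c] by (rule linear_frechet_derivative)
    {
      assume "X y c = 0"
      then have "b y = 0" unfolding dfield_def dc[OF \<tau>_smooth X] by (simp add: linear_0[OF lin[OF \<tau>_smooth]])
      then show False using immersed(2)[OF assms(2)] by (simp add: span_0)
    next
      fix r assume r: "Y y c = r *\<^sub>R X y c"
      have "a y = r *\<^sub>R dfield A X \<sigma> y"
        unfolding dfield_def dc[OF \<sigma>_smooth X] dc[OF \<sigma>_smooth Y] r by (simp add: linear_cmul[OF lin[OF \<sigma>_smooth]])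
      then show False using immersed(1)[OF assms(2)] curvature(1)[OF assms(2)] by (simp add: span_scale)
    }
  qed
  then show ?thesis using dfield_commute[OF assms(1) U assms(2) X Y] that by blast
qed

lemma frame_a: "y \<in> U \<Longrightarrow> lform (\<sigma> y) (a y) = 0" "y \<in> U \<Longrightarrow> lform (\<tau> y) (a y) = 0"
  using orth[OF \<sigma>_smooth \<sigma>_smooth null(1), of y Y] contact(2) by (auto simp: lform_commute)

text \<open>
  For a section \<open>\<rho>\<close> of the Legendre map, the derivative of \<open>\<rho>\<close> along \<open>Y\<close> is orthogonal to \<open>b\<close>. Indeed,
  differentiating the orthogonality of \<open>\<rho>\<close> to the derivatives of \<open>\<tau>\<close> and exchanging the order of
  differentiation, the product equals that of the derivative of \<open>\<rho>\<close> along \<open>X\<close> with the derivative of \<open>\<tau>\<close>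
  along \<open>Y\<close>, which is a section of the Legendre map and hence orthogonal to derivatives of \<open>\<rho>\<close>.
\<close>

lemma section_derivative:
  assumes \<rho>: "smooth_map A U \<rho>" "\<And>y. y \<in> U \<Longrightarrow> \<rho> y \<in> span {\<sigma> y, \<tau> y}" and y: "y \<in> U"
    and b: "\<And>y. y \<in> U \<Longrightarrow> lform (\<sigma> y) (b y) = 0" "\<And>y. y \<in> U \<Longrightarrow> lform (\<tau> y) (b y) = 0"
  shows "lform (\<sigma> y) (dfield A Y \<rho> y) = 0" "lform (\<tau> y) (dfield A Y \<rho> y) = 0" 
    "lform (b y) (dfield A Y \<rho> y) = 0"
proof -
  have z: "lform u (\<rho> y) = 0" if "y \<in> U" "lform u (\<sigma> y) = 0" "lform u (\<tau> y) = 0" for u y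
    using lform_span_pair[OF \<rho>(2)[OF that(1)]] that by blast
  have \<rho>0: "lform (\<sigma> y) (\<rho> y) = 0" "lform (\<tau> y) (\<rho> y) = 0" "lform (b y) (\<rho> y) = 0"
    "lform (a y) (\<rho> y) = 0" "lform (dfield A Y \<tau> y) (\<rho> y) = 0" if "y \<in> U" for y
  proof -
    show "lform (\<sigma> y) (\<rho> y) = 0" "lform (\<tau> y) (\<rho> y) = 0" "lform (b y) (\<rho> y) = 0" "lform (a y) (\<rho> y) = 0"
      by (rule z[OF that]; use null[OF that] b[OF that] frame_a[OF that] in
          \<open>simp add: lform_commute[of "\<tau> y" "\<sigma> y"] lform_commute[of "b y" "\<sigma> y"]
            lform_commute[of "a y" "\<sigma> y"] lform_commute[of "b y" "\<tau> y"] lform_commute[of "a y" "\<tau> y"]\<close>)+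
    then show "lform (dfield A Y \<tau> y) (\<rho> y) = 0"
      using lform_span_pair[OF curvature(2)[OF that], of "\<rho> y"] by (auto simp: lform_commute)
  qed
  have sY: "lform (\<sigma> y) (dfield A V \<rho> y) = 0" "lform (\<tau> y) (dfield A V \<rho> y) = 0" if "V \<in> {X, Y}" for V
  proof -
    have "lform (dfield A V \<sigma> y) (\<rho> y) = 0"
    proof (rule z[OF y])
      show "lform (dfield A V \<sigma> y) (\<sigma> y) = 0"
        using orth[OF \<sigma>_smooth \<sigma>_smooth null(1) y, of V] by (simp add: lform_commute)
      show "lform (dfield A V \<sigma> y) (\<tau> y) = 0" using contact y that by auto
    qed
    then show "lform (\<sigma> y) (dfield A V \<rho> y) = 0" using orth[OF \<sigma>_smooth \<rho>(1) \<rho>0(1) y, of V] by simp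
    have "lform (dfield A V \<tau> y) (\<rho> y) = 0" using that \<rho>0 y by auto
    then show "lform (\<tau> y) (dfield A V \<rho> y) = 0" using orth[OF \<tau>_smooth \<rho>(1) \<rho>0(2) y, of V] by simp
  qed
  show "lform (\<sigma> y) (dfield A Y \<rho> y) = 0" "lform (\<tau> y) (dfield A Y \<rho> y) = 0" using sY by auto
  have "lform (b y) (dfield A Y \<rho> y) = - lform (dfield A Y b y) (\<rho> y)"
    using orth[OF smooth_X[OF \<tau>_smooth] \<rho>(1) \<rho>0(3) y, of Y] by simp
  also have "lform (dfield A Y b y) (\<rho> y) = lform (dfield A X (dfield A Y \<tau>) y) (\<rho> y)"
  proof -
    obtain p q where "dfield A X (dfield A Y \<tau>) y = dfield A Y b y + p *\<^sub>R b y + q *\<^sub>R dfield A Y \<tau> y"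
      using commute[OF \<tau>_smooth y] .
    then show ?thesis using \<rho>0[OF y] by (simp add: lform_simps)
  qed
  also have "- \<dots> = lform (dfield A Y \<tau> y) (dfield A X \<rho> y)"
    using orth[OF smooth_Y[OF \<tau>_smooth] \<rho>(1) \<rho>0(5) y, of X] by simp
  also have "\<dots> = lform (dfield A X \<rho> y) (dfield A Y \<tau> y)" by (rule lform_commute)
  also have "\<dots> = 0"
    using lform_span_pair[OF curvature(2)[OF y], of "dfield A X \<rho> y"] sY[of X] by (auto simp: lform_commute)
  finally show "lform (b y) (dfield A Y \<rho> y) = 0" .
qed

end

text \<open>
  A frame together with the frame obtained by exchanging the two curvature directions, so that each
  fact about one direction is available for the other one as well.
\<close>

locale legendre_frame_pair = legendre_frame A U \<sigma> \<tau> X Y + swapped: legendre_frame A U \<tau> \<sigma> Y X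
  for A :: "('a::{t2_space, second_countable_topology}) chart set" and U \<sigma> \<tau> X Y
begin

lemmas frame_b = swapped.frame_a(2) swapped.frame_a(1)

lemma frame_b2_\<sigma>: "y \<in> U \<Longrightarrow> lform (\<sigma> y) (b2 y) = 0"
proof -
  assume y: "y \<in> U"
  have "lform (b y) (dfield A X \<sigma> y) = 0"
    using lform_span_pair[OF curvature(1)[OF y], of "b y"] frame_b[OF y] by (auto simp: lform_commute)
  then show ?thesis
    using orth[OF \<sigma>_smooth smooth_X[OF \<tau>_smooth] frame_b(1) y, of X] by (simp add: lform_commute)
qed

lemma frame_b2_\<tau>: "y \<in> U \<Longrightarrow> lform (\<tau> y) (b2 y) = - lform (b y) (b y)"
  using orth[OF \<tau>_smooth smooth_X[OF \<tau>_smooth] frame_b(2), of y X] by simp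

lemma b_spacelike: "y \<in> U \<Longrightarrow> lform (b y) (b y) > 0"
  using isotropic_plane_positive[OF null indep, of y "b y"] frame_b immersed(2)
  by (force simp: lform_commute)

lemma frame_ab: "y \<in> U \<Longrightarrow> lform (a y) (b y) = 0"
  using section_derivative(3)[OF \<sigma>_smooth _ _ frame_b, of y]
  by (auto simp: lform_commute span_base)

text \<open>
  The mixed derivative of \<open>\<sigma>\<close> is orthogonal to the Legendre map and to \<open>b\<close>: up to a combination of first
  derivatives of \<open>\<sigma>\<close> it is the derivative along \<open>Y\<close> of a section of the Legendre map.
\<close>

lemma mixed_derivative:
  assumes y: "y \<in> U"
  shows "lform (\<sigma> y) (dfield A X a y) = 0" "lform (\<tau> y) (dfield A X a y) = 0" "lform (b y) (dfield A X a y) = 0"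
proof -
  obtain p q where pq: "dfield A X a y = dfield A Y (dfield A X \<sigma>) y + p *\<^sub>R dfield A X \<sigma> y + q *\<^sub>R a y"
    using commute[OF \<sigma>_smooth y] .
  note sd = section_derivative[OF smooth_X[OF \<sigma>_smooth] curvature(1) y frame_b]
  have 1: "lform u (dfield A X \<sigma> y) = 0" if "lform u (\<sigma> y) = 0" "lform u (\<tau> y) = 0" for u
    using lform_span_pair[OF curvature(1)[OF y], of u] that by auto
  show "lform (\<sigma> y) (dfield A X a y) = 0" "lform (\<tau> y) (dfield A X a y) = 0" "lform (b y) (dfield A X a y) = 0"
    unfolding pq using sd frame_a[OF y] frame_ab[OF y] null[OF y] frame_b[OF y]
      1[of "\<sigma> y"] 1[of "\<tau> y"] 1[of "b y"]
    by (simp_all add: lform_simps lform_commute)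
qed

lemma frame_ab2: "y \<in> U \<Longrightarrow> lform (a y) (b2 y) = 0"
  using orth[OF smooth_Y[OF \<sigma>_smooth] smooth_X[OF \<tau>_smooth] frame_ab, of y X] mixed_derivative(3)[of y]
  by (simp add: lform_commute)

end

context legendre_frame_pair
begin

lemma pair_swap: "legendre_frame_pair A U \<tau> \<sigma> Y X"
  by (simp add: legendre_frame_pair_def swap swapped.swap)

interpretation sw: legendre_frame_pair A U \<tau> \<sigma> Y X by (rule pair_swap)

text \<open>
  The last of the orthogonality relations between the two osculating complexes. Moving derivatives
  reduces it to the product of the mixed derivatives of \<open>\<sigma>\<close> and \<open>\<tau>\<close>, which are, modulo the Legendre map,
  multiples of the orthogonal vectors \<open>a\<close> and \<open>b\<close>.
\<close>

lemma frame_a2b2: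
  assumes y: "y \<in> U"
  shows "lform (a2 y) (b2 y) = 0"
proof -
  let ?Yb = "dfield A Y b"
  have aYb: "lform (a y) (?Yb y) = 0" if "y \<in> U" for y
    using orth[OF smooth_Y[OF \<sigma>_smooth] smooth_X[OF \<tau>_smooth] frame_ab that, of Y] sw.frame_ab2[OF that]
    by (simp add: lform_commute)
  have sm: "smooth_map A U a" "smooth_map A U b" "smooth_map A U ?Yb" "smooth_map A U b2"
    using smooth_X smooth_Y \<sigma>_smooth \<tau>_smooth by blast+
  obtain p q where "dfield A X ?Yb y = dfield A Y b2 y + p *\<^sub>R b2 y + q *\<^sub>R ?Yb y"
    using commute[OF sm(2) y] .
  then have "lform (a y) (dfield A Y b2 y) = lform (a y) (dfield A X ?Yb y)"
    using frame_ab2[OF y] aYb[OF y] by (simp add: lform_simps)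
  also have "\<dots> = - lform (dfield A X a y) (?Yb y)"
    using orth[OF sm(1,3) aYb y, of X] by simp
  also have "lform (dfield A X a y) (?Yb y) = 0"
    by (rule isotropic_plane_quotient_orthogonal[OF null[OF y] indep[OF y], of "a y" "b y"])
      (use frame_a[OF y] frame_b[OF y] sw.b_spacelike[OF y] b_spacelike[OF y] frame_ab[OF y]
        mixed_derivative[OF y] sw.mixed_derivative[OF y] in auto)
  finally show ?thesis using orth[OF sm(1,4) frame_ab2 y, of Y] by simp
qed

lemma indep_b: 
  assumes y: "y \<in> U"
  shows "independent {b2 y, b y, \<tau> y}" "card {b2 y, b y, \<tau> y} = 3"
proof -
  have 1: "independent {\<tau> y}" using indep(1)[OF y] independent_mono by blast
  have 2: "independent {b y, \<tau> y}" "b y \<notin> {\<tau> y}"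
    using independent_insert_perp[OF 1, of "b y" "b y"] b_spacelike[OF y] frame_b[OF y] by (auto simp: lform_commute)
  have 3: "independent {b2 y, b y, \<tau> y}" "b2 y \<notin> {b y, \<tau> y}"
    using independent_insert_perp[OF 2(1), of "\<tau> y" "b2 y"] b_spacelike[OF y] frame_b[OF y] frame_b2_\<tau>[OF y] null[OF y]
    by (auto simp: lform_commute)
  show "independent {b2 y, b y, \<tau> y}" "card {b2 y, b y, \<tau> y} = 3" using 2 3 by auto
qed

lemma osculating_span:
  assumes y: "y \<in> U"
  shows "span {\<sigma> y, a y, a2 y} = perp {\<tau> y, b y, b2 y}"
proof (rule span_eq_perpI)
  show "{\<sigma> y, a y, a2 y} \<subseteq> perp {\<tau> y, b y, b2 y}"
    using null[OF y] frame_a[OF y] frame_b[OF y] frame_ab[OF y] frame_ab2[OF y] frame_b2_\<sigma>[OF y]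
      sw.frame_ab2[OF y] sw.frame_b2_\<sigma>[OF y] frame_a2b2[OF y]
    by (auto simp: perp_def lform_commute)
  have "{\<sigma> y, a y, a2 y} = {a2 y, a y, \<sigma> y}" "{\<tau> y, b y, b2 y} = {b2 y, b y, \<tau> y}" by auto
  then show "dim {\<sigma> y, a y, a2 y} + dim {\<tau> y, b y, b2 y} = 6"
    using indep_b[OF y] legendre_frame_pair.indep_b[OF pair_swap y] by (simp add: dim_eq_card_independent)
qed

text \<open>
  The Gram matrix of \<open>\<sigma>\<close>, \<open>a\<close>, \<open>a2\<close> is triangular with respect to the antidiagonal, whose entries are
  nonzero.
\<close>

lemma osculating_nondegenerate:
  assumes y: "y \<in> U" and u: "u \<in> span {\<sigma> y, a y, a2 y}" "u \<in> perp (span {\<sigma> y, a y, a2 y})"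
  shows "u = 0"
proof -
  obtain c d e where u': "u = c *\<^sub>R \<sigma> y + d *\<^sub>R a y + e *\<^sub>R a2 y"
  proof -
    obtain c d e where "u - c *\<^sub>R \<sigma> y - d *\<^sub>R a y - e *\<^sub>R a2 y = 0"
      using u(1) by (auto simp: span_breakdown_eq)
    then have "u = c *\<^sub>R \<sigma> y + d *\<^sub>R a y + e *\<^sub>R a2 y" by (simp add: algebra_simps)
    then show ?thesis by (rule that)
  qed
  have z: "lform u (\<sigma> y) = 0" "lform u (a y) = 0" "lform u (a2 y) = 0"
    using u(2) unfolding perp_span by (auto simp: perp_def)
  have g: "lform (a y) (a y) > 0" "lform (\<sigma> y) (a2 y) = - lform (a y) (a y)"
    using sw.b_spacelike[OF y] sw.frame_b2_\<tau>[OF y] by auto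
  have "e = 0" using z(1) g null[OF y] frame_a[OF y] unfolding u' by (simp add: lform_simps lform_commute)
  then have "d = 0" using z(2) g frame_a[OF y] unfolding u' by (simp add: lform_simps lform_commute)
  then have "c = 0" using z(3) g \<open>e = 0\<close> unfolding u' by (simp add: lform_simps lform_commute)
  then show ?thesis using \<open>e = 0\<close> \<open>d = 0\<close> u' by simp
qed

lemma frame_b3: "y \<in> U \<Longrightarrow> lform (\<sigma> y) (b3 y) \<noteq> 0"
proof -
  assume y: "y \<in> U"
  obtain \<alpha> \<beta> where ab: "dfield A X \<sigma> y = \<alpha> *\<^sub>R \<sigma> y + \<beta> *\<^sub>R \<tau> y"
    using curvature(1)[OF y] unfolding in_span_pair by blast
  then have "\<beta> \<noteq> 0" using regular(1)[OF y] by (auto simp: span_singleton)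
  moreover have "lform (\<sigma> y) (b3 y) = - lform (dfield A X \<sigma> y) (b2 y)"
    using orth[OF \<sigma>_smooth smooth_X[OF smooth_X[OF \<tau>_smooth]] frame_b2_\<sigma> y, of X] by simp
  ultimately show ?thesis
    using b_spacelike[OF y] frame_b2_\<sigma>[OF y] frame_b2_\<tau>[OF y] unfolding ab by (simp add: lform_simps)
qed

text \<open>
  The orthogonal complement of \<open>F\<close> is the osculating sphere complex. Only derivatives along \<open>X\<close> occur.
\<close>

abbreviation F where "F y \<equiv> {\<sigma> y, \<tau> y, b y, b2 y, b3 y}"

text \<open>
  If \<open>l\<close> is a spacelike vector orthogonal to \<open>F\<close>, then omitting \<open>b3\<close> from \<open>F\<close> enlarges the complement
  \<open>span {l}\<close> by \<open>\<sigma>\<close> only.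
\<close>

lemma perp_F_unique:
  assumes y: "y \<in> U" and l: "l \<in> perp (F y)" "lform l l > 0" and m: "m \<in> perp {\<sigma> y, \<tau> y, b y, b2 y}"
  obtains k r where "m = k *\<^sub>R \<sigma> y + r *\<^sub>R l" "lform m (b3 y) = 0 \<Longrightarrow> k = 0"
proof -
  have \<sigma>l: "lform (\<sigma> y) l = 0" using l(1) by (auto simp: perp_def lform_commute)
  have "independent {\<sigma> y}" using independent_mono[OF indep(1)[OF y]] by blast
  then have i: "independent {l, \<sigma> y}" "l \<notin> {\<sigma> y}"
    using independent_insert_perp[of "{\<sigma> y}" l l] l(2) \<sigma>l by (auto simp: lform_commute)
  have "independent {b y, \<sigma> y, \<tau> y}" "b y \<notin> {\<sigma> y, \<tau> y}"
    using independent_insert_perp[OF indep(1)[OF y], of "b y" "b y"] b_spacelike[OF y] frame_b[OF y]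
    by (auto simp: lform_commute)
  moreover from this have "independent {b2 y, b y, \<sigma> y, \<tau> y}" "b2 y \<notin> {b y, \<sigma> y, \<tau> y}"
    using independent_insert_perp[of "{b y, \<sigma> y, \<tau> y}" "\<tau> y" "b2 y"] b_spacelike[OF y] frame_b[OF y]
      frame_b2_\<tau>[OF y] null[OF y] by (auto simp: lform_commute)
  ultimately have d: "dim {b2 y, b y, \<sigma> y, \<tau> y} = 4"
    using indep(2)[OF y] by (subst dim_eq_card_independent) auto
  have eq: "{\<sigma> y, \<tau> y, b y, b2 y} = {b2 y, b y, \<sigma> y, \<tau> y}" by auto
  have "span {l, \<sigma> y} = perp {\<sigma> y, \<tau> y, b y, b2 y}"
  proof (rule span_eq_perpI)
    show "{l, \<sigma> y} \<subseteq> perp {\<sigma> y, \<tau> y, b y, b2 y}"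
      using l(1) null[OF y] frame_b[OF y] frame_b2_\<sigma>[OF y] by (auto simp: perp_def)
    show "dim {l, \<sigma> y} + dim {\<sigma> y, \<tau> y, b y, b2 y} = 6"
      unfolding eq d using i by (simp add: dim_eq_card_independent)
  qed
  then obtain r k where mm: "m = r *\<^sub>R l + k *\<^sub>R \<sigma> y" using m in_span_pair by blast
  show ?thesis
  proof (rule that[of k r])
    show "m = k *\<^sub>R \<sigma> y + r *\<^sub>R l" using mm by simp
    have "lform l (b3 y) = 0" using l(1) by (auto simp: perp_def)
    then show "k = 0" if "lform m (b3 y) = 0"
      using that frame_b3[OF y] unfolding mm by (simp add: lform_simps)
  qed
qed

text \<open>
  Orthogonality to \<open>F\<close> follows when a section of the osculating complex and its derivatives stay in that
  complex: the derivative along \<open>X\<close> yields orthogonality to \<open>b3\<close>, and the derivative along \<open>Y\<close>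
  orthogonality to \<open>\<sigma>\<close>, because the derivative of \<open>\<tau>\<close> along \<open>Y\<close> has a nonzero component along \<open>\<sigma>\<close>.
\<close>

lemma osculating_section_perp_F:
  assumes V: "open V" "V \<subseteq> U" "y \<in> V" and \<xi>: "smooth_map A V \<xi>"
    "\<And>z. z \<in> V \<Longrightarrow> \<xi> z \<in> perp {\<tau> z, b z, b2 z}"
    and d: "dfield A X \<xi> y \<in> perp {\<tau> y, b y, b2 y}" "dfield A Y \<xi> y \<in> perp {\<tau> y, b y, b2 y}"
  shows "\<xi> y \<in> perp (F y)"
proof -
  have y: "y \<in> U" using V by blast
  have sm: "smooth_map A V \<tau>" "smooth_map A V b2"
    using smooth_map_subset[OF _ V(2)] smooth_X \<tau>_smooth by blast+
  have 0: "lform (\<xi> z) (\<tau> z) = 0" "lform (\<xi> z) (b z) = 0" "lform (\<xi> z) (b2 z) = 0" if "z \<in> V" for z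
    using \<xi>(2)[OF that] by (auto simp: perp_def)
  have 3: "lform (\<xi> y) (b3 y) = 0"
    using dfield_orthogonal[OF V(1) \<xi>(1) sm(2) 0(3) V(3), of X] d(1) by (auto simp: perp_def)
  have "lform (\<xi> y) (dfield A Y \<tau> y) = 0"
    using dfield_orthogonal[OF V(1) \<xi>(1) sm(1) 0(1) V(3), of Y] d(2) by (auto simp: perp_def)
  moreover obtain \<gamma> \<delta> where gd: "dfield A Y \<tau> y = \<gamma> *\<^sub>R \<sigma> y + \<delta> *\<^sub>R \<tau> y"
    using curvature(2)[OF y] unfolding in_span_pair by blast
  moreover have "\<gamma> \<noteq> 0" using regular(2)[OF y] gd by (auto simp: span_singleton)
  ultimately have "lform (\<xi> y) (\<sigma> y) = 0" using 0(1)[OF V(3)] by (simp add: lform_simps)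
  then show ?thesis using 0[OF V(3)] 3 by (auto simp: perp_def)
qed

text \<open>
  Conversely, a section orthogonal to the Legendre map that is constant, as a line, along the
  curvature lines belongs to the osculating sphere complex.
\<close>

lemma parallel_perp_F:
  assumes V: "open V" "V \<subseteq> U" "y \<in> V" and m: "smooth_map A V m"
    "\<And>z. z \<in> V \<Longrightarrow> lform (m z) (\<sigma> z) = 0" "\<And>z. z \<in> V \<Longrightarrow> lform (m z) (\<tau> z) = 0"
    and d: "\<And>z. z \<in> V \<Longrightarrow> dfield A X m z \<in> span {m z}"
  shows "m y \<in> perp (F y)"
proof -
  have step: "lform (m z) (dfield A X g z) = 0"
    if g: "smooth_map A U g" "\<And>z. z \<in> V \<Longrightarrow> lform (m z) (g z) = 0" and z: "z \<in> V" for g z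
  proof -
    obtain r where "dfield A X m z = r *\<^sub>R m z" using d[OF z] by (auto simp: span_singleton)
    then show ?thesis
      using dfield_orthogonal[OF V(1) m(1) smooth_map_subset[OF g(1) V(2)] g(2) z, of X] g(2)[OF z]
      by (simp add: lform_simps)
  qed
  have sm: "smooth_map A U b" "smooth_map A U b2" using smooth_X \<tau>_smooth by blast+
  have 1: "lform (m z) (b z) = 0" if "z \<in> V" for z by (rule step[OF \<tau>_smooth m(3) that])
  have 2: "lform (m z) (b2 z) = 0" if "z \<in> V" for z by (rule step[OF sm(1) 1 that])
  have 3: "lform (m z) (b3 z) = 0" if "z \<in> V" for z by (rule step[OF sm(2) 2 that])
  show ?thesis using m 1 2 3 V(3) by (auto simp: perp_def)
qed

text \<open>
  If the osculating sphere complex lies in a fixed hyperplane then it is constant along the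
  curvature lines; otherwise the normal of the hyperplane would belong to the complex.
\<close>

lemma hyperplane_imp_parallel:
  assumes V: "open V" "V \<subseteq> U" "y \<in> V" and e: "smooth_map A V e"
    "\<And>z. z \<in> V \<Longrightarrow> e z \<in> perp (F z)" "\<And>z. z \<in> V \<Longrightarrow> lform (e z) (e z) > 0"
    and q: "q \<noteq> 0" "\<And>z. z \<in> V \<Longrightarrow> lform (e z) q = 0"
  shows "dfield A X e y \<in> span {e y}"
proof -
  have XV: "vector_field A V X" using vector_field_subset[OF X V(2)] .
  have smV: "smooth_map A V g" if "smooth_map A U g" for g :: "'a \<Rightarrow> R42"
    using smooth_map_subset[OF that V(2)] .
  have sm: "smooth_map A U b" "smooth_map A U b2" "smooth_map A U b3" using smooth_X \<tau>_smooth by blast+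
  have de: "dfield A X e z \<in> perp {\<sigma> z, \<tau> z, b z, b2 z}" if z: "z \<in> V" for z
  proof -
    have zU: "z \<in> U" using z V by blast
    have 0: "lform (e z) (\<sigma> z) = 0" "lform (e z) (\<tau> z) = 0" "lform (e z) (b z) = 0"
      "lform (e z) (b2 z) = 0" "lform (e z) (b3 z) = 0" if "z \<in> V" for z
      using e(2)[OF that] by (auto simp: perp_def)
    have "lform (dfield A X e z) (\<sigma> z) = 0"
      using dfield_orthogonal[OF V(1) e(1) smV[OF \<sigma>_smooth] 0(1) z, of X]
        lform_span_pair[OF curvature(1)[OF zU], of "e z"] 0(1,2)[OF z] by auto
    then show ?thesis
      using dfield_orthogonal[OF V(1) e(1) smV[OF \<tau>_smooth] 0(2) z, of X]
        dfield_orthogonal[OF V(1) e(1) smV[OF sm(1)] 0(3) z, of X]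
        dfield_orthogonal[OF V(1) e(1) smV[OF sm(2)] 0(4) z, of X] 0[OF z] by (auto simp: perp_def)
  qed
  have dec: "\<exists>k r. dfield A X e z = k *\<^sub>R \<sigma> z + r *\<^sub>R e z \<and> (lform (dfield A X e z) (b3 z) = 0 \<longrightarrow> k = 0)"
    if z: "z \<in> V" for z
    using perp_F_unique[OF _ e(2)[OF z] e(3)[OF z] de[OF z]] z V(2) by blast
  show ?thesis
  proof (cases "lform (dfield A X e y) (b3 y) = 0")
    case True
    then show ?thesis using dec[OF V(3)] by (auto simp: span_singleton)
  next
    case False
    define W where "W = {z \<in> V. lform (dfield A X e z) (b3 z) \<noteq> 0}"
    have "continuous_on V (\<lambda>z. lform (dfield A X e z) (b3 z))"
      by (intro smooth_map_continuous_on[OF _ V(1)] smooth_map_lform V(1) smooth_map_dfield e(1) XV smV sm)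
    then have W: "open W" "y \<in> W" "W \<subseteq> V" "W \<subseteq> U"
      using continuous_open_preimage[OF _ V(1), of _ "- {0}"] V False by (auto simp: W_def vimage_def Int_def)
    have smW: "smooth_map A W g" if "smooth_map A U g" for g :: "'a \<Rightarrow> R42"
      using smooth_map_subset[OF that W(4)] .
    have step: "lform (dfield A X g z) q = 0"
      if "smooth_map A V' g" "open V'" "\<And>z. z \<in> V' \<Longrightarrow> lform (g z) q = 0" "z \<in> V'" for g z V'
      using dfield_orthogonal[OF that(2,1) smooth_map_const that(3,4), of X] dder_const[of q z "X z"]
      by (simp add: dfield_def lform_simps)
    have \<sigma>q: "lform (\<sigma> z) q = 0" if z: "z \<in> W" for z
    proof -
      have zV: "z \<in> V" using z W by blast
      obtain k r where kr: "dfield A X e z = k *\<^sub>R \<sigma> z + r *\<^sub>R e z" using dec[OF zV] by blast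
      have "k \<noteq> 0" using kr z e(2)[OF zV] by (auto simp: W_def lform_simps perp_def)
      then show ?thesis
        using step[OF e(1) V(1) q(2) zV] q(2)[OF zV] unfolding kr by (simp add: lform_simps)
    qed
    have \<tau>q: "lform (\<tau> z) q = 0" if z: "z \<in> W" for z
    proof -
      have zU: "z \<in> U" using z W by blast
      obtain \<alpha> \<beta> where ab: "dfield A X \<sigma> z = \<alpha> *\<^sub>R \<sigma> z + \<beta> *\<^sub>R \<tau> z"
        using curvature(1)[OF zU] unfolding in_span_pair by blast
      then have "\<beta> \<noteq> 0" using regular(1)[OF zU] by (auto simp: span_singleton)
      then show ?thesis
        using step[OF smW[OF \<sigma>_smooth] W(1) \<sigma>q z] \<sigma>q[OF z] unfolding ab by (simp add: lform_simps)
    qed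
    have 1: "lform (b z) q = 0" if "z \<in> W" for z by (rule step[OF smW[OF \<tau>_smooth] W(1) \<tau>q that])
    have 2: "lform (b2 z) q = 0" if "z \<in> W" for z by (rule step[OF smW[OF sm(1)] W(1) 1 that])
    have 3: "lform (b3 z) q = 0" if "z \<in> W" for z by (rule step[OF smW[OF sm(2)] W(1) 2 that])
    have "lform q (b3 y) = 0" and q4: "q \<in> perp {\<sigma> y, \<tau> y, b y, b2 y}"
      using \<sigma>q \<tau>q 1 2 3 W(2) by (auto simp: perp_def lform_commute)
    then obtain r where "q = r *\<^sub>R e y"
      using perp_F_unique[OF _ e(2)[OF V(3)] e(3)[OF V(3)] q4] V by auto
    then have False using q(1) q(2)[OF V(3)] e(3)[OF V(3)] by (auto simp: lform_simps)
    then show ?thesis ..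
  qed
qed

end

section \<open>Integral curves\<close>

lemma smooth_on_imp_lipschitz_cball:
  fixes F :: "'a::euclidean_space \<Rightarrow> 'b::euclidean_space"
  assumes D: "open D" "cball z r \<subseteq> D" and F: "smooth_on D F"
  obtains K where "K > 0" "\<And>x y. x \<in> cball z r \<Longrightarrow> y \<in> cball z r \<Longrightarrow> norm (F x - F y) \<le> K * norm (x - y)"
proof -
  have "continuous_on (cball z r) (\<lambda>x. \<Sum>b\<in>Basis. norm (frechet_derivative F (at x) b))"
    using smooth_on_continuous_on[OF smooth_on_frechet_derivative[OF F]] D(2)
    by (intro continuous_intros) (auto intro: continuous_on_subset)
  then have "compact ((\<lambda>x. \<Sum>b\<in>Basis. norm (frechet_derivative F (at x) b)) ` cball z r)"
    by (rule compact_continuous_image) simp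
  from compact_imp_bounded[OF this]
  obtain K where K: "K > 0" "\<And>x. x \<in> cball z r \<Longrightarrow> norm (\<Sum>b\<in>Basis. norm (frechet_derivative F (at x) b)) \<le> K"
    unfolding bounded_pos by blast
  have on: "onorm (frechet_derivative F (at x)) \<le> K" if x: "x \<in> cball z r" for x
  proof (rule onorm_le)
    fix w
    have "F differentiable (at x)" using smooth_on_differentiable[OF F] x D(2) by blast
    then have "norm (frechet_derivative F (at x) w) \<le> (\<Sum>b\<in>Basis. norm ((w \<bullet> b) *\<^sub>R frechet_derivative F (at x) b))"
      using norm_sum[of "\<lambda>b. (w \<bullet> b) *\<^sub>R frechet_derivative F (at x) b" Basis] frechet_derivative_Basis[of F x w]
      by simp
    also have "\<dots> \<le> (\<Sum>b\<in>Basis. norm w * norm (frechet_derivative F (at x) b))"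
      by (intro sum_mono) (auto intro!: mult_right_mono simp: Basis_le_norm)
    also have "\<dots> \<le> norm w * K"
      using K(2)[OF x] by (simp add: sum_distrib_left[symmetric] mult_left_mono)
    finally show "norm (frechet_derivative F (at x) w) \<le> K * norm w" by (simp add: mult.commute)
  qed
  have "norm (F x - F y) \<le> K * norm (x - y)" if "x \<in> cball z r" "y \<in> cball z r" for x y
    by (rule differentiable_bound[OF convex_cball[of z r] _ on that(1,2)])
      (use smooth_on_differentiable[OF F] D(2) has_frechet_derivative has_derivative_at_withinI in blast)+
  then show ?thesis using that K(1) by blast
qed

lemma norm_integral_difference_le:
  fixes h :: "real \<Rightarrow> 'a::euclidean_space"
  assumes h: "continuous_on {a..b} h" "\<And>s. s \<in> {a..b} \<Longrightarrow> norm (h s) \<le> M"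
    and st: "s \<in> {a..b}" "t \<in> {a..b}"
  shows "norm (integral {a..t} h - integral {a..s} h) \<le> M * \<bar>t - s\<bar>"
proof -
  have "norm (integral {a..t} h - integral {a..s} h) \<le> M * norm (t - s)"
  proof (rule differentiable_bound[of "{a..b}" _ "\<lambda>x u. u *\<^sub>R h x"])
    show "((\<lambda>u. integral {a..u} h) has_derivative (\<lambda>u. u *\<^sub>R h x)) (at x within {a..b})" if "x \<in> {a..b}" for x
      using integral_has_vector_derivative[OF h(1) that] by (simp add: has_vector_derivative_def)
    show "onorm (\<lambda>u. u *\<^sub>R h x) \<le> M" if "x \<in> {a..b}" for x
      by (rule onorm_le) (use h(2)[OF that] in \<open>simp add: mult.commute[of M] mult_left_mono\<close>)
  qed (use st in auto)
  then show ?thesis by simp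
qed

text \<open>Picard's local existence theorem.\<close>

lemma ode_local_solution:
  fixes F :: "'a::euclidean_space \<Rightarrow> 'a"
  assumes D: "open D" "z \<in> D" and F: "smooth_on D F"
  obtains \<epsilon> \<phi> where "\<epsilon> > 0" "\<phi> 0 = z"
    "\<And>t. t \<in> {-\<epsilon><..<\<epsilon>} \<Longrightarrow> \<phi> t \<in> D \<and> (\<phi> has_vector_derivative F (\<phi> t)) (at t)"
proof -
  obtain r where r: "r > 0" "cball z r \<subseteq> D" using D open_contains_cball by blast
  obtain K where K: "K > 0"
    "\<And>x y. x \<in> cball z r \<Longrightarrow> y \<in> cball z r \<Longrightarrow> norm (F x - F y) \<le> K * norm (x - y)"
    using smooth_on_imp_lipschitz_cball[OF D(1) r(2) F] by metis
  have Fcont: "continuous_on (cball z r) F"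
    using smooth_on_continuous_on[OF F] r(2) continuous_on_subset by blast
  then have "compact (F ` cball z r)" by (rule compact_continuous_image) simp
  then obtain B where B: "B > 0" "\<And>x. x \<in> cball z r \<Longrightarrow> norm (F x) \<le> B"
    using compact_imp_bounded bounded_pos by (metis imageI)
  \<comment> \<open>For this \<open>\<epsilon>\<close> the integral operator maps curves in the ball to such curves and contracts by one half.\<close>
  define \<epsilon> where "\<epsilon> = min (r / B) (1 / (2 * K))"
  have \<epsilon>: "\<epsilon> > 0" "B * \<epsilon> \<le> r" "K * \<epsilon> \<le> 1/2"
    using r K B by (auto simp: \<epsilon>_def min_def field_simps)
  \<comment> \<open>Clipping the time makes the operator act on bounded continuous functions on the whole line.\<close>
  define clip where "clip t = max (-\<epsilon>) (min \<epsilon> t)" for t :: real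
  have clip: "clip t \<in> {-\<epsilon>..\<epsilon>}" "\<bar>clip t\<bar> \<le> \<epsilon>" for t using \<epsilon>(1) by (auto simp: clip_def)
  have clip_id: "clip t = t" if "t \<in> {-\<epsilon>..\<epsilon>}" for t using that by (auto simp: clip_def)
  have clip_cont: "continuous_on UNIV clip" unfolding clip_def by (intro continuous_intros)
  define S where "S = (PiC UNIV (\<lambda>_. cball z r) :: (real \<Rightarrow>\<^sub>C 'a) set)"
  have S: "\<phi> \<in> S \<longleftrightarrow> (\<forall>t. apply_bcontfun \<phi> t \<in> cball z r)" for \<phi>
    unfolding S_def mem_PiC_iff by auto
  define I where "I \<phi> t = integral {-\<epsilon>..t} (\<lambda>s. F (apply_bcontfun \<phi> s))" for \<phi> :: "real \<Rightarrow>\<^sub>C 'a" and t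
  define P where "P \<phi> t = z + (I \<phi> (clip t) - I \<phi> 0)" for \<phi> t
  have Fc: "continuous_on {-\<epsilon>..\<epsilon>} (\<lambda>s. F (apply_bcontfun \<phi> s))" if "\<phi> \<in> S" for \<phi>
    by (rule continuous_on_compose2[OF Fcont]) (use that S in auto)
  have P_ball: "P \<phi> t \<in> cball z r" if \<phi>: "\<phi> \<in> S" for \<phi> t
  proof -
    have "norm (I \<phi> (clip t) - I \<phi> 0) \<le> B * \<bar>clip t - 0\<bar>"
      unfolding I_def by (rule norm_integral_difference_le[OF Fc[OF \<phi>]])
        (use B \<phi> S clip \<epsilon>(1) in auto)
    also have "\<dots> \<le> B * \<epsilon>" using clip B(1) by (intro mult_left_mono) auto
    finally have "norm (I \<phi> (clip t) - I \<phi> 0) \<le> r" using \<epsilon>(2) by linarith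
    then show ?thesis unfolding P_def mem_cball dist_norm using norm_minus_commute by (metis add_diff_cancel_left')
  qed
  have P_bc: "P \<phi> \<in> bcontfun" if \<phi>: "\<phi> \<in> S" for \<phi>
    unfolding bcontfun_def
  proof (intro CollectI conjI)
    have "continuous_on {-\<epsilon>..\<epsilon>} (I \<phi>)"
      unfolding I_def by (rule indefinite_integral_continuous_1[OF integrable_continuous_real[OF Fc[OF \<phi>]]])
    then have "continuous_on UNIV (\<lambda>t. I \<phi> (clip t))"
      by (rule continuous_on_compose2[OF _ clip_cont]) (use clip in auto)
    then show "continuous_on UNIV (P \<phi>)" unfolding P_def by (intro continuous_intros)
    show "bounded (range (P \<phi>))"
      by (rule bounded_subset[OF bounded_cball[of z r]]) (use P_ball[OF \<phi>] in auto)
  qed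
  define T where "T \<phi> = Bcontfun (P \<phi>)" for \<phi>
  have T: "apply_bcontfun (T \<phi>) = P \<phi>" if "\<phi> \<in> S" for \<phi>
    unfolding T_def by (rule Bcontfun_inverse[OF P_bc[OF that]])
  have "\<exists>!\<phi>\<in>S. T \<phi> = \<phi>"
  proof (rule Banach_fix[where c="1/2"])
    show "complete S" unfolding complete_eq_closed S_def by (rule closed_PiC) simp
    have "const_bcontfun z \<in> S" unfolding S using r(1) by (simp add: const_bcontfun.rep_eq)
    then show "S \<noteq> {}" by blast
    show "T ` S \<subseteq> S" using T P_ball by (auto simp: S)
    show "dist (T \<phi>) (T \<psi>) \<le> 1/2 * dist \<phi> \<psi>" if \<phi>: "\<phi> \<in> S" and \<psi>: "\<psi> \<in> S" for \<phi> \<psi>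
    proof (rule dist_bound)
      fix t
      let ?h = "\<lambda>s. F (apply_bcontfun \<phi> s) - F (apply_bcontfun \<psi> s)"
      have diff: "I \<phi> u - I \<psi> u = integral {-\<epsilon>..u} ?h" if "u \<in> {-\<epsilon>..\<epsilon>}" for u
        unfolding I_def
        by (rule integral_diff[symmetric]; rule integrable_continuous_real;
            rule continuous_on_subset[OF Fc]) (use \<phi> \<psi> that in auto)
      have "norm (?h s) \<le> K * dist \<phi> \<psi>" for s
      proof -
        have "norm (?h s) \<le> K * dist (apply_bcontfun \<phi> s) (apply_bcontfun \<psi> s)"
          using K(2) \<phi> \<psi> by (auto simp: S dist_norm)
        also have "\<dots> \<le> K * dist \<phi> \<psi>" using K(1) dist_bounded by (intro mult_left_mono) auto
        finally show ?thesis .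
      qed
      then have "norm (integral {-\<epsilon>..clip t} ?h - integral {-\<epsilon>..0} ?h) \<le> K * dist \<phi> \<psi> * \<bar>clip t - 0\<bar>"
        by (intro norm_integral_difference_le[of _ \<epsilon>])
          (use Fc[OF \<phi>] Fc[OF \<psi>] clip \<epsilon>(1) in \<open>auto intro!: continuous_on_diff\<close>)
      also have "\<dots> \<le> K * dist \<phi> \<psi> * \<epsilon>" using clip K(1) by (intro mult_left_mono) auto
      also have "\<dots> = (K * \<epsilon>) * dist \<phi> \<psi>" by simp
      also have "\<dots> \<le> 1/2 * dist \<phi> \<psi>" using \<epsilon>(3) by (intro mult_right_mono) auto
      finally have "norm ((I \<phi> (clip t) - I \<psi> (clip t)) - (I \<phi> 0 - I \<psi> 0)) \<le> 1/2 * dist \<phi> \<psi>"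
        using diff[OF clip(1)[of t]] diff[of 0] \<epsilon>(1) by simp
      then show "dist (apply_bcontfun (T \<phi>) t) (apply_bcontfun (T \<psi>) t) \<le> 1/2 * dist \<phi> \<psi>"
        unfolding T[OF \<phi>] T[OF \<psi>] P_def dist_norm by (simp add: algebra_simps)
    qed
  qed auto
  then obtain \<phi> where \<phi>: "\<phi> \<in> S" "T \<phi> = \<phi>" by blast
  then have eq: "apply_bcontfun \<phi> t = P \<phi> t" for t using T by metis
  show ?thesis
  proof (rule that[of \<epsilon> "apply_bcontfun \<phi>"])
    show "\<epsilon> > 0" by fact
    show "apply_bcontfun \<phi> 0 = z" unfolding eq P_def using clip_id[of 0] \<epsilon>(1) by simp
    show "apply_bcontfun \<phi> t \<in> D \<and> (apply_bcontfun \<phi> has_vector_derivative F (apply_bcontfun \<phi> t)) (at t)"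
      if t: "t \<in> {-\<epsilon><..<\<epsilon>}" for t
    proof
      show "apply_bcontfun \<phi> t \<in> D" using \<phi>(1) r(2) S by blast
      have "(I \<phi> has_vector_derivative F (apply_bcontfun \<phi> t)) (at t within {-\<epsilon>..\<epsilon>})"
        unfolding I_def[abs_def]
        using integral_has_vector_derivative[OF Fc[OF \<phi>(1)], of t] t by simp
      then have "(I \<phi> has_vector_derivative F (apply_bcontfun \<phi> t)) (at t)"
        using t at_within_Icc_at[of "-\<epsilon>" t \<epsilon>] by simp
      then have "((\<lambda>s. z + (I \<phi> s - I \<phi> 0)) has_vector_derivative F (apply_bcontfun \<phi> t)) (at t)"
        by (auto intro!: derivative_eq_intros)
      then show "(apply_bcontfun \<phi> has_vector_derivative F (apply_bcontfun \<phi> t)) (at t)"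
        by (rule has_vector_derivative_transform_within_open[of _ _ _ "{-\<epsilon><..<\<epsilon>}"])
          (use t clip_id in \<open>auto simp: eq P_def\<close>)
    qed
  qed
qed

section \<open>Two-valued sections over simply connected surfaces\<close>

text \<open>
  A two-valued section assigns to each point a pair of opposite nonzero vectors that locally
  depends continuously on the point. Its graph is a double covering.
\<close>

definition two_valued_section :: "'c::topological_space set \<Rightarrow> ('c \<Rightarrow> 'b::euclidean_space set) \<Rightarrow> bool" where
  "two_valued_section K M \<longleftrightarrow>
     (\<forall>x\<in>K. \<exists>V e. openin (top_of_set K) V \<and> x \<in> V \<and> continuous_on V e \<and>
        (\<forall>y\<in>V. e y \<noteq> 0 \<and> M y = {e y, - e y}))"

lemma two_valued_sectionE:
  assumes "two_valued_section K M" "x \<in> K"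
  obtains V e where "openin (top_of_set K) V" "x \<in> V" "continuous_on V e"
    "\<And>y. y \<in> V \<Longrightarrow> e y \<noteq> 0" "\<And>y. y \<in> V \<Longrightarrow> M y = {e y, - e y}"
  using bspec[OF assms(1)[unfolded two_valued_section_def] assms(2)] by blast

lemma vector_neq_uminus:
  fixes u :: "'b::real_vector"
  shows "u \<noteq> 0 \<Longrightarrow> u \<noteq> - u"
  by (metis add.right_inverse scaleR_2 scaleR_eq_0_iff zero_neq_numeral)

lemma two_valued_section_signs:
  assumes "two_valued_section K M" "x \<in> K" "u \<in> M x"
  shows "u \<noteq> 0" "M x = {u, - u}"
  using assms unfolding two_valued_section_def by fastforce+

lemma two_valued_section_pullback:
  assumes M: "two_valued_section L M" and h: "continuous_on K h" "h ` K \<subseteq> L"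
  shows "two_valued_section K (\<lambda>x. M (h x))"
  unfolding two_valued_section_def
proof
  fix x assume x: "x \<in> K"
  then obtain V e where V: "openin (top_of_set L) V" "h x \<in> V" "continuous_on V e"
    "\<And>y. y \<in> V \<Longrightarrow> e y \<noteq> 0 \<and> M y = {e y, - e y}"
    using M h(2) unfolding two_valued_section_def by (metis image_subset_iff)
  have "openin (top_of_set K) (K \<inter> h -` V)"
    using continuous_openin_preimage[OF h(1) _ V(1)] h(2) by blast
  moreover have "continuous_on (K \<inter> h -` V) (e \<circ> h)"
    by (rule continuous_on_compose[OF continuous_on_subset[OF h(1)] continuous_on_subset[OF V(3)]]) auto
  ultimately show "\<exists>V e. openin (top_of_set K) V \<and> x \<in> V \<and> continuous_on V e \<and>
      (\<forall>y\<in>V. e y \<noteq> 0 \<and> M (h y) = {e y, - e y})"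
    using V x by (intro exI[of _ "K \<inter> h -` V"] exI[of _ "e \<circ> h"]) auto
qed

text \<open>
  Over a convex set one of the two values can be chosen continuously: the graph is a covering space,
  to which the identity lifts.
\<close>

lemma two_valued_section_convex:
  fixes K :: "'c::euclidean_space set" and M :: "'c \<Rightarrow> 'b::euclidean_space set"
  assumes K: "convex K" and M: "two_valued_section K M"
  obtains k where "continuous_on K k" "\<And>x. x \<in> K \<Longrightarrow> k x \<in> M x"
proof -
  define C where "C = {p. fst p \<in> K \<and> snd p \<in> M (fst p)}"
  have cov: "covering_space C fst K"
  proof
    show "continuous_on C fst" by (intro continuous_intros)
    show "fst ` C = K"
    proof
      show "K \<subseteq> fst ` C"
      proof
        fix x assume x: "x \<in> K"
        then obtain e where "M x = {e x, - e x}" using two_valued_sectionE[OF M] by metis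
        then have "(x, e x) \<in> C" using x by (simp add: C_def)
        then show "x \<in> fst ` C" by force
      qed
    qed (auto simp: C_def)
    fix x assume x: "x \<in> K"
    obtain V e where V: "openin (top_of_set K) V" "x \<in> V" "continuous_on V e"
      "\<And>y. y \<in> V \<Longrightarrow> e y \<noteq> 0" "\<And>y. y \<in> V \<Longrightarrow> M y = {e y, - e y}"
      by (rule two_valued_sectionE[OF M x], rule that)
    have VK: "V \<subseteq> K" using V(1) openin_imp_subset by blast
    let ?s = "\<lambda>\<eta>. (\<lambda>y. (y, \<eta> *\<^sub>R e y)) ` V"
    let ?C = "C \<inter> fst -` V"
    have openC: "openin (top_of_set C) ?C"
      by (rule continuous_openin_preimage[OF _ _ V(1)]) (auto simp: C_def intro: continuous_intros)
    have sheet: "?s \<eta> = ?C \<inter> (\<lambda>p. snd p \<bullet> (\<eta> *\<^sub>R e (fst p))) -` {0<..}" if "\<eta> = 1 \<or> \<eta> = -1" for \<eta> :: real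
    proof (intro set_eqI iffI)
      fix p assume "p \<in> ?s \<eta>"
      then obtain y where y: "y \<in> V" "p = (y, \<eta> *\<^sub>R e y)" by blast
      have "\<eta> * \<eta> = 1" using that by auto
      then show "p \<in> ?C \<inter> (\<lambda>p. snd p \<bullet> (\<eta> *\<^sub>R e (fst p))) -` {0<..}"
        using y V(4)[OF y(1)] V(5)[OF y(1)] VK that by (auto simp: C_def)
    next
      fix p assume p: "p \<in> ?C \<inter> (\<lambda>p. snd p \<bullet> (\<eta> *\<^sub>R e (fst p))) -` {0<..}"
      obtain a u where au: "p = (a, u)" by (cases p)
      have a: "a \<in> V" and u: "u = e a \<or> u = - e a" "u \<bullet> (\<eta> *\<^sub>R e a) > 0"
        using p V(5)[of a] by (auto simp: C_def au)
      have "\<not> e a \<bullet> e a < 0" by (simp add: not_less)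
      then have "u = \<eta> *\<^sub>R e a" using that u by auto
      then show "p \<in> ?s \<eta>" using a au by blast
    qed
    have opens: "openin (top_of_set C) (?s \<eta>)" if "\<eta> = 1 \<or> \<eta> = -1" for \<eta> :: real
    proof -
      have "continuous_on ?C (\<lambda>p. snd p \<bullet> (\<eta> *\<^sub>R e (fst p)))"
        by (intro continuous_intros continuous_on_compose2[OF V(3)]) auto
      then have "openin (top_of_set ?C) (?C \<inter> (\<lambda>p. snd p \<bullet> (\<eta> *\<^sub>R e (fst p))) -` {0<..})"
        using continuous_openin_preimage_gen open_greaterThan by blast
      then show ?thesis unfolding sheet[OF that] using openC openin_trans by blast
    qed
    have homeo: "homeomorphism (?s \<eta>) V fst (\<lambda>y. (y, \<eta> *\<^sub>R e y))" for \<eta>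
      unfolding homeomorphism_def using V(3) by (auto intro!: continuous_intros simp: image_image)
    have disj: "disjnt (?s 1) (?s (-1))"
    proof -
      have "e y \<noteq> - e y" if "y \<in> V" for y using vector_neq_uminus[OF V(4)[OF that]] .
      then show ?thesis by (auto simp: disjnt_def)
    qed
    have un: "\<Union>{?s 1, ?s (-1)} = ?C" using V(5) VK by (fastforce simp: C_def)
    show "\<exists>T. x \<in> T \<and> openin (top_of_set K) T \<and>
        (\<exists>v. \<Union>v = C \<inter> fst -` T \<and> (\<forall>u\<in>v. openin (top_of_set C) u) \<and>
          pairwise disjnt v \<and> (\<forall>u\<in>v. \<exists>q. homeomorphism u T fst q))"
    proof (intro exI[of _ V] conjI exI[of _ "{?s 1, ?s (-1)}"])
      show "\<forall>u\<in>{?s 1, ?s (-1)}. openin (top_of_set C) u" using opens by blast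
      show "pairwise disjnt {?s 1, ?s (-1)}" using disj disjnt_sym by (auto simp: pairwise_insert)
      show "\<forall>u\<in>{?s 1, ?s (-1)}. \<exists>q. homeomorphism u V fst q" using homeo by blast
    qed (use V un in auto)
  qed
  obtain g where g: "continuous_on K g" "g \<in> K \<rightarrow> C" "\<And>y. y \<in> K \<Longrightarrow> fst (g y) = y"
    by (rule covering_space_lift[OF cov convex_imp_simply_connected[OF K] convex_imp_locally_path_connected[OF K]
          continuous_on_id]) auto
  show ?thesis
  proof (rule that[of "snd \<circ> g"])
    show "continuous_on K (snd \<circ> g)" using g(1) by (auto intro: continuous_intros simp: comp_def)
    show "(snd \<circ> g) x \<in> M x" if x: "x \<in> K" for x
    proof -
      have "g x \<in> C" using g(2) x by blast
      then show ?thesis using g(3)[OF x] by (simp add: C_def)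
    qed
  qed
qed

lemma two_valued_section_unique:
  fixes M :: "'c::topological_space \<Rightarrow> 'b::euclidean_space set"
  assumes K: "connected K" and M: "two_valued_section K M"
    and k: "continuous_on K k" "\<And>x. x \<in> K \<Longrightarrow> k x \<in> M x"
    and l: "continuous_on K l" "\<And>x. x \<in> K \<Longrightarrow> l x \<in> M x"
    and eq: "x \<in> K" "k x = l x" and y: "y \<in> K"
  shows "k y = l y"
proof -
  have pm: "l z = k z \<or> l z = - k z" "k z \<noteq> 0" if "z \<in> K" for z
    using two_valued_section_signs[OF M that k(2)[OF that]] l(2)[OF that] by auto
  have con: "connected ((\<lambda>z. k z \<bullet> l z) ` K)"
    by (intro connected_continuous_image[OF _ K] continuous_intros k l)
  have "k y \<bullet> l y > 0"
  proof (rule ccontr)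
    assume "\<not> k y \<bullet> l y > 0"
    moreover have "{k y \<bullet> l y..k x \<bullet> l x} \<subseteq> (\<lambda>z. k z \<bullet> l z) ` K"
      by (rule connected_contains_Icc[OF con imageI[OF y] imageI[OF eq(1)]])
    moreover have "k x \<bullet> l x > 0" using eq(2) pm(2)[OF eq(1)] by simp
    ultimately have "0 \<in> (\<lambda>z. k z \<bullet> l z) ` K" by auto
    then show False using pm by force
  qed
  then have "l y \<noteq> - k y" using inner_ge_zero[of "k y"] by (auto simp del: inner_ge_zero)
  then show ?thesis using pm[OF y] by auto
qed

text \<open>
  A continuous choice of one of the two values along a null-homotopic loop closes up: over the square
  parametrising the homotopy there is a continuous choice, whose values on two opposite sides agree
  because they agree at the constant loop.
\<close>

lemma two_valued_section_loop:
  fixes M :: "'c::topological_space \<Rightarrow> 'b::euclidean_space set"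
  assumes M: "two_valued_section UNIV M" and sc: "simply_connected (UNIV :: 'c set)"
    and g: "path g" "g 1 = g 0" and k: "continuous_on {0..1} k" "\<And>t. t \<in> {0..1} \<Longrightarrow> k t \<in> M (g t)"
  shows "k 1 = k 0"
proof -
  have "homotopic_loops UNIV g (\<lambda>t. g 0)"
    using sc g unfolding simply_connected_def
    by (auto simp: path_def pathfinish_def pathstart_def)
  then obtain h :: "real \<times> real \<Rightarrow> 'c" where h: "continuous_on ({0..1} \<times> {0..1}) h"
    "\<And>t. t \<in> {0..1} \<Longrightarrow> h (0, t) = g t" "\<And>t. t \<in> {0..1} \<Longrightarrow> h (1, t) = g 0"
    "\<And>s. s \<in> {0..1} \<Longrightarrow> h (s, 1) = h (s, 0)"
    unfolding homotopic_loops pathfinish_def pathstart_def comp_def by blast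
  note M' = two_valued_section_pullback[OF M]
  obtain \<kappa> where \<kappa>: "continuous_on ({0..1} \<times> {0..1}) \<kappa>" "\<And>z. z \<in> {0..1} \<times> {0..1} \<Longrightarrow> \<kappa> z \<in> M (h z)"
    by (rule two_valued_section_convex[OF _ M'[OF h(1)]]) (auto intro: convex_Times)
  have c1: "continuous_on {0..1} (\<lambda>t. \<kappa> (s, t))" if "s \<in> {0..1}" for s
    by (rule continuous_on_compose2[OF \<kappa>(1)]) (use that in \<open>auto intro!: continuous_intros\<close>)
  have c2: "continuous_on {0..1} (\<lambda>s. \<kappa> (s, t))" if "t \<in> {0..1}" for t
    by (rule continuous_on_compose2[OF \<kappa>(1)]) (use that in \<open>auto intro!: continuous_intros\<close>)
  have ch: "continuous_on {0..1} (\<lambda>s. h (s, 0))"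
    by (rule continuous_on_compose2[OF h(1)]) (auto intro!: continuous_intros)
  have con: "connected {0..1::real}" by simp
  have "\<kappa> (1, 1) = \<kappa> (1, 0)"
  proof (rule two_valued_section_unique[OF con, of "\<lambda>t. M (g 0)" "\<lambda>t. \<kappa> (1, t)" "\<lambda>t. \<kappa> (1, 0)" 0 1])
    show "two_valued_section {0..1} (\<lambda>t::real. M (g 0))"
      using M'[of "{0..1}" "\<lambda>t. g 0"] by simp
    show "\<kappa> (1, t) \<in> M (g 0)" if "t \<in> {0..1}" for t using \<kappa>(2)[of "(1, t)"] h(3)[OF that] that by simp
    show "\<kappa> (1, 0) \<in> M (g 0)" using \<kappa>(2)[of "(1, 0)"] h(3)[of 0] by simp
  qed (use c1 in auto)
  then have \<kappa>0: "\<kappa> (0, 0) = \<kappa> (0, 1)"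
  proof (rule_tac two_valued_section_unique[OF con, of "\<lambda>s. M (h (s, 0))" "\<lambda>s. \<kappa> (s, 0)" "\<lambda>s. \<kappa> (s, 1)" 1 0])
    show "two_valued_section {0..1} (\<lambda>s. M (h (s, 0)))" using M'[OF ch] by simp
    show "\<kappa> (s, 0) \<in> M (h (s, 0))" if "s \<in> {0..1}" for s using \<kappa>(2)[of "(s, 0)"] that by simp
    show "\<kappa> (s, 1) \<in> M (h (s, 0))" if "s \<in> {0..1}" for s using \<kappa>(2)[of "(s, 1)"] h(4)[OF that] that by simp
  qed (use c2 in auto)
  have Mg: "two_valued_section {0..1} (\<lambda>t. M (g t))" using M' g(1) by (simp add: path_def)
  have \<kappa>g: "\<kappa> (0, t) \<in> M (g t)" "- \<kappa> (0, t) \<in> M (g t)" if "t \<in> {0..1}" for t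
  proof -
    show 1: "\<kappa> (0, t) \<in> M (g t)" using \<kappa>(2)[of "(0, t)"] h(2)[OF that] that by simp
    show "- \<kappa> (0, t) \<in> M (g t)" using two_valued_section_signs(2)[OF M _ 1] by auto
  qed
  have "k 0 = \<kappa> (0, 0) \<or> k 0 = - \<kappa> (0, 0)"
    using two_valued_section_signs(2)[OF M UNIV_I \<kappa>g(1)[of 0]] k(2)[of 0] by auto
  then show ?thesis
  proof
    assume "k 0 = \<kappa> (0, 0)"
    then have "k 1 = \<kappa> (0, 1)"
      by (rule_tac two_valued_section_unique[OF con Mg k, of "\<lambda>t. \<kappa> (0, t)" 0 1]) (use \<kappa>g c1 in auto)
    then show ?thesis using \<kappa>0 \<open>k 0 = \<kappa> (0, 0)\<close> by simp
  next
    assume "k 0 = - \<kappa> (0, 0)"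
    then have "k 1 = - \<kappa> (0, 1)"
      by (rule_tac two_valued_section_unique[OF con Mg k, of "\<lambda>t. - \<kappa> (0, t)" 0 1])
        (use \<kappa>g c1 in \<open>auto intro!: continuous_intros\<close>)
    then show ?thesis using \<kappa>0 \<open>k 0 = - \<kappa> (0, 0)\<close> by simp
  qed
qed

text \<open>Over a simply connected space one of the two values can be chosen continuously.\<close>

lemma two_valued_section_simply_connected:
  fixes M :: "'c::topological_space \<Rightarrow> 'b::euclidean_space set"
  assumes M: "two_valued_section UNIV M" and sc: "simply_connected (UNIV :: 'c set)"
    and loc: "\<And>(x :: 'c) V. open V \<Longrightarrow> x \<in> V \<Longrightarrow> \<exists>W. open W \<and> x \<in> W \<and> W \<subseteq> V \<and> path_connected W"
  obtains l where "\<And>x. l x \<in> M x" "\<And>x. \<exists>W. open W \<and> x \<in> W \<and> continuous_on W l"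
proof -
  fix x0 :: 'c
  obtain V e where "x0 \<in> V" "\<forall>y\<in>V. e y \<noteq> 0 \<and> M y = {e y, - e y}"
    using M unfolding two_valued_section_def by blast
  then obtain u0 where u0: "u0 \<in> M x0" by blast
  \<comment> \<open>\<open>R x v\<close>: the value \<open>v\<close> at \<open>x\<close> is obtained by continuing \<open>u0\<close> along some path from \<open>x0\<close> to \<open>x\<close>.\<close>
  define R where "R x v \<longleftrightarrow> (\<exists>g k. path g \<and> path k \<and> g 0 = x0 \<and> g 1 = x \<and> k 0 = u0 \<and> k 1 = v \<and>
      (\<forall>t\<in>{0..1}. k t \<in> M (g t)))" for x v
  have neg: "- u \<in> M x" if "u \<in> M x" for u x using two_valued_section_signs(2)[OF M UNIV_I that] by auto
  have RM: "v \<in> M x" if "R x v" for x v using that unfolding R_def by auto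
  have ex: "\<exists>v. R x v" for x
  proof -
    have "homotopic_loops UNIV (\<lambda>t. x0) (\<lambda>t. x)"
      using sc unfolding simply_connected_def by (auto simp: path_def pathfinish_def pathstart_def)
    then obtain h where h: "continuous_on ({0..1::real} \<times> {0..1::real}) h" "h (0, 0) = x0" "h (1, 0) = x"
      unfolding homotopic_loops by auto
    have g: "path (\<lambda>s. h (s, 0))"
      unfolding path_def by (rule continuous_on_compose2[OF h(1)]) (auto intro!: continuous_intros)
    obtain k where k: "continuous_on {0..1} k" "\<And>t. t \<in> {0..1} \<Longrightarrow> k t \<in> M (h (t, 0))"
      by (rule two_valued_section_convex[OF _ two_valued_section_pullback[OF M g[unfolded path_def]]]) auto
    have "k 0 = u0 \<or> k 0 = - u0" using two_valued_section_signs(2)[OF M UNIV_I u0] k(2)[of 0] h(2) by auto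
    then show ?thesis
    proof
      assume "k 0 = u0"
      then have "R x (k 1)" unfolding R_def using g k h by (auto simp: path_def intro!: exI[of _ "\<lambda>s. h (s, 0)"] exI[of _ k])
      then show ?thesis ..
    next
      assume "k 0 = - u0"
      then have "R x (- k 1)" unfolding R_def using g k h neg
        by (auto simp: path_def intro!: exI[of _ "\<lambda>s. h (s, 0)"] exI[of _ "\<lambda>t. - k t"] continuous_intros)
      then show ?thesis ..
    qed
  qed
  have join: "(k1 +++ k2) t \<in> M ((g1 +++ g2) t)"
    if "\<forall>t\<in>{0..1}. k1 t \<in> M (g1 t)" "\<forall>t\<in>{0..1}. k2 t \<in> M (g2 t)" "t \<in> {0..1}"
    for k1 k2 :: "real \<Rightarrow> 'b" and g1 g2 t
    using that by (auto simp: joinpaths_def)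
  have uniq: "v1 = v2" if r1: "R x v1" and r2: "R x v2" for x v1 v2
  proof (rule ccontr)
    assume "v1 \<noteq> v2"
    then have v: "v2 = - v1" using two_valued_section_signs(2)[OF M UNIV_I RM[OF r1]] RM[OF r2] by auto
    obtain g1 k1 where 1: "path g1" "path k1" "g1 0 = x0" "g1 1 = x" "k1 0 = u0" "k1 1 = v1" "\<forall>t\<in>{0..1}. k1 t \<in> M (g1 t)"
      using r1 unfolding R_def by blast
    obtain g2 k2 where 2: "path g2" "path k2" "g2 0 = x0" "g2 1 = x" "k2 0 = u0" "k2 1 = v2" "\<forall>t\<in>{0..1}. k2 t \<in> M (g2 t)"
      using r2 unfolding R_def by blast
    let ?g = "g1 +++ reversepath g2" and ?k = "k1 +++ reversepath (\<lambda>t. - k2 t)"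
    have "?k 1 = ?k 0"
    proof (rule two_valued_section_loop[OF M sc, of ?g])
      show "path ?g" using 1 2 by (intro path_join_imp path_reversepath[THEN iffD2]) (auto simp: pathfinish_def pathstart_def reversepath_def)
      show "?g 1 = ?g 0" using 1 2 by (simp add: joinpaths_def reversepath_def)
      have "path (\<lambda>t. - k2 t)" using 2(2) unfolding path_def by (intro continuous_intros)
      then show "continuous_on {0..1} ?k" unfolding path_def[symmetric]
        using 1 2 v by (intro path_join_imp path_reversepath[THEN iffD2]) (auto simp: pathfinish_def pathstart_def reversepath_def)
      show "?k t \<in> M (?g t)" if "t \<in> {0..1}" for t
        by (rule join[OF 1(7) _ that]) (use 2(7) neg in \<open>auto simp: reversepath_def\<close>)
    qed
    then have "- u0 = u0" using 1 2 by (simp add: joinpaths_def reversepath_def)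
    then show False using vector_neq_uminus[OF two_valued_section_signs(1)[OF M UNIV_I u0]] by metis
  qed
  define l where "l x = (SOME v. R x v)" for x
  have l: "R x (l x)" for x unfolding l_def using ex someI_ex by metis
  show ?thesis
  proof (rule that[of l])
    show "l x \<in> M x" for x using RM l by blast
    show "\<exists>W. open W \<and> x \<in> W \<and> continuous_on W l" for x
    proof -
      obtain V e where "openin (top_of_set UNIV) V" "x \<in> V" "continuous_on V e"
        "\<And>y. y \<in> V \<Longrightarrow> e y \<noteq> 0" "\<And>y. y \<in> V \<Longrightarrow> M y = {e y, - e y}"
        by (rule two_valued_sectionE[OF M UNIV_I[of x]], rule that)
      then have V: "open V" "x \<in> V" "continuous_on V e" "\<And>y. y \<in> V \<Longrightarrow> M y = {e y, - e y}"
        by simp_all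
      obtain W where W: "open W" "x \<in> W" "W \<subseteq> V" "path_connected W" using loc[OF V(1,2)] by blast
      obtain e' where e': "continuous_on W e'" "l x = e' x" "\<And>y. y \<in> W \<Longrightarrow> e' y \<in> M y"
      proof (cases "l x = e x")
        case True
        show ?thesis by (rule that[of e]) (use True V W continuous_on_subset in auto)
      next
        case False
        then have "l x = - e x" using V RM[OF l] by fastforce
        then show ?thesis using that[of "\<lambda>y. - e y"] V W continuous_on_minus continuous_on_subset
          by (metis insertCI subsetD)
      qed
      have "l y = e' y" if y: "y \<in> W" for y
      proof -
        obtain p where p: "path p" "path_image p \<subseteq> W" "p 0 = x" "p 1 = y"
          using W y unfolding path_connected_def by (metis pathstart_def pathfinish_def)
        obtain g k where g: "path g" "path k" "g 0 = x0" "g 1 = x" "k 0 = u0" "k 1 = l x" "\<forall>t\<in>{0..1}. k t \<in> M (g t)"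
          using l[of x] unfolding R_def by blast
        have pe: "path (e' \<circ> p)"
          using p e'(1) path_continuous_image continuous_on_subset by blast
        have "R y (e' y)" unfolding R_def
        proof (intro exI conjI ballI)
          show "path (g +++ p)" using g p by (intro path_join_imp) (auto simp: pathfinish_def pathstart_def)
          show "path (k +++ (e' \<circ> p))" using g p pe e' by (intro path_join_imp) (auto simp: pathfinish_def pathstart_def)
          show "(k +++ (e' \<circ> p)) t \<in> M ((g +++ p) t)" if "t \<in> {0..1}" for t
            by (rule join[OF g(7) _ that]) (use p(2) e'(3) in \<open>auto simp: path_image_def\<close>)
        qed (use g p in \<open>auto simp: joinpaths_def\<close>)
        then show ?thesis using uniq l by blast
      qed
      then have "continuous_on W l" using continuous_on_eq[OF e'(1)] by metis
      then show ?thesis using W by blast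
    qed
  qed
qed

section \<open>Line bundles and leaves on a surface\<close>

context surface
begin

lemma path_connected_neighbourhood:
  fixes x :: 'a
  assumes "open V" "x \<in> V"
  shows "\<exists>W. open W \<and> x \<in> W \<and> W \<subseteq> V \<and> path_connected W"
proof -
  obtain c where c: "c \<in> A" "x \<in> fst c" using chart_exists by blast
  let ?D = "snd c ` (fst c \<inter> V)"
  have "open ?D" "snd c x \<in> ?D" using open_chart_image[OF c(1) assms(1)] c assms by auto
  then obtain r where r: "r > 0" "ball (snd c x) r \<subseteq> ?D" using open_contains_ball by blast
  define W where "W = fst c \<inter> snd c -` ball (snd c x) r"
  have W: "W = chart_inv c ` ball (snd c x) r"
  proof
    show "W \<subseteq> chart_inv c ` ball (snd c x) r"
      using chart_inv_snd[OF c(1)] unfolding W_def by force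
    show "chart_inv c ` ball (snd c x) r \<subseteq> W"
    proof
      fix y assume "y \<in> chart_inv c ` ball (snd c x) r"
      then obtain z where z: "y = chart_inv c z" "z \<in> ball (snd c x) r" by blast
      then have "z \<in> ?D" using r(2) by blast
      then show "y \<in> W" using z chart_imageE(1,3)[OF c(1), of z V] by (simp add: W_def)
    qed
  qed
  have "open W" unfolding W_def
    by (rule continuous_open_preimage[OF homeomorphism_cont1[OF chart_homeo[OF c(1)]] chart_open[OF c(1)]]) simp
  moreover have "x \<in> W" using c r by (simp add: W_def)
  moreover have "W \<subseteq> V" using chart_imageE(2)[OF c(1)] r(2) unfolding W by blast
  moreover have "path_connected W" unfolding W
  proof (rule path_connected_continuous_image)
    show "continuous_on (ball (snd c x) r) (chart_inv c)"
      using homeomorphism_cont2[OF chart_homeo[OF c(1)]] r(2) by (blast intro: continuous_on_subset)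
  qed (simp add: convex_imp_path_connected)
  ultimately show ?thesis by blast
qed

lemma line_subbundle_frame:
  assumes "subbundle A 1 E"
  obtains U e where "open U" "x \<in> U" "smooth_map A U e" "\<And>y. y \<in> U \<Longrightarrow> e y \<noteq> 0" "\<And>y. y \<in> U \<Longrightarrow> E y = span {e y}"
proof -
  obtain U e where U: "open U" "x \<in> U" "\<forall>j<1. smooth_map A U (e j)"
    and E: "\<forall>y\<in>U. E y = span ((\<lambda>j. e j y) ` {..<1::nat}) \<and> dim (E y) = 1"
    using assms[unfolded subbundle_def, THEN spec[of _ x]] by (elim exE conjE) (rule that)
  have E: "E y = span {e 0 y}" "e 0 y \<noteq> 0" if "y \<in> U" for y
  proof -
    have "{..<1::nat} = {0}" by auto
    then show E': "E y = span {e 0 y}" using E that by simp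
    show "e 0 y \<noteq> 0" proof
      assume "e 0 y = 0"
      then have "dim (E y) = 0" unfolding E' by simp
      moreover have "dim (E y) = 1" using E that by blast
      ultimately show False by (simp only: zero_neq_one)
    qed
  qed
  show ?thesis by (rule that[of U "e 0"]) (use U E in auto)
qed

lemma smooth_map_scale:
  "open U \<Longrightarrow> smooth_map A U g \<Longrightarrow> smooth_map A U h \<Longrightarrow> smooth_map A U (\<lambda>y. g y *\<^sub>R h y)"
  by (rule smooth_map_bilinear[OF _ bounded_bilinear_scaleR])

lemma smooth_map_inner:
  "open U \<Longrightarrow> smooth_map A U g \<Longrightarrow> smooth_map A U h \<Longrightarrow> smooth_map A U (\<lambda>y. g y \<bullet> h y)"
  by (rule smooth_map_bilinear[OF _ bounded_bilinear_inner])

text \<open>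
  A spacelike line bundle has two opposite unit vectors at each point; simple connectedness allows one
  of them to be chosen continuously.
\<close>

lemma spacelike_line_unit_section:
  assumes L: "subbundle A 1 L" "\<And>x. spacelike_space (L x)" and sc: "simply_connected (UNIV :: 'a set)"
  obtains l where "smooth_map A UNIV l" "\<And>x. l x \<in> L x" "\<And>x. lform (l x) (l x) = 1"
proof -
  define M where "M x = {u \<in> L x. lform u u = 1}" for x
  have loc: "\<exists>U n. open U \<and> x \<in> U \<and> smooth_map A U n \<and> (\<forall>y\<in>U. n y \<noteq> 0 \<and> M y = {n y, - n y} \<and> lform (n y) (n y) = 1)" for x
  proof -
    obtain U e where U: "open U" "x \<in> U" "smooth_map A U e" "\<And>y. y \<in> U \<Longrightarrow> e y \<noteq> 0" "\<And>y. y \<in> U \<Longrightarrow> L y = span {e y}"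
      using line_subbundle_frame[OF L(1), of x] by metis
    have pos: "lform (e y) (e y) > 0" if "y \<in> U" for y
      using L(2)[of y] U(4,5)[OF that] by (auto simp: spacelike_space_def span_base)
    define n where "n y = inverse (sqrt (lform (e y) (e y))) *\<^sub>R e y" for y
    have "smooth_map A U n"
      unfolding n_def
      by (intro smooth_map_scale[OF U(1)] smooth_map_inverse[OF U(1)] smooth_map_sqrt[OF U(1)]
          smooth_map_lform[OF U(1)] U(3)) (use pos in force)+
    moreover have "n y \<noteq> 0 \<and> M y = {n y, - n y} \<and> lform (n y) (n y) = 1" if y: "y \<in> U" for y
    proof -
      have nn: "lform (n y) (n y) = 1"
        using pos[OF y] by (simp add: n_def lform_simps field_simps)
      have e: "e y = sqrt (lform (e y) (e y)) *\<^sub>R n y" using pos[OF y] by (simp add: n_def)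
      have nL: "n y \<in> L y" "- n y \<in> L y" unfolding U(5)[OF y] n_def by (auto simp: span_base span_scale span_neg)
      have "u = n y \<or> u = - n y" if u: "u \<in> M y" for u
      proof -
        obtain r where "u = r *\<^sub>R e y" using u U(5)[OF y] by (auto simp: M_def span_singleton)
        then obtain r' where r: "u = r' *\<^sub>R n y" using e by (metis scaleR_scaleR)
        then have "r' * r' = 1" using u nn by (simp add: M_def lform_simps)
        then have "r' = 1 \<or> r' = -1" by (simp add: square_eq_1_iff)
        then show ?thesis using r by auto
      qed
      then have "M y = {n y, - n y}" using nL nn by (auto simp: M_def lform_simps)
      then show ?thesis using nn by (auto simp: lform_simps)
    qed
    ultimately show ?thesis using U(1,2) by blast
  qed
  have "two_valued_section UNIV M"
    unfolding two_valued_section_def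
  proof
    fix x :: 'a
    obtain U n where "open U" "x \<in> U" "smooth_map A U n" "\<forall>y\<in>U. n y \<noteq> 0 \<and> M y = {n y, - n y} \<and> lform (n y) (n y) = 1"
      using loc by blast
    then show "\<exists>V e. openin (top_of_set UNIV) V \<and> x \<in> V \<and> continuous_on V e \<and> (\<forall>y\<in>V. e y \<noteq> 0 \<and> M y = {e y, - e y})"
      using smooth_map_continuous_on by (intro exI[of _ U] exI[of _ n]) auto
  qed
  then obtain l where l: "\<And>x. l x \<in> M x" "\<And>x. \<exists>W. open W \<and> x \<in> W \<and> continuous_on W l"
    by (rule two_valued_section_simply_connected[OF _ sc path_connected_neighbourhood]) (assumption, assumption, rule that)
  have "smooth_map A UNIV l"
  proof (rule smooth_map_local)
    fix x :: 'a
    obtain U n where U: "open U" "x \<in> U" "smooth_map A U n"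
      "\<And>y. y \<in> U \<Longrightarrow> M y = {n y, - n y}" "\<And>y. y \<in> U \<Longrightarrow> lform (n y) (n y) = 1"
      using loc[of x] by blast
    obtain W where W: "open W" "x \<in> W" "continuous_on W l" using l(2) by blast
    obtain \<eta> :: real where \<eta>: "\<eta> = 1 \<or> \<eta> = -1" "l x = \<eta> *\<^sub>R n x"
      using l(1)[of x] U(4)[OF U(2)] by (metis insertE scaleR_minus1_left scaleR_one singletonD)
    define V where "V = (W \<inter> U) \<inter> (\<lambda>y. lform (l y) (\<eta> *\<^sub>R n y)) -` {0<..}"
    have "continuous_on (W \<inter> U) (\<lambda>y. lform (l y) (\<eta> *\<^sub>R n y))"
      by (intro bounded_bilinear.continuous_on[OF bounded_bilinear_lform] continuous_intros
          continuous_on_subset[OF W(3)] continuous_on_subset[OF smooth_map_continuous_on[OF U(3,1)]]) auto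
    then have "open V" unfolding V_def by (rule continuous_open_preimage) (use U W in auto)
    moreover have "x \<in> V" using \<eta> U W by (auto simp: V_def lform_simps)
    moreover have "smooth_map A V l"
    proof (rule smooth_map_cong[OF \<open>open V\<close>])
      show "smooth_map A V (\<lambda>y. \<eta> *\<^sub>R n y)"
        by (intro smooth_map_scale \<open>open V\<close> smooth_map_const smooth_map_subset[OF U(3)]) (auto simp: V_def)
      show "\<eta> *\<^sub>R n y = l y" if "y \<in> V" for y
      proof -
        have y: "y \<in> U" "lform (l y) (\<eta> *\<^sub>R n y) > 0" using that by (auto simp: V_def)
        have "l y = n y \<or> l y = - n y" using l(1)[of y] U(4)[OF y(1)] by auto
        then show ?thesis using \<eta>(1) y(2) U(5)[OF y(1)] by (auto simp: lform_simps)
      qed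
    qed
    ultimately show "\<exists>V. open V \<and> x \<in> V \<and> smooth_map A V l" by blast
  qed
  then show ?thesis using that[of l] l(1) unfolding M_def by blast
qed

lemma tangent_line_bundleE:
  assumes "tangent_line_bundle A T"
  obtains U X where "open U" "x \<in> U" "vector_field A U X" "\<And>y. y \<in> U \<Longrightarrow> X y \<noteq> (\<lambda>_. 0)"
    "\<And>y. y \<in> U \<Longrightarrow> T y = {\<lambda>c. r *\<^sub>R X y c | r. True}"
  using assms[unfolded tangent_line_bundle_def, rule_format, of x] by blast

lemma tangent_line_generator:
  assumes T: "tangent_line_bundle A T" and u: "u \<in> T y" "u \<noteq> (\<lambda>_. 0)" and v: "v \<in> T y"
  shows "\<exists>r. v = (\<lambda>c. r *\<^sub>R u c)" "v \<in> tangent_space A y"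
proof -
  obtain U X where X: "y \<in> U" "vector_field A U X" "\<And>y. y \<in> U \<Longrightarrow> T y = {\<lambda>c. r *\<^sub>R X y c | r. True}"
    by (rule tangent_line_bundleE[OF T, of y], rule that)
  obtain a b where a: "u = (\<lambda>c. a *\<^sub>R X y c)" and b: "v = (\<lambda>c. b *\<^sub>R X y c)"
    using u v X(3)[OF X(1)] by blast
  have "a \<noteq> 0" using u(2) a by auto
  then have "v = (\<lambda>c. (b / a) *\<^sub>R u c)" unfolding a b by simp
  then show "\<exists>r. v = (\<lambda>c. r *\<^sub>R u c)" by blast
  show "v \<in> tangent_space A y" unfolding b using tangent_space_scaleR vector_fieldD[OF X(2,1)] by blast
qed

lemma smooth_map_coordinate: "c \<in> A \<Longrightarrow> smooth_map A (fst c) (snd c)"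
  using surf unfolding smooth_map_def smooth_surface_def by blast

lemma dder_coordinate:
  assumes "c \<in> A" "x \<in> fst c" "v \<in> tangent_space A x"
  shows "dder A (snd c) x v = v c"
proof -
  obtain c' where c': "c' \<in> A" "x \<in> fst c'" using chart_exists by blast
  show ?thesis
    using dder_chart[OF smooth_map_coordinate[OF assms(1)] chart_open[OF assms(1)] assms(2) c' assms(3)]
      tangent_spaceD[OF assms(3) c'(1) assms(1) c'(2) assms(2)] by simp
qed

lemma integral_curve_exists:
  assumes T: "tangent_line_bundle A T"
  obtains \<epsilon> \<gamma> where "\<epsilon> > 0" "integral_curve A T \<gamma> {-\<epsilon><..<\<epsilon>}" "\<gamma> 0 = x"
proof -
  obtain U X where U: "open U" "x \<in> U" and X: "vector_field A U X" "\<And>y. y \<in> U \<Longrightarrow> X y \<noteq> (\<lambda>_. 0)"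
    "\<And>y. y \<in> U \<Longrightarrow> T y = {\<lambda>c. r *\<^sub>R X y c | r. True}"
    by (rule tangent_line_bundleE[OF T, of x], rule that)
  obtain c where c: "c \<in> A" "x \<in> fst c" using chart_exists by blast
  let ?D = "snd c ` (fst c \<inter> U)"
  have D: "open ?D" "snd c x \<in> ?D" using open_chart_image[OF c(1) U(1)] U c by auto
  have "smooth_on ?D (\<lambda>z. X (chart_inv c z) c)" using X(1) c unfolding vector_field_def by blast
  from ode_local_solution[OF D this]
  obtain \<epsilon> \<phi> where \<epsilon>: "\<epsilon> > 0" and \<phi>: "\<phi> 0 = snd c x"
    "\<And>t. t \<in> {-\<epsilon><..<\<epsilon>} \<Longrightarrow> \<phi> t \<in> ?D \<and> (\<phi> has_vector_derivative X (chart_inv c (\<phi> t)) c) (at t)"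
    by metis
  let ?I = "{-\<epsilon><..<\<epsilon>}" and ?\<gamma> = "chart_inv c \<circ> \<phi>"
  have \<gamma>: "?\<gamma> t \<in> fst c" "?\<gamma> t \<in> U" "snd c (?\<gamma> t) = \<phi> t" if "t \<in> ?I" for t
    using chart_imageE[OF c(1)] \<phi>(2)[OF that] by (metis comp_apply)+
  have cont: "continuous_on ?I ?\<gamma>"
  proof (rule continuous_on_compose)
    show "continuous_on ?I \<phi>"
      using \<phi>(2) has_vector_derivative_continuous by (intro continuous_at_imp_continuous_on) blast
    show "continuous_on (\<phi> ` ?I) (chart_inv c)"
      by (rule continuous_on_subset[OF homeomorphism_cont2[OF chart_homeo[OF c(1)]]]) (use \<phi>(2) in blast)
  qed
  have "integral_curve A T ?\<gamma> ?I"
    unfolding integral_curve_def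
  proof (intro conjI ballI cont)
    fix t assume t: "t \<in> ?I"
    have tv: "X (?\<gamma> t) \<in> tangent_space A (?\<gamma> t)" using vector_fieldD[OF X(1) \<gamma>(2)[OF t]] .
    have ct: "isCont ?\<gamma> t" using cont t continuous_on_eq_continuous_at open_greaterThanLessThan by blast
    have d: "((snd c \<circ> ?\<gamma>) has_vector_derivative X (?\<gamma> t) c) (at t)"
      by (rule has_vector_derivative_transform_within_open[of \<phi> _ _ ?I])
        (use \<phi>(2)[OF t] \<gamma>(3) t in auto)
    show "\<exists>v\<in>T (?\<gamma> t). v \<noteq> (\<lambda>_. 0) \<and>
        (\<forall>c'\<in>A. ?\<gamma> t \<in> fst c' \<longrightarrow> ((snd c' \<circ> ?\<gamma>) has_vector_derivative v c') (at t))"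
    proof (intro bexI[of _ "X (?\<gamma> t)"] conjI ballI impI)
      show "X (?\<gamma> t) \<in> T (?\<gamma> t)" unfolding X(3)[OF \<gamma>(2)[OF t]] by (rule CollectI, rule exI[of _ 1]) simp
      show "X (?\<gamma> t) \<noteq> (\<lambda>_. 0)" by (rule X(2)[OF \<gamma>(2)[OF t]])
      fix c' assume c': "c' \<in> A" "?\<gamma> t \<in> fst c'"
      show "((snd c' \<circ> ?\<gamma>) has_vector_derivative X (?\<gamma> t) c') (at t)"
        using dder_along_curve[OF smooth_map_coordinate[OF c'(1)] chart_open[OF c'(1)] ct c'(2) c(1) \<gamma>(1)[OF t] tv d]
        unfolding dder_coordinate[OF c' tv] .
    qed
  qed
  moreover have "?\<gamma> 0 = x" using \<phi>(1) chart_inv_snd c by simp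
  ultimately show ?thesis using that \<epsilon> by blast
qed

lemma dder_along_integral_curve:
  assumes T: "tangent_line_bundle A T" and \<gamma>: "integral_curve A T \<gamma> {a<..<b}" "t \<in> {a<..<b}"
    and g: "smooth_map A U g" "open U" "\<gamma> t \<in> U"
  obtains v where "v \<in> T (\<gamma> t)" "v \<noteq> (\<lambda>_. 0)" "((g \<circ> \<gamma>) has_vector_derivative dder A g (\<gamma> t) v) (at t)"
proof -
  obtain v where v: "v \<in> T (\<gamma> t)" "v \<noteq> (\<lambda>_. 0)"
    "\<And>c. c \<in> A \<Longrightarrow> \<gamma> t \<in> fst c \<Longrightarrow> ((snd c \<circ> \<gamma>) has_vector_derivative v c) (at t)"
    using \<gamma> unfolding integral_curve_def by blast
  obtain c where c: "c \<in> A" "\<gamma> t \<in> fst c" using chart_exists by blast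
  have "isCont \<gamma> t"
    using \<gamma> continuous_on_eq_continuous_at open_greaterThanLessThan unfolding integral_curve_def by blast
  then show ?thesis
    using that[OF v(1,2)] dder_along_curve[OF g(1,2) _ g(3) c tangent_line_generator(2)[OF T v(1,2,1)] v(3)[OF c]]
    by blast
qed

text \<open>A line bundle that is constant along the leaves is parallel along the distribution.\<close>

lemma constant_on_leaves_imp_parallel:
  assumes T: "tangent_line_bundle A T" and \<nu>: "\<And>y. y \<in> leaf A T x \<Longrightarrow> \<nu> y = \<nu> x"
    and n: "smooth_map A U n" "open U" "x \<in> U" "\<And>y. y \<in> U \<Longrightarrow> n y \<in> \<nu> y" "\<nu> x = span {n x}"
    and v: "v \<in> T x"
  shows "dder A n x v \<in> span {n x}"
proof -
  obtain \<epsilon> \<gamma> where \<epsilon>: "\<epsilon> > 0" and \<gamma>: "integral_curve A T \<gamma> {-\<epsilon><..<\<epsilon>}" "\<gamma> 0 = x"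
    using integral_curve_exists[OF T] by metis
  have 0: "0 \<in> {-\<epsilon><..<\<epsilon>}" using \<epsilon> by simp
  obtain w where w: "w \<in> T x" "w \<noteq> (\<lambda>_. 0)" "((n \<circ> \<gamma>) has_vector_derivative dder A n x w) (at 0)"
    using dder_along_integral_curve[OF T \<gamma>(1) 0 n(1,2)] \<gamma>(2) n(3) by metis
  let ?d = "dder A n x w"
  \<comment> \<open>The part of the derivative that is Euclidean orthogonal to \<open>n x\<close>; it vanishes, since \<open>n\<close> remains in the line of \<open>n x\<close> along the curve.\<close>
  define u where "u = ?d - ((?d \<bullet> n x) / (n x \<bullet> n x)) *\<^sub>R n x"
  have un: "u \<bullet> n x = 0" by (cases "n x = 0") (auto simp: u_def inner_diff_left)
  define J where "J = {-\<epsilon><..<\<epsilon>} \<inter> \<gamma> -` U"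
  have J: "open J" "0 \<in> J" unfolding J_def
    using continuous_open_preimage[OF _ open_greaterThanLessThan n(2)] \<gamma> 0 n(3)
    unfolding integral_curve_def by auto
  have zero: "u \<bullet> (n \<circ> \<gamma>) t = 0" if "t \<in> J" for t
  proof -
    have t: "t \<in> {-\<epsilon><..<\<epsilon>}" "\<gamma> t \<in> U" using that by (auto simp: J_def)
    have "\<gamma> t \<in> leaf A T x" unfolding leaf_def using \<gamma> 0 t(1) by blast
    then have "n (\<gamma> t) \<in> span {n x}" using \<nu> n(4)[OF t(2)] n(5) by metis
    then show ?thesis using un by (auto simp: span_singleton)
  qed
  have "((\<lambda>t. u \<bullet> (n \<circ> \<gamma>) t) has_vector_derivative u \<bullet> ?d) (at 0)"
    by (rule bounded_linear.has_vector_derivative[OF bounded_linear_inner_right w(3)])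
  moreover have "((\<lambda>t. u \<bullet> (n \<circ> \<gamma>) t) has_vector_derivative 0) (at 0)"
    by (rule has_vector_derivative_transform_within_open[of "\<lambda>t. 0", OF _ J]) (use zero in auto)
  ultimately have "u \<bullet> ?d = 0" by (rule vector_derivative_unique_at)
  then have "u \<bullet> u = 0" using un unfolding u_def by (simp add: inner_diff_right)
  then have "?d = ((?d \<bullet> n x) / (n x \<bullet> n x)) *\<^sub>R n x" by (simp add: u_def)
  then have "?d \<in> span {n x}" by (metis rangeI span_singleton)
  moreover obtain r where "v = (\<lambda>c. r *\<^sub>R w c)" using tangent_line_generator(1)[OF T w(1,2) v] by blast
  ultimately show ?thesis
    using dder_scaleR[OF n(1-3) tangent_line_generator(2)[OF T w(1,2,1)]] by (simp add: span_scale)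
qed

lemma parallel_imp_constant_on_leaves:
  assumes T: "tangent_line_bundle A T" and l: "smooth_map A UNIV l" "\<And>y v. v \<in> T y \<Longrightarrow> dder A l y v = 0"
    and y: "y \<in> leaf A T x"
  shows "l y = l x"
proof -
  obtain \<gamma> a b t t' where \<gamma>: "integral_curve A T \<gamma> {a<..<b}" "t \<in> {a<..<b}" "t' \<in> {a<..<b}" "\<gamma> t = x" "\<gamma> t' = y"
    using y unfolding leaf_def by blast
  have "\<exists>k. \<forall>s\<in>{a<..<b}. (l \<circ> \<gamma>) s = k"
  proof (rule has_derivative_zero_constant)
    show "((l \<circ> \<gamma>) has_derivative (\<lambda>h. 0)) (at s within {a<..<b})" if s: "s \<in> {a<..<b}" for s
    proof -
      obtain v where "v \<in> T (\<gamma> s)" "((l \<circ> \<gamma>) has_vector_derivative dder A l (\<gamma> s) v) (at s)"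
        using dder_along_integral_curve[OF T \<gamma>(1) s l(1)] by (metis UNIV_I open_UNIV)
      then have "((l \<circ> \<gamma>) has_vector_derivative 0) (at s)" using l(2) by metis
      then show ?thesis by (simp add: has_vector_derivative_def has_derivative_at_withinI)
    qed
  qed simp
  then show ?thesis using \<gamma> by force
qed

end

section \<open>Orthogonal projections and line spans\<close>

lemma span_line_eq:
  fixes e :: "'b::real_vector"
  assumes "u \<in> span {e}" "u \<noteq> 0"
  shows "span {e} = span {u}"
proof -
  obtain r where r: "u = r *\<^sub>R e" "r \<noteq> 0" using assms by (auto simp: span_singleton)
  then have "e = inverse r *\<^sub>R u" by simp
  then have "e \<in> span {u}" by (metis rangeI span_singleton)
  then show ?thesis using assms(1) by (simp add: span_eq)
qed

lemma exists_orthogonal_decomposition: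
  assumes W: "subspace W" and nd: "\<And>u. u \<in> W \<Longrightarrow> u \<in> perp W \<Longrightarrow> u = 0"
  shows "\<exists>w\<in>W. u - w \<in> perp W"
proof -
  have "W \<inter> perp W = {0}" using nd subspace_0[OF W] subspace_0[OF subspace_perp] by auto
  then have "dim (W \<inter> perp W) = 0" by simp
  moreover have "DIM(R42) = 6" by simp
  ultimately have "dim {x + y |x y. x \<in> W \<and> y \<in> perp W} = DIM(R42)"
    using dim_sums_Int[OF W subspace_perp[of W]] dim_perp[of W] by linarith
  then have "span {x + y |x y. x \<in> W \<and> y \<in> perp W} = UNIV"
    unfolding dim_eq_full .
  then have "{x + y |x y. x \<in> W \<and> y \<in> perp W} = UNIV"
    by (simp only: span_eq_iff[THEN iffD2, OF subspace_sums[OF W subspace_perp[of W]]])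
  then have "u \<in> {x + y |x y. x \<in> W \<and> y \<in> perp W}" by (simp only: UNIV_I)
  then obtain x y where "u = x + y" "x \<in> W" "y \<in> perp W" by blast
  then show ?thesis by (intro bexI[of _ x]) auto
qed

lemma oproj_eqI:
  assumes W: "subspace W" and nd: "\<And>u. u \<in> W \<Longrightarrow> u \<in> perp W \<Longrightarrow> u = 0"
    and w: "w \<in> W" "u - w \<in> perp W"
  shows "oproj W u = w"
  unfolding oproj_def
proof (rule the_equality)
  show "w' = w" if "w' \<in> W \<and> u - w' \<in> perp W" for w'
  proof -
    have "(u - w) - (u - w') \<in> perp W" using subspace_diff[OF subspace_perp w(2)] that by blast
    moreover have "w' - w \<in> W" using subspace_diff[OF W] that w by blast
    ultimately have "w' - w = 0" by (intro nd) auto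
    then show ?thesis by simp
  qed
qed (use w in blast)

lemma timelike_perp_nondegenerate:
  assumes p: "lform p p \<noteq> 0" and u: "u \<in> perp {p}" "u \<in> perp (perp {p})"
  shows "u = 0"
proof (rule lform_nondegenerate)
  fix w
  define w' where "w' = w - (lform w p / lform p p) *\<^sub>R p"
  have "w' \<in> perp {p}" using p by (simp add: perp_def w'_def lform_simps)
  then have "lform u w' = 0" using u(2) unfolding perp_def[of "perp {p}"] by blast
  then show "lform u w = 0" using u(1) by (simp add: w'_def lform_simps perp_def)
qed

lemma oproj_perp_vector:
  assumes p: "lform p p \<noteq> 0"
  shows "oproj (perp {p}) u = u - (lform u p / lform p p) *\<^sub>R p"
proof (rule oproj_eqI[OF subspace_perp timelike_perp_nondegenerate[OF p]])
  show "u - (lform u p / lform p p) *\<^sub>R p \<in> perp {p}" using p by (simp add: perp_def lform_simps)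
  show "u - (u - (lform u p / lform p p) *\<^sub>R p) \<in> perp (perp {p})"
  proof -
    have "lform p w = 0" if "w \<in> perp {p}" for w using that by (simp add: perp_def lform_commute[of p w])
    then show ?thesis unfolding perp_def[of "perp {p}"] by (simp add: lform_scaleR_left)
  qed
qed

lemma timelike_perp_exists: "\<exists>p. timelike p \<and> lform q p = 0"
proof -
  let ?w = "snd q"
  define v :: "real^2" where "v = (if ?w = 0 then axis 1 1 else vector [- (?w $ 2), ?w $ 1])"
  have "v \<noteq> 0"
  proof (cases "?w = 0")
    case False
    then have "?w $ 1 \<noteq> 0 \<or> ?w $ 2 \<noteq> 0" by (simp add: vec_eq_iff forall_2)
    then show ?thesis using False by (auto simp: v_def vec_eq_iff forall_2)
  qed (simp add: v_def)
  moreover have "?w \<bullet> v = 0" by (simp add: v_def inner_vec_def sum_2)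
  ultimately have "timelike (0, v) \<and> lform q (0, v) = 0" by (simp add: timelike_def lform_def)
  then show ?thesis by blast
qed

context surface
begin

text \<open>The coefficients of a smooth section with respect to a smooth frame of rank one or two are smooth.\<close>

lemma smooth_coefficient_line:
  assumes U: "open U" and sm: "smooth_map A U \<sigma>" "smooth_map A U \<rho>"
    and y: "\<And>y. y \<in> U \<Longrightarrow> \<sigma> y \<noteq> 0 \<and> \<rho> y \<in> span {\<sigma> y}"
  obtains g :: "'a \<Rightarrow> real" where "smooth_map A U g" "\<And>y. y \<in> U \<Longrightarrow> \<rho> y = g y *\<^sub>R \<sigma> y"
proof (rule that[of "\<lambda>y. (\<rho> y \<bullet> \<sigma> y) * inverse (\<sigma> y \<bullet> \<sigma> y)"])
  show "smooth_map A U (\<lambda>y. (\<rho> y \<bullet> \<sigma> y) * inverse (\<sigma> y \<bullet> \<sigma> y))"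
    by (intro smooth_map_bilinear[OF U bounded_bilinear_mult] smooth_map_inverse[OF U] smooth_map_inner[OF U] sm)
      (use y in auto)
  show "\<rho> x = ((\<rho> x \<bullet> \<sigma> x) * inverse (\<sigma> x \<bullet> \<sigma> x)) *\<^sub>R \<sigma> x" if "x \<in> U" for x
    using y[OF that] by (auto simp: span_singleton)
qed

lemma smooth_coefficient_plane:
  assumes U: "open U" and sm: "smooth_map A U \<sigma>" "smooth_map A U \<tau>" "smooth_map A U \<rho>"
    and y: "\<And>y. y \<in> U \<Longrightarrow> \<sigma> y \<notin> span {\<tau> y} \<and> \<tau> y \<noteq> 0 \<and> \<rho> y - h y *\<^sub>R \<sigma> y \<in> span {\<tau> y}"
  shows "smooth_map A U h"
proof -
  \<comment> \<open>A multiple of the Euclidean orthogonal projection of \<open>\<sigma>\<close> to the complement of \<open>\<tau>\<close>; pairing with it isolates the coefficient of \<open>\<sigma>\<close>.\<close>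
  define w where "w y = (\<tau> y \<bullet> \<tau> y) *\<^sub>R \<sigma> y + (-1) *\<^sub>R ((\<sigma> y \<bullet> \<tau> y) *\<^sub>R \<tau> y)" for y
  have w_smooth: "smooth_map A U w" unfolding w_def
    by (intro smooth_map_add[OF U] smooth_map_scale[OF U] smooth_map_inner[OF U] smooth_map_const sm)
  have w\<tau>: "w y \<bullet> \<tau> y = 0" "\<tau> y \<bullet> w y = 0" for y
    by (simp_all add: w_def inner_diff_left inner_diff_right inner_commute)
  have w\<sigma>: "\<sigma> y \<bullet> w y \<noteq> 0" if yU: "y \<in> U" for y
  proof
    assume "\<sigma> y \<bullet> w y = 0"
    moreover have "w y \<bullet> w y = (\<tau> y \<bullet> \<tau> y) * (\<sigma> y \<bullet> w y) - (\<sigma> y \<bullet> \<tau> y) * (\<tau> y \<bullet> w y)"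
      by (subst (1) w_def) (simp add: inner_diff_left)
    ultimately have "w y \<bullet> w y = 0" using w\<tau>(2)[of y] by simp
    then have "w y = 0" by simp
    then have eq: "(\<tau> y \<bullet> \<tau> y) *\<^sub>R \<sigma> y = (\<sigma> y \<bullet> \<tau> y) *\<^sub>R \<tau> y" by (simp add: w_def)
    have "\<sigma> y = inverse (\<tau> y \<bullet> \<tau> y) *\<^sub>R ((\<tau> y \<bullet> \<tau> y) *\<^sub>R \<sigma> y)" using y[OF yU] by simp
    then have "\<sigma> y = (inverse (\<tau> y \<bullet> \<tau> y) * (\<sigma> y \<bullet> \<tau> y)) *\<^sub>R \<tau> y" unfolding eq by simp
    then show False using y[OF yU] by (metis rangeI span_singleton)
  qed
  show ?thesis
  proof (rule smooth_map_cong[OF U])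
    show "smooth_map A U (\<lambda>y. (\<rho> y \<bullet> w y) * inverse (\<sigma> y \<bullet> w y))"
      by (intro smooth_map_bilinear[OF U bounded_bilinear_mult] smooth_map_inverse[OF U] smooth_map_inner[OF U]
          sm w_smooth w\<sigma>)
    show "(\<rho> x \<bullet> w x) * inverse (\<sigma> x \<bullet> w x) = h x" if x: "x \<in> U" for x
    proof -
      obtain k where "\<rho> x - h x *\<^sub>R \<sigma> x = k *\<^sub>R \<tau> x" using y[OF x] by (auto simp: span_singleton)
      then have "\<rho> x = h x *\<^sub>R \<sigma> x + k *\<^sub>R \<tau> x" by (simp add: algebra_simps)
      then show ?thesis using w\<sigma>[OF x] w\<tau>(2)[of x] by (simp add: inner_add_left)
    qed
  qed
qed

end

section \<open>Legendre surfaces\<close>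

text \<open>A regular umbilic-free Legendre map with its curvature sphere congruences and curvature subbundles.\<close>

locale legendre_surface = surface A
  for A :: "('a::{t2_space, second_countable_topology}) chart set" +
  fixes f :: "'a \<Rightarrow> R42 set" and s :: "nat \<Rightarrow> 'a \<Rightarrow> R42 set" and T :: "nat \<Rightarrow> 'a \<Rightarrow> 'a tvec set"
  assumes legendre: "legendre_map A f" and data: "curvature_data A f s T"
    and regular: "regular_legendre A s"
begin

lemma other_index: "i \<in> {1,2} \<Longrightarrow> 3 - i \<in> {1,2}" "i \<in> {1,2} \<Longrightarrow> 3 - (3 - i) = (i :: nat)"
  by auto

lemma T_line: "i \<in> {1,2} \<Longrightarrow> tangent_line_bundle A (T i)"
  using data unfolding curvature_data_def by blast

lemma s_line: "i \<in> {1,2} \<Longrightarrow> subbundle A 1 (s i)" and s_sub: "i \<in> {1,2} \<Longrightarrow> s i x \<subseteq> f x"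
  using data[unfolded curvature_data_def, THEN conjunct1] by blast+

lemma s_disjoint: "i \<in> {1,2} \<Longrightarrow> s i x \<inter> s (3 - i) x = {0}"
proof -
  have "s 1 x \<inter> s 2 x = {0}"
    using data[unfolded curvature_data_def, THEN conjunct2, THEN conjunct1] by (rule spec)
  then show "i \<in> {1,2} \<Longrightarrow> s i x \<inter> s (3 - i) x = {0}" by (elim insertE; simp add: Int_commute)
qed

lemma f_plane: "subspace (f x)" "dim (f x) = 2"
proof -
  have "subbundle A 2 f" using legendre unfolding legendre_map_def null_subbundle_def by blast
  from this[unfolded subbundle_def, THEN spec[of _ x]] obtain U and e :: "nat \<Rightarrow> 'a \<Rightarrow> R42"
    where U: "x \<in> U" "\<forall>y\<in>U. f y = span ((\<lambda>j. e j y) ` {..<2::nat}) \<and> dim (f y) = 2"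
    by (elim exE conjE) (rule that)
  have E: "f x = span ((\<lambda>j. e j x) ` {..<2::nat}) \<and> dim (f x) = 2" by (rule bspec[OF U(2,1)])
  show "subspace (f x)" by (subst conjunct1[OF E]) (rule subspace_span)
  show "dim (f x) = 2" by (rule conjunct2[OF E])
qed

lemma f_null: "u \<in> f x \<Longrightarrow> w \<in> f x \<Longrightarrow> lform u w = 0"
  using legendre unfolding legendre_map_def null_subbundle_def totally_isotropic_def by blast

lemma s_span:
  assumes "i \<in> {1,2}" "u \<in> s i x" "u \<noteq> 0"
  shows "s i x = span {u}"
proof -
  obtain e where "s i x = span {e}" using line_subbundle_frame[OF s_line[OF assms(1)], of x] by metis
  then show ?thesis using span_line_eq assms by metis
qed

lemma f_span:
  assumes i: "i \<in> {1,2}" and u: "u \<in> s i x" "u \<noteq> 0" and w: "w \<in> s (3 - i) x" "w \<noteq> 0"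
  shows "independent {u, w}" "u \<noteq> w" "f x = span {u, w}" "u \<notin> span {w}" "w \<notin> span {u}"
proof -
  show un: "u \<notin> span {w}" using s_span[OF other_index(1)[OF i] w] s_disjoint[OF i, of x] u by blast
  show "w \<notin> span {u}" using s_span[OF i u] s_disjoint[OF i, of x] w by blast
  from un show ind: "independent {u, w}" "u \<noteq> w" using w(2) by (auto simp: independent_insert span_base)
  have "span {u, w} = span (f x)"
  proof (rule dim_eq_span)
    show "{u, w} \<subseteq> f x" using s_sub[OF i] s_sub[OF other_index(1)[OF i]] u w by blast
    show "dim (f x) \<le> dim {u, w}" using f_plane(2) ind by (simp add: dim_eq_card_independent)
  qed
  then show "f x = span {u, w}" using f_plane(1) span_eq_iff by metis
qed

text \<open>
  If the derivatives of two spanning sections along a tangent vector were in \<open>f\<close>, then, by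
  the product rule, so would be the derivative of each section of \<open>f\<close>, and \<open>f\<close> would not be immersed.
\<close>

lemma frame_immersed:
  assumes i: "i \<in> {1,2}" and U: "open U" "y \<in> U"
    and \<sigma>: "\<sigma> \<in> sections A U (s i)" "\<And>z. z \<in> U \<Longrightarrow> \<sigma> z \<noteq> 0"
    and \<tau>: "\<tau> \<in> sections A U (s (3 - i))" "\<And>z. z \<in> U \<Longrightarrow> \<tau> z \<noteq> 0"
    and v: "v \<in> tangent_space A y" "v \<noteq> (\<lambda>_. 0)" "dder A \<tau> y v \<in> f y"
  shows "dder A \<sigma> y v \<notin> f y"
proof
  assume d: "dder A \<sigma> y v \<in> f y"
  have sm: "smooth_map A U \<sigma>" "smooth_map A U \<tau>" and mem: "\<And>z. z \<in> U \<Longrightarrow> \<sigma> z \<in> s i z"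
    "\<And>z. z \<in> U \<Longrightarrow> \<tau> z \<in> s (3 - i) z" using \<sigma>(1) \<tau>(1) unfolding sections_def by auto
  note fs = f_span[OF i mem(1) \<sigma>(2) mem(2) \<tau>(2)]
  have "dder A \<rho> y v \<in> f y" if V: "open V" "y \<in> V" "\<rho> \<in> sections A V f" for V \<rho>
  proof -
    let ?W = "U \<inter> V"
    have W: "open ?W" "y \<in> ?W" using U V by auto
    have smW: "smooth_map A ?W \<sigma>" "smooth_map A ?W \<tau>" "smooth_map A ?W \<rho>"
      using sm V(3) smooth_map_subset unfolding sections_def by blast+
    have "\<exists>a b. \<rho> z = a *\<^sub>R \<sigma> z + b *\<^sub>R \<tau> z" if "z \<in> ?W" for z
      using V(3) fs(3)[of z] that unfolding sections_def by (auto simp: in_span_pair)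
    then obtain a b where ab: "\<And>z. z \<in> ?W \<Longrightarrow> \<rho> z = a z *\<^sub>R \<sigma> z + b z *\<^sub>R \<tau> z" by metis
    have nsp: "\<sigma> z \<notin> span {\<tau> z}" "\<tau> z \<notin> span {\<sigma> z}" if "z \<in> ?W" for z
      using fs(4,5) that by blast+
    have "smooth_map A ?W a"
      by (rule smooth_coefficient_plane[OF W(1) smW]) (use nsp ab \<tau>(2) in \<open>auto simp: span_base span_scale\<close>)
    moreover have "smooth_map A ?W b"
      by (rule smooth_coefficient_plane[OF W(1) smW(2,1,3)]) (use nsp ab \<sigma>(2) in \<open>auto simp: span_base span_scale\<close>)
    ultimately have ab_sm: "smooth_map A ?W (\<lambda>z. a z *\<^sub>R \<sigma> z)" "smooth_map A ?W (\<lambda>z. b z *\<^sub>R \<tau> z)"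
      "smooth_map A ?W a" "smooth_map A ?W b"
      using smooth_map_scale[OF W(1)] smW by blast+
    have "dder A \<rho> y v = dder A (\<lambda>z. a z *\<^sub>R \<sigma> z + b z *\<^sub>R \<tau> z) y v"
      by (rule dder_cong[OF W]) (rule ab)
    also have "\<dots> = (a y *\<^sub>R dder A \<sigma> y v + dder A a y v *\<^sub>R \<sigma> y) + (b y *\<^sub>R dder A \<tau> y v + dder A b y v *\<^sub>R \<tau> y)"
      unfolding dder_add[OF ab_sm(1,2) W] dder_bilinear[OF bounded_bilinear_scaleR ab_sm(3) smW(1) W]
        dder_bilinear[OF bounded_bilinear_scaleR ab_sm(4) smW(2) W] ..
    also have "\<dots> \<in> f y"
      using d v(3) mem s_sub[OF i, of y] s_sub[OF other_index(1)[OF i], of y] U(2)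
      by (intro subspace_add[OF f_plane(1)] subspace_scale[OF f_plane(1)]) blast+
    finally show ?thesis .
  qed
  then show False using legendre v(1,2) unfolding legendre_map_def immersive_def by blast
qed

lemma frame_regular:
  assumes i: "i \<in> {1,2}" and U: "open U" "y \<in> U"
    and \<sigma>: "\<sigma> \<in> sections A U (s i)" "\<And>z. z \<in> U \<Longrightarrow> \<sigma> z \<noteq> 0"
    and v: "v \<in> tangent_space A y" "v \<noteq> (\<lambda>_. 0)"
  shows "dder A \<sigma> y v \<notin> span {\<sigma> y}"
proof
  assume d: "dder A \<sigma> y v \<in> span {\<sigma> y}"
  have sm: "smooth_map A U \<sigma>" and sp: "\<And>z. z \<in> U \<Longrightarrow> s i z = span {\<sigma> z}"
    using \<sigma> s_span[OF i] unfolding sections_def by auto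
  have "dder A \<rho> y v \<in> s i y" if V: "open V" "y \<in> V" "\<rho> \<in> sections A V (s i)" for V \<rho>
  proof -
    let ?W = "U \<inter> V"
    have W: "open ?W" "y \<in> ?W" using U V by auto
    have smW: "smooth_map A ?W \<sigma>" "smooth_map A ?W \<rho>"
      using sm V(3) smooth_map_subset unfolding sections_def by blast+
    have "\<sigma> z \<noteq> 0 \<and> \<rho> z \<in> span {\<sigma> z}" if "z \<in> ?W" for z
      using V(3) sp[of z] \<sigma>(2) that unfolding sections_def by auto
    then obtain g where g: "smooth_map A ?W g" "\<And>z. z \<in> ?W \<Longrightarrow> \<rho> z = g z *\<^sub>R \<sigma> z"
      using smooth_coefficient_line[OF W(1) smW] by blast
    have "dder A \<rho> y v = dder A (\<lambda>z. g z *\<^sub>R \<sigma> z) y v" by (rule dder_cong[OF W]) (rule g(2))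
    also have "\<dots> = g y *\<^sub>R dder A \<sigma> y v + dder A g y v *\<^sub>R \<sigma> y"
      by (rule dder_bilinear[OF bounded_bilinear_scaleR g(1) smW(1) W])
    also have "\<dots> \<in> s i y" unfolding sp[OF U(2)] using d by (intro span_add span_scale) (auto simp: span_base)
    finally show ?thesis .
  qed
  moreover have "immersive A (s i)" using regular i unfolding regular_legendre_def by blast
  ultimately show False using v unfolding immersive_def by blast
qed

lemma legendre_frameI:
  assumes i: "i \<in> {1,2}" and U: "open U"
    and \<sigma>: "\<sigma> \<in> sections A U (s i)" "\<And>z. z \<in> U \<Longrightarrow> \<sigma> z \<noteq> 0"
    and \<tau>: "\<tau> \<in> sections A U (s (3 - i))" "\<And>z. z \<in> U \<Longrightarrow> \<tau> z \<noteq> 0"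
    and X: "X \<in> tangent_sections A U (T i)" "\<And>z. z \<in> U \<Longrightarrow> X z \<noteq> (\<lambda>_. 0)"
    and Y: "Y \<in> tangent_sections A U (T (3 - i))" "\<And>z. z \<in> U \<Longrightarrow> Y z \<noteq> (\<lambda>_. 0)"
  shows "legendre_frame_pair A U \<sigma> \<tau> X Y"
proof -
  note i' = other_index(1)[OF i]
  have sm: "smooth_map A U \<sigma>" "smooth_map A U \<tau>" and mem: "\<And>z. z \<in> U \<Longrightarrow> \<sigma> z \<in> s i z"
    "\<And>z. z \<in> U \<Longrightarrow> \<tau> z \<in> s (3 - i) z" using \<sigma>(1) \<tau>(1) unfolding sections_def by auto
  have memf: "\<sigma> z \<in> f z" "\<tau> z \<in> f z" if "z \<in> U" for z
    using mem that s_sub[OF i] s_sub[OF i'] by blast+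
  note fs = f_span[OF i mem(1) \<sigma>(2) mem(2) \<tau>(2)]
  have vf: "vector_field A U X" "vector_field A U Y" using X(1) Y(1) unfolding tangent_sections_def by auto
  have X\<sigma>: "dfield A X \<sigma> \<in> sections A U f" using data i U \<sigma>(1) X(1) unfolding curvature_data_def by blast
  have Y\<tau>: "dfield A Y \<tau> \<in> sections A U f" using data i' U \<tau>(1) Y(1) unfolding curvature_data_def by blast
  have der: "dfield A V \<sigma> z \<in> perp (f z)" if "z \<in> U" "vector_field A U V" for z V
  proof -
    have "\<sigma> \<in> sections A U f" using sm memf unfolding sections_def by blast
    then have "dfield A V \<sigma> z \<in> derived A f z"
      using U that vector_fieldD[OF that(2,1)] unfolding derived_def dfield_def by blast
    then show ?thesis using legendre unfolding legendre_map_def by blast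
  qed
  have "legendre_frame A U \<sigma> \<tau> X Y"
  proof
    fix y assume y: "y \<in> U"
    show "lform (\<sigma> y) (\<sigma> y) = 0" "lform (\<tau> y) (\<tau> y) = 0" "lform (\<sigma> y) (\<tau> y) = 0"
      using f_null memf[OF y] by blast+
    show "independent {\<sigma> y, \<tau> y}" "\<sigma> y \<noteq> \<tau> y" using fs[OF y y y y] by blast+
    show "lform (dfield A X \<sigma> y) (\<tau> y) = 0" "lform (dfield A Y \<sigma> y) (\<tau> y) = 0"
      using der[OF y vf(1)] der[OF y vf(2)] memf[OF y] unfolding perp_def by blast+
    show "dfield A X \<sigma> y \<in> span {\<sigma> y, \<tau> y}" "dfield A Y \<tau> y \<in> span {\<sigma> y, \<tau> y}"
      using X\<sigma> Y\<tau> y fs(3)[OF y y y y] unfolding sections_def by auto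
    then have in_f: "dder A \<sigma> y (X y) \<in> f y" "dder A \<tau> y (Y y) \<in> f y"
      using fs(3)[OF y y y y] by (simp_all add: dfield_def)
    show "dfield A Y \<sigma> y \<notin> span {\<sigma> y, \<tau> y}"
      using frame_immersed[OF i U y \<sigma> \<tau> vector_fieldD[OF vf(2) y] Y(2)[OF y] in_f(2)] fs(3)[OF y y y y]
      by (simp add: dfield_def)
    have \<sigma>': "\<sigma> \<in> sections A U (s (3 - (3 - i)))" using \<sigma>(1) other_index(2)[OF i] by simp
    show "dfield A X \<tau> y \<notin> span {\<sigma> y, \<tau> y}"
      using frame_immersed[OF i' U y \<tau> \<sigma>' \<sigma>(2) vector_fieldD[OF vf(1) y] X(2)[OF y] in_f(1)] fs(3)[OF y y y y]
      by (simp add: dfield_def)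
    show "dfield A X \<sigma> y \<notin> span {\<sigma> y}"
      using frame_regular[OF i U y \<sigma> vector_fieldD[OF vf(1) y] X(2)[OF y]] by (simp add: dfield_def)
    show "dfield A Y \<tau> y \<notin> span {\<tau> y}"
      using frame_regular[OF i' U y \<tau> vector_fieldD[OF vf(2) y] Y(2)[OF y]] by (simp add: dfield_def)
  qed (use U sm vf in blast)+
  then show ?thesis unfolding legendre_frame_pair_def using legendre_frame.swap by blast
qed

text \<open>
  Nowhere vanishing sections over the open set \<open>U\<close>; \<open>\<sigma>\<close> and \<open>X\<close> belong to the index \<open>i\<close>, while \<open>\<tau>\<close> and \<open>Y\<close>
  belong to the other index.
\<close>

definition adapted_frame where
  "adapted_frame i U \<sigma> \<tau> X Y \<longleftrightarrow> open U \<and>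
     \<sigma> \<in> sections A U (s i) \<and> \<tau> \<in> sections A U (s (3 - i)) \<and>
     X \<in> tangent_sections A U (T i) \<and> Y \<in> tangent_sections A U (T (3 - i)) \<and>
     (\<forall>z\<in>U. \<sigma> z \<noteq> 0 \<and> \<tau> z \<noteq> 0 \<and> X z \<noteq> (\<lambda>_. 0) \<and> Y z \<noteq> (\<lambda>_. 0))"

lemma adapted_frame_pair: "i \<in> {1,2} \<Longrightarrow> adapted_frame i U \<sigma> \<tau> X Y \<Longrightarrow> legendre_frame_pair A U \<sigma> \<tau> X Y"
  unfolding adapted_frame_def by (intro legendre_frameI) auto

lemma adapted_frame_swap: "i \<in> {1,2} \<Longrightarrow> adapted_frame i U \<sigma> \<tau> X Y \<Longrightarrow> adapted_frame (3 - i) U \<tau> \<sigma> Y X"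
  unfolding adapted_frame_def using other_index(2) by auto

lemma sections_subset: "\<sigma> \<in> sections A U E \<Longrightarrow> V \<subseteq> U \<Longrightarrow> \<sigma> \<in> sections A V E"
  unfolding sections_def using smooth_map_subset by blast

lemma tangent_sections_subset: "X \<in> tangent_sections A U E \<Longrightarrow> V \<subseteq> U \<Longrightarrow> X \<in> tangent_sections A V E"
  unfolding tangent_sections_def using vector_field_subset by blast

lemma adapted_frame_f:
  assumes "i \<in> {1,2}" "adapted_frame i U \<sigma> \<tau> X Y" "y \<in> U"
  shows "f y = span {\<sigma> y, \<tau> y}"
  by (rule f_span(3)[OF assms(1)]) (use assms(2,3) in \<open>auto simp: adapted_frame_def sections_def\<close>)

lemma line_section_exists:
  assumes "subbundle A 1 E"
  obtains U e where "open U" "x \<in> U" "e \<in> sections A U E" "\<And>y. y \<in> U \<Longrightarrow> e y \<noteq> 0"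
proof -
  obtain U e where "open U" "x \<in> U" "smooth_map A U e" "\<And>y. y \<in> U \<Longrightarrow> e y \<noteq> 0" "\<And>y. y \<in> U \<Longrightarrow> E y = span {e y}"
    by (rule line_subbundle_frame[OF assms, of x], rule that)
  then show ?thesis using that[of U e] by (auto simp: sections_def span_base)
qed

lemma tangent_section_exists:
  assumes "tangent_line_bundle A E"
  obtains U X where "open U" "x \<in> U" "X \<in> tangent_sections A U E" "\<And>y. y \<in> U \<Longrightarrow> X y \<noteq> (\<lambda>_. 0)"
proof -
  obtain U X where U: "open U" "x \<in> U" "vector_field A U X" "\<And>y. y \<in> U \<Longrightarrow> X y \<noteq> (\<lambda>_. 0)"
    "\<And>y. y \<in> U \<Longrightarrow> E y = {\<lambda>c. r *\<^sub>R X y c | r. True}"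
    by (rule tangent_line_bundleE[OF assms, of x], rule that)
  have "X y \<in> E y" if "y \<in> U" for y
    unfolding U(5)[OF that] by (rule CollectI, rule exI[of _ 1]) simp
  then show ?thesis using that[of U X] U by (simp add: tangent_sections_def)
qed

lemma adapted_frame_exists:
  assumes i: "i \<in> {1,2}"
  obtains U \<sigma> \<tau> X Y where "x \<in> U" "adapted_frame i U \<sigma> \<tau> X Y"
proof -
  note i' = other_index(1)[OF i]
  obtain U1 \<sigma> where 1: "open U1" "x \<in> U1" "\<sigma> \<in> sections A U1 (s i)" "\<And>y. y \<in> U1 \<Longrightarrow> \<sigma> y \<noteq> 0"
    by (rule line_section_exists[OF s_line[OF i], of x], rule that)
  obtain U2 \<tau> where 2: "open U2" "x \<in> U2" "\<tau> \<in> sections A U2 (s (3 - i))" "\<And>y. y \<in> U2 \<Longrightarrow> \<tau> y \<noteq> 0"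
    by (rule line_section_exists[OF s_line[OF i'], of x], rule that)
  obtain U3 X where 3: "open U3" "x \<in> U3" "X \<in> tangent_sections A U3 (T i)" "\<And>y. y \<in> U3 \<Longrightarrow> X y \<noteq> (\<lambda>_. 0)"
    by (rule tangent_section_exists[OF T_line[OF i], of x], rule that)
  obtain U4 Y where 4: "open U4" "x \<in> U4" "Y \<in> tangent_sections A U4 (T (3 - i))" "\<And>y. y \<in> U4 \<Longrightarrow> Y y \<noteq> (\<lambda>_. 0)"
    by (rule tangent_section_exists[OF T_line[OF i'], of x], rule that)
  let ?U = "U1 \<inter> U2 \<inter> U3 \<inter> U4"
  show ?thesis
  proof (rule that[of ?U \<sigma> \<tau> X Y])
    show "adapted_frame i ?U \<sigma> \<tau> X Y"
      unfolding adapted_frame_def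
      using sections_subset[OF 1(3), of ?U] sections_subset[OF 2(3), of ?U]
        tangent_sections_subset[OF 3(3), of ?U] tangent_sections_subset[OF 4(3), of ?U] 1 2 3 4
      by (auto intro!: open_Int)
  qed (use 1 2 3 4 in auto)
qed

text \<open>
  The span defining the osculating complex does not depend on the sections: for each choice it is the
  orthogonal complement of the span belonging to one fixed choice for the other index.
\<close>

lemma osculating_complex_eq:
  assumes i: "i \<in> {1,2}" and fr: "adapted_frame i U \<sigma> \<tau> X Y" and y: "y \<in> U"
  shows "osculating_complex A s T i y = span {\<sigma> y, dfield A Y \<sigma> y, dfield A Y (dfield A Y \<sigma>) y}"
    "osculating_complex A s T i y = perp {\<tau> y, dfield A X \<tau> y, dfield A X (dfield A X \<tau>) y}"
proof -
  interpret F: legendre_frame_pair A U \<sigma> \<tau> X Y by (rule adapted_frame_pair[OF i fr])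
  let ?P = "perp {\<tau> y, dfield A X \<tau> y, dfield A X (dfield A X \<tau>) y}"
  have "span {\<sigma>' y, dfield A Y' \<sigma>' y, dfield A Y' (dfield A Y' \<sigma>') y} = ?P"
    if V: "open V" "y \<in> V" "\<sigma>' \<in> sections A V (s i)" "Y' \<in> tangent_sections A V (T (3 - i))"
      "\<forall>z\<in>V. \<sigma>' z \<noteq> 0 \<and> Y' z \<noteq> (\<lambda>_. 0)" for V \<sigma>' Y'
  proof -
    have "adapted_frame i (U \<inter> V) \<sigma>' \<tau> X Y'"
      using fr V sections_subset[OF V(3), of "U \<inter> V"] tangent_sections_subset[OF V(4), of "U \<inter> V"]
        sections_subset[of \<tau> U _ "U \<inter> V"] tangent_sections_subset[of X U _ "U \<inter> V"]
      unfolding adapted_frame_def by (auto intro!: open_Int)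
    then show ?thesis
      using legendre_frame_pair.osculating_span[OF adapted_frame_pair[OF i]] y V(2) by blast
  qed
  then have "osculating_complex A s T i y \<subseteq> ?P"
    unfolding osculating_complex_def complex_of_def by blast
  moreover have sp: "span {\<sigma> y, dfield A Y \<sigma> y, dfield A Y (dfield A Y \<sigma>) y} = ?P"
    by (rule F.osculating_span[OF y])
  moreover have "span {\<sigma> y, dfield A Y \<sigma> y, dfield A Y (dfield A Y \<sigma>) y} \<subseteq> osculating_complex A s T i y"
    unfolding osculating_complex_def complex_of_def
    using fr y unfolding adapted_frame_def by blast
  ultimately show "osculating_complex A s T i y = span {\<sigma> y, dfield A Y \<sigma> y, dfield A Y (dfield A Y \<sigma>) y}"
    "osculating_complex A s T i y = ?P" by auto
qed

lemma osculating_complex_orthogonal: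
  assumes i: "i \<in> {1,2}"
  shows "subspace (osculating_complex A s T i y)"
    "perp (osculating_complex A s T i y) = osculating_complex A s T (3 - i) y"
    "u \<in> osculating_complex A s T i y \<Longrightarrow> u \<in> perp (osculating_complex A s T i y) \<Longrightarrow> u = 0"
proof -
  obtain U \<sigma> \<tau> X Y where fr: "y \<in> U" "adapted_frame i U \<sigma> \<tau> X Y" using adapted_frame_exists[OF i] by metis
  interpret F: legendre_frame_pair A U \<sigma> \<tau> X Y by (rule adapted_frame_pair[OF i fr(2)])
  show "subspace (osculating_complex A s T i y)"
    unfolding osculating_complex_eq(1)[OF i fr(2,1)] by (rule subspace_span)
  show "perp (osculating_complex A s T i y) = osculating_complex A s T (3 - i) y"
    unfolding osculating_complex_eq(1)[OF i fr(2,1)] perp_span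
      osculating_complex_eq(2)[OF other_index(1)[OF i] adapted_frame_swap[OF i fr(2)] fr(1)] ..
  show "u = 0" if "u \<in> osculating_complex A s T i y" "u \<in> perp (osculating_complex A s T i y)"
    using F.osculating_nondegenerate[OF fr(1)] that unfolding osculating_complex_eq(1)[OF i fr(2,1)] by blast
qed

text \<open>Derivatives of sections of an osculating sphere complex stay in the osculating complex.\<close>

lemma split_form_zero_imp:
  assumes i: "i \<in> {1,2}" and V: "open V" "y \<in> V"
    and \<xi>: "\<And>z. z \<in> V \<Longrightarrow> \<xi> z \<in> osculating_complex A s T i z"
    and zero: "split_form A (osculating_complex A s T) \<xi> y v = 0"
  shows "dder A \<xi> y v \<in> osculating_complex A s T i y"
proof -
  let ?S = "osculating_complex A s T"
  note i' = other_index(1)[OF i]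
  note oc = osculating_complex_orthogonal[OF i] and oc' = osculating_complex_orthogonal[OF i']
  have own: "oproj (?S i z) u = u" if "u \<in> ?S i z" for z u
    by (rule oproj_eqI[OF oc(1) oc(3)]) (use that subspace_0[OF subspace_perp] in auto)
  have other: "oproj (?S (3 - i) z) u = 0" if "u \<in> ?S i z" for z u
    by (rule oproj_eqI[OF oc'(1) oc'(3)])
      (use that subspace_0[OF oc'(1)] oc'(2) other_index(2)[OF i] in auto)
  have "{1, 2} = {i, 3 - i}" "i \<noteq> 3 - i" using i by auto
  then have "split_conn A ?S \<xi> y v = oproj (?S i y) (dder A (\<lambda>z. oproj (?S i z) (\<xi> z)) y v) +
      oproj (?S (3 - i) y) (dder A (\<lambda>z. oproj (?S (3 - i) z) (\<xi> z)) y v)"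
    unfolding split_conn_def by simp
  also have "dder A (\<lambda>z. oproj (?S i z) (\<xi> z)) y v = dder A \<xi> y v"
    by (rule dder_cong[OF V]) (rule own[OF \<xi>])
  also have "dder A (\<lambda>z. oproj (?S (3 - i) z) (\<xi> z)) y v = dder A (\<lambda>z. 0) y v"
    by (rule dder_cong[OF V]) (rule other[OF \<xi>])
  also have "\<dots> = 0" by (rule dder_const)
  also have "oproj (?S (3 - i) y) 0 = 0" by (rule other[OF subspace_0[OF oc(1)]])
  finally have eq: "dder A \<xi> y v = oproj (?S i y) (dder A \<xi> y v)"
    using zero unfolding split_form_def by simp
  have "\<exists>w\<in>?S i y. dder A \<xi> y v - w \<in> perp (?S i y)"
    by (rule exists_orthogonal_decomposition[OF oc(1) oc(3)])
  then obtain w where w: "w \<in> ?S i y" "dder A \<xi> y v - w \<in> perp (?S i y)" by blast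
  have "oproj (?S i y) (dder A \<xi> y v) = w"
    by (rule oproj_eqI[OF oc(1) oc(3) w])
  then show ?thesis using eq w(1) by simp
qed

text \<open>
  The osculating sphere complex is the orthogonal complement of the Legendre map and the first
  three derivatives, along the curvature direction, of the opposite curvature sphere.
\<close>

lemma osculating_sphere_complex_eq:
  assumes i: "i \<in> {1,2}" and L: "osculating_sphere_complex A s T i L"
    and fr: "adapted_frame i U \<sigma> \<tau> X Y" and y: "y \<in> U"
  shows "L y = perp {\<sigma> y, \<tau> y, dfield A X \<tau> y, dfield A X (dfield A X \<tau>) y, dfield A X (dfield A X (dfield A X \<tau>)) y}"
proof -
  interpret F: legendre_frame_pair A U \<sigma> \<tau> X Y by (rule adapted_frame_pair[OF i fr])
  have L': "subbundle A 1 L" "\<And>z. L z \<subseteq> osculating_complex A s T i z" "spacelike_space (L y)"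
    "\<And>U \<xi> x v. open U \<Longrightarrow> x \<in> U \<Longrightarrow> \<xi> \<in> sections A U L \<Longrightarrow> v \<in> tangent_space A x \<Longrightarrow>
      split_form A (osculating_complex A s T) \<xi> x v = 0"
    using L unfolding osculating_sphere_complex_def by blast+
  obtain V e where V: "open V" "y \<in> V" "smooth_map A V e" "\<And>y. y \<in> V \<Longrightarrow> e y \<noteq> 0" "\<And>y. y \<in> V \<Longrightarrow> L y = span {e y}"
    by (rule line_subbundle_frame[OF L'(1), of y], rule that)
  let ?W = "U \<inter> V"
  have W: "open ?W" "?W \<subseteq> U" "y \<in> ?W" using F.U V y by auto
  have eW: "smooth_map A ?W e" using smooth_map_subset[OF V(3)] by blast
  have eL: "e z \<in> L z" if "z \<in> ?W" for z using V(5)[of z] that by (auto simp: span_base)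
  then have eS: "e z \<in> osculating_complex A s T i z" if "z \<in> ?W" for z using L'(2) that by blast
  have de: "dder A e y v \<in> osculating_complex A s T i y" if "v \<in> tangent_space A y" for v
    by (rule split_form_zero_imp[OF i W(1,3) eS], assumption, rule L'(4)[OF W(1,3) _ that])
      (use eW eL in \<open>simp add: sections_def\<close>)
  have e_perp: "e y \<in> perp (F.F y)"
    by (rule F.osculating_section_perp_F[OF W eW])
      (use eS osculating_complex_eq(2)[OF i fr] de vector_fieldD[OF F.X y] vector_fieldD[OF F.Y y] y
       in \<open>auto simp: dfield_def\<close>)
  have pos: "lform (e y) (e y) > 0"
    using L'(3) V(4,5)[OF V(2)] by (auto simp: spacelike_space_def span_base)
  show ?thesis
  proof
    show "L y \<subseteq> perp (F.F y)" unfolding V(5)[OF V(2)]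
      using e_perp by (intro span_minimal subspace_perp) auto
    show "perp (F.F y) \<subseteq> L y"
    proof
      fix m assume m: "m \<in> perp (F.F y)"
      then have "m \<in> perp {\<sigma> y, \<tau> y, dfield A X \<tau> y, dfield A X (dfield A X \<tau>) y}" by (auto simp: perp_def)
      then obtain k r where "m = k *\<^sub>R \<sigma> y + r *\<^sub>R e y" "lform m (dfield A X (dfield A X (dfield A X \<tau>)) y) = 0 \<Longrightarrow> k = 0"
        using F.perp_F_unique[OF y e_perp pos] by metis
      then show "m \<in> L y" using m unfolding V(5)[OF V(2)] by (auto simp: perp_def span_singleton)
    qed
  qed
qed

lemma timelike_not_perp_f:
  assumes "timelike p"
  shows "\<not> f x \<subseteq> perp {p}"
proof
  assume p: "f x \<subseteq> perp {p}"
  obtain U \<sigma> \<tau> X Y where fr: "x \<in> U" "adapted_frame 1 U \<sigma> \<tau> X Y" by (rule adapted_frame_exists[of 1 x], simp, rule that)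
  interpret F: legendre_frame_pair A U \<sigma> \<tau> X Y by (rule adapted_frame_pair[OF _ fr(2)]) simp
  have fx: "f x = span {\<sigma> x, \<tau> x}" by (rule adapted_frame_f[OF _ fr(2,1)]) simp
  have "\<sigma> x \<in> f x" "\<tau> x \<in> f x" unfolding fx by (auto simp: span_base)
  then have "lform p (\<sigma> x) = 0" "lform p (\<tau> x) = 0" using p by (auto simp: perp_def lform_commute)
  then have "p \<in> f x" unfolding fx
    using isotropic_plane_positive[OF F.null[OF fr(1)] F.indep[OF fr(1)]] assms by (simp add: timelike_def)
  then show False using f_null[of p x p] assms by (simp add: timelike_def)
qed

end

section \<open>Planar and orthogonally intersected spherical curvature lines\<close>

context legendre_surface
begin

lemma adapted_frame_X:
  assumes "adapted_frame i U \<sigma> \<tau> X Y" "y \<in> U"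
  shows "X y \<in> T i y" "X y \<noteq> (\<lambda>_. 0)"
  using assms by (auto simp: adapted_frame_def tangent_sections_def)

lemma complex_perp_f:
  assumes i: "i \<in> {1,2}" and L: "osculating_sphere_complex A s T i L" and l: "l \<in> L x"
  shows "l \<in> perp (f x)"
proof -
  obtain U \<sigma> \<tau> X Y where fr: "x \<in> U" "adapted_frame i U \<sigma> \<tau> X Y"
    by (rule adapted_frame_exists[OF i, of x], rule that)
  show ?thesis
    using l unfolding osculating_sphere_complex_eq[OF i L fr(2,1)] adapted_frame_f[OF i fr(2,1)] perp_span
    by (auto simp: perp_def)
qed

lemma unit_section_parallel:
  assumes i: "i \<in> {1,2}" and L: "osculating_sphere_complex A s T i L"
    and l: "smooth_map A UNIV l" "\<And>x. l x \<in> L x" "\<And>x. lform (l x) (l x) = 1"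
    and q: "q \<noteq> 0" "\<And>x. L x \<subseteq> perp {q}" and v: "v \<in> T i y"
  shows "dder A l y v = 0"
proof -
  obtain U \<sigma> \<tau> X Y where fr: "y \<in> U" "adapted_frame i U \<sigma> \<tau> X Y"
    by (rule adapted_frame_exists[OF i, of y], rule that)
  interpret F: legendre_frame_pair A U \<sigma> \<tau> X Y by (rule adapted_frame_pair[OF i fr(2)])
  have lU: "smooth_map A U l" using smooth_map_subset[OF l(1)] by blast
  have lq: "lform (l z) q = 0" for z using l(2)[of z] q(2)[of z] by (auto simp: perp_def)
  have lF: "l z \<in> perp (F.F z)" if "z \<in> U" for z
    using l(2)[of z] osculating_sphere_complex_eq[OF i L fr(2) that] by blast
  have "dfield A X l y \<in> span {l y}"
    by (rule F.hyperplane_imp_parallel[OF F.U subset_refl fr(1) lU lF _ q(1) lq]) (auto simp: l(3))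
  then obtain r where r: "dder A l y (X y) = r *\<^sub>R l y" by (auto simp: dfield_def span_singleton)
  have "lform (dder A l y (X y)) (l y) = - lform (l y) (dder A l y (X y))"
    by (rule dder_orthogonal[OF open_UNIV l(1) l(1) l(3) UNIV_I])
  then have "r = 0" using l(3)[of y] unfolding r by (simp add: lform_simps)
  moreover obtain k where "v = (\<lambda>c. k *\<^sub>R X y c)"
    using tangent_line_generator(1)[OF T_line[OF i] adapted_frame_X[OF fr(2,1)] v] by blast
  ultimately show ?thesis
    using dder_scaleR[OF l(1) open_UNIV UNIV_I vector_fieldD[OF F.X fr(1)]] r by simp
qed

text \<open>
  If the osculating sphere complex lies in a fixed hyperplane, then its span with a timelike vector
  contains two null directions, and each of them is a congruence of spheres containing the
  curvature lines. A global choice of one of them is a choice of orientation of the complex.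
\<close>

lemma sphere_congruence_exists:
  assumes i: "i \<in> {1,2}" and sc: "simply_connected (UNIV :: 'a set)"
    and L: "osculating_sphere_complex A s T i L"
    and q: "q \<noteq> 0" "\<And>x. L x \<subseteq> perp {q}" and p: "timelike p"
  obtains \<nu> where "sphere_congruence_along A f (T i) p \<nu>"
    "\<And>x n. n \<in> \<nu> x \<Longrightarrow> \<exists>l\<in>L x. \<exists>c. n = l + c *\<^sub>R p"
proof -
  have L': "subbundle A 1 L" "\<And>x. spacelike_space (L x)"
    using L unfolding osculating_sphere_complex_def by blast+
  obtain l where l: "smooth_map A UNIV l" "\<And>x. l x \<in> L x" "\<And>x. lform (l x) (l x) = 1"
    by (rule spacelike_line_unit_section[OF L' sc], rule that)
  \<comment> \<open>The scalar \<open>r\<close> below is the positive solution of \<open>1 + 2 h r - k r\<^sup>2 = 0\<close>, so that \<open>l + r p\<close> is null.\<close>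
  define k where "k = - lform p p"
  have k: "k > 0" using p by (simp add: k_def timelike_def)
  define h where "h x = lform (l x) p" for x
  define w where "w x = sqrt (h x * h x + k)" for x
  define r where "r x = (h x + w x) * inverse k" for x
  define n where "n x = l x + r x *\<^sub>R p" for x
  have pos: "h x * h x + k > 0" for x using k by (simp add: add_nonneg_pos)
  have ww: "w x * w x = h x * h x + k" "w x > 0" "\<bar>h x\<bar> < w x" for x
  proof -
    show "w x * w x = h x * h x + k" "w x > 0" using pos[of x] by (simp_all add: w_def)
    have "sqrt (h x * h x) < w x" unfolding w_def by (rule real_sqrt_less_mono) (use k in simp)
    then show "\<bar>h x\<bar> < w x" by simp
  qed
  have r0: "r x \<noteq> 0" for x using ww(3)[of x] k by (simp add: r_def)
  have rk: "k * r x = h x + w x" for x using k by (simp add: r_def)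
  have null: "lform (n x) (n x) = 0" for x
  proof -
    have "lform (n x) (n x) = 1 + 2 * r x * h x - k * (r x * r x)"
      using l(3)[of x] by (simp add: n_def lform_simps h_def k_def lform_commute[of p "l x"] algebra_simps)
    moreover have "k * (1 + 2 * r x * h x - k * (r x * r x)) = 0"
    proof -
      have "k * (1 + 2 * r x * h x - k * (r x * r x)) = k + 2 * (k * r x) * h x - (k * r x) * (k * r x)"
        by (simp add: algebra_simps)
      also have "\<dots> = k + h x * h x - w x * w x" unfolding rk by (simp add: algebra_simps)
      finally show ?thesis using ww(1)[of x] by simp
    qed
    ultimately show ?thesis using k by simp
  qed
  have np: "lform (n x) p = - w x" for x
    using rk[of x] by (simp add: n_def lform_simps h_def[symmetric] k_def algebra_simps)
  then have n0: "n x \<noteq> 0" for x using ww(2)[of x] by (metis lform_zero_left neg_equal_0_iff_equal less_irrefl)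
  have n_smooth: "smooth_map A UNIV n"
    unfolding n_def r_def w_def h_def
    by (intro smooth_map_add smooth_map_scale smooth_map_bilinear[OF _ bounded_bilinear_mult] smooth_map_sqrt
        smooth_map_lform smooth_map_const l(1) open_UNIV) (use pos in \<open>simp add: h_def\<close>)
  have l_perp: "lform (l x) u = 0" if u: "u \<in> f x" for x u
    using complex_perp_f[OF i L l(2)] u unfolding perp_def by blast
  define \<nu> where "\<nu> x = span {n x}" for x
  have \<nu>: "m \<in> \<nu> x \<longleftrightarrow> (\<exists>c. m = c *\<^sub>R n x)" for m x by (auto simp: \<nu>_def span_singleton)
  have "sphere_congruence_along A f (T i) p \<nu>"
    unfolding sphere_congruence_along_def
  proof (intro conjI allI ballI)
    have "subbundle A 1 \<nu>" unfolding subbundle_def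
    proof
      fix x
      have "{..<1::nat} = {0}" by auto
      then show "\<exists>U e. open U \<and> x \<in> U \<and> (\<forall>j<1. smooth_map A U (e j)) \<and>
          (\<forall>y\<in>U. \<nu> y = span ((\<lambda>j. e j y) ` {..<1::nat}) \<and> dim (\<nu> y) = 1)"
        using n_smooth n0 by (intro exI[of _ UNIV] exI[of _ "\<lambda>_. n"]) (simp add: \<nu>_def)
    qed
    moreover have "totally_isotropic (\<nu> x)" for x
      using null by (auto simp: totally_isotropic_def \<nu> lform_simps)
    ultimately show "null_subbundle A 1 \<nu>" unfolding null_subbundle_def by blast
    show "\<not> \<nu> x \<subseteq> perp {p}" for x
    proof
      assume "\<nu> x \<subseteq> perp {p}"
      moreover have "n x \<in> \<nu> x" by (simp add: \<nu>_def span_base)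
      ultimately have "lform (n x) p = 0" by (auto simp: perp_def)
      then show False using np[of x] ww(2)[of x] by simp
    qed
    show "\<nu> y = \<nu> x" if y: "y \<in> leaf A (T i) x" for x y
    proof -
      have "l y = l x"
        by (rule parallel_imp_constant_on_leaves[OF T_line[OF i] l(1) unit_section_parallel[OF i L l q] y])
      then show ?thesis by (simp add: \<nu>_def n_def r_def w_def h_def)
    qed
    show "f x \<inter> perp {p} \<subseteq> perp (\<nu> x)" for x
    proof
      fix u assume "u \<in> f x \<inter> perp {p}"
      then have "lform u (n x) = 0"
        using l_perp[of u x] by (auto simp: n_def lform_simps perp_def lform_commute[of u "l x"])
      then show "u \<in> perp (\<nu> x)" unfolding perp_def by (auto simp: \<nu> lform_simps)
    qed
    show "\<nu> x \<inter> perp (f x) = {0}" for x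
    proof -
      have "m = 0" if m: "m \<in> \<nu> x" "m \<in> perp (f x)" for m
      proof (rule ccontr)
        obtain c where c: "m = c *\<^sub>R n x" using m(1) unfolding \<nu> ..
        assume "m \<noteq> 0"
        then have "c * r x \<noteq> 0" using c r0[of x] by auto
        moreover have "(c * r x) * lform u p = 0" if u: "u \<in> f x" for u
          using m(2) u l_perp[OF u] unfolding c perp_def n_def
          by (auto simp: lform_simps lform_commute[of p u])
        ultimately have "f x \<subseteq> perp {p}" by (auto simp: perp_def)
        then show False using timelike_not_perp_f[OF p] by blast
      qed
      then show ?thesis
        using subspace_0[OF subspace_span] subspace_0[OF subspace_perp] unfolding \<nu>_def by blast
    qed
  qed
  moreover have "\<exists>l'\<in>L x. \<exists>c. m = l' + c *\<^sub>R p" if m: "m \<in> \<nu> x" for x m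
  proof -
    obtain c where c: "m = c *\<^sub>R n x" using m \<nu> by blast
    obtain U e where U: "open U" "x \<in> U" "smooth_map A U e" "\<And>y. y \<in> U \<Longrightarrow> e y \<noteq> 0" "\<And>y. y \<in> U \<Longrightarrow> L y = span {e y}"
      by (rule line_subbundle_frame[OF L'(1), of x], rule that)
    have "subspace (L x)" unfolding U(5)[OF U(2)] by (rule subspace_span)
    then have "c *\<^sub>R l x \<in> L x" using l(2) subspace_scale by blast
    moreover have "m = c *\<^sub>R l x + (c * r x) *\<^sub>R p" by (simp add: c n_def scaleR_add_right)
    ultimately show ?thesis by blast
  qed
  ultimately show ?thesis using that by blast
qed

lemma sphere_congruence_frame:
  assumes i: "i \<in> {1,2}" and \<nu>: "sphere_congruence_along A f (T i) p \<nu>"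
  obtains U \<sigma> \<tau> X Y n where "adapted_frame i U \<sigma> \<tau> X Y" "x \<in> U" "smooth_map A U n"
    "\<And>y. y \<in> U \<Longrightarrow> n y \<in> \<nu> y" "\<And>y. y \<in> U \<Longrightarrow> n y \<noteq> 0" "\<And>y. y \<in> U \<Longrightarrow> lform (n y) (n y) = 0"
    "\<And>y. y \<in> U \<Longrightarrow> dfield A X n y \<in> span {n y}"
proof -
  have \<nu>': "subbundle A 1 \<nu>" "\<And>x. totally_isotropic (\<nu> x)" "\<And>x y. y \<in> leaf A (T i) x \<Longrightarrow> \<nu> y = \<nu> x"
    using \<nu> unfolding sphere_congruence_along_def null_subbundle_def by blast+
  obtain V n where V: "open V" "x \<in> V" "smooth_map A V n" "\<And>y. y \<in> V \<Longrightarrow> n y \<noteq> 0" "\<And>y. y \<in> V \<Longrightarrow> \<nu> y = span {n y}"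
    by (rule line_subbundle_frame[OF \<nu>'(1), of x], rule that)
  obtain U \<sigma> \<tau> X Y where fr: "x \<in> U" "adapted_frame i U \<sigma> \<tau> X Y"
    by (rule adapted_frame_exists[OF i, of x], rule that)
  have U: "open U" using fr(2) by (simp add: adapted_frame_def)
  let ?W = "U \<inter> V"
  have frW: "adapted_frame i ?W \<sigma> \<tau> X Y"
    using fr(2) V(1) sections_subset[of \<sigma> U _ ?W] sections_subset[of \<tau> U _ ?W]
      tangent_sections_subset[of X U _ ?W] tangent_sections_subset[of Y U _ ?W]
    unfolding adapted_frame_def by (auto intro!: open_Int)
  have n\<nu>: "n y \<in> \<nu> y" if "y \<in> V" for y using V(5)[OF that] by (simp add: span_base)
  show ?thesis
  proof (rule that[of ?W \<sigma> \<tau> X Y n, OF frW])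
    show "x \<in> ?W" using fr V by blast
    show "smooth_map A ?W n" using smooth_map_subset[OF V(3)] by blast
    show "n y \<in> \<nu> y" "n y \<noteq> 0" "lform (n y) (n y) = 0" if "y \<in> ?W" for y
      using n\<nu>[of y] V(4)[of y] \<nu>'(2)[of y] that unfolding totally_isotropic_def by blast+
    show "dfield A X n y \<in> span {n y}" if y: "y \<in> ?W" for y
      unfolding dfield_def
      by (rule constant_on_leaves_imp_parallel[OF T_line[OF i] \<nu>'(3) V(3,1) _ n\<nu> V(5) adapted_frame_X(1)[OF frW y]])
        (use y in auto)
  qed
qed

text \<open>
  Conversely, a section \<open>m\<close> that is orthogonal to the Legendre map and parallel along the curvature
  lines spans the osculating sphere complex where it does not vanish. A sum of a nonzero null vector
  and a multiple of a timelike vector does not vanish.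
\<close>

lemma parallel_spans_complex:
  assumes i: "i \<in> {1,2}" and L: "osculating_sphere_complex A s T i L"
    and fr: "adapted_frame i U \<sigma> \<tau> X Y" and V: "open V" "V \<subseteq> U" "y \<in> V"
    and m: "smooth_map A V m" "\<And>z. z \<in> V \<Longrightarrow> lform (m z) (\<sigma> z) = 0" "\<And>z. z \<in> V \<Longrightarrow> lform (m z) (\<tau> z) = 0"
      "\<And>z. z \<in> V \<Longrightarrow> dfield A X m z \<in> span {m z}"
    and n: "n \<noteq> 0" "lform n n = 0" "m y = n + t *\<^sub>R p" and p: "timelike p"
  shows "L y = span {m y}"
proof -
  interpret F: legendre_frame_pair A U \<sigma> \<tau> X Y by (rule adapted_frame_pair[OF i fr])
  have "m y \<in> perp (F.F y)" by (rule F.parallel_perp_F[OF V m])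
  then have mL: "m y \<in> L y" using osculating_sphere_complex_eq[OF i L fr] V by blast
  have "m y \<noteq> 0"
  proof
    assume "m y = 0"
    then have n': "n = (- t) *\<^sub>R p" using n(3) by (simp add: eq_neg_iff_add_eq_0)
    then have "t * t * lform p p = 0" using n(2) by (simp add: lform_simps)
    then show False using p n(1) n' by (simp add: timelike_def)
  qed
  moreover obtain e where "L y = span {e}"
    using line_subbundle_frame[of L y] L unfolding osculating_sphere_complex_def by metis
  ultimately show ?thesis using mL span_line_eq by metis
qed

lemma planar_imp_perp:
  assumes i: "i \<in> {1,2}" and L: "osculating_sphere_complex A s T i L"
    and p: "timelike p" "lform q p = 0" and pl: "planar_curvature_lines A f (T i) p q"
  shows "L x \<subseteq> perp {q}"
proof -
  obtain \<nu> where \<nu>: "sphere_congruence_along A f (T i) p \<nu>" "\<And>x. \<nu> x \<subseteq> perp {q}"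
    using pl unfolding planar_curvature_lines_def by blast
  obtain U \<sigma> \<tau> X Y n where fr: "adapted_frame i U \<sigma> \<tau> X Y" "x \<in> U" and n: "smooth_map A U n"
    "\<And>y. y \<in> U \<Longrightarrow> n y \<in> \<nu> y" "\<And>y. y \<in> U \<Longrightarrow> n y \<noteq> 0" "\<And>y. y \<in> U \<Longrightarrow> lform (n y) (n y) = 0"
    "\<And>y. y \<in> U \<Longrightarrow> dfield A X n y \<in> span {n y}"
    by (rule sphere_congruence_frame[OF i \<nu>(1), of x], rule that)
  interpret F: legendre_frame_pair A U \<sigma> \<tau> X Y by (rule adapted_frame_pair[OF i fr(1)])
  define g where "g y = lform p (\<sigma> y)" for y
  have g_smooth: "smooth_map A U g" unfolding g_def
    by (intro smooth_map_lform F.U smooth_map_const F.\<sigma>_smooth)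
  have nq: "lform (n y) q = 0" if "y \<in> U" for y using n(2)[OF that] \<nu>(2)[of y] by (auto simp: perp_def)
  define V where "V = U \<inter> g -` (- {0})"
  have V: "open V" "V \<subseteq> U" unfolding V_def
    using continuous_open_preimage[OF smooth_map_continuous_on[OF g_smooth F.U] F.U] by auto
  \<comment> \<open>Where \<open>p\<close> is not orthogonal to \<open>\<sigma>\<close>, the combination of \<open>n\<close> and \<open>p\<close> that is orthogonal to \<open>\<sigma>\<close> spans the osculating sphere complex.\<close>
  have Lq: "L y \<subseteq> perp {q}" if y: "y \<in> V" for y
  proof -
    have smV: "smooth_map A V \<sigma>" "smooth_map A V \<tau>" "smooth_map A V n" "smooth_map A V g"
      using smooth_map_subset V(2) F.\<sigma>_smooth F.\<tau>_smooth n(1) g_smooth by blast+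
    define t where "t z = (-1) * (lform (n z) (\<sigma> z) * inverse (g z))" for z
    define m where "m z = n z + t z *\<^sub>R p" for z
    have t_smooth: "smooth_map A V t" unfolding t_def
      by (intro smooth_map_bilinear[OF V(1) bounded_bilinear_mult] smooth_map_const smooth_map_lform[OF V(1)]
          smooth_map_inverse[OF V(1)] smV) (auto simp: V_def)
    have tp_smooth: "smooth_map A V (\<lambda>z. t z *\<^sub>R p)" by (intro smooth_map_scale V(1) t_smooth smooth_map_const)
    have m_smooth: "smooth_map A V m" unfolding m_def by (intro smooth_map_add V(1) smV tp_smooth)
    have m\<sigma>: "lform (m z) (\<sigma> z) = 0" if z: "z \<in> V" for z
      using z by (simp add: m_def t_def lform_simps g_def[symmetric] V_def)
    have m\<tau>: "lform (m z) (\<tau> z) = 0" if z: "z \<in> V" for z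
    proof -
      have zU: "z \<in> U" using z V by blast
      let ?u = "g z *\<^sub>R \<tau> z - lform p (\<tau> z) *\<^sub>R \<sigma> z"
      have "?u \<in> f z" unfolding adapted_frame_f[OF i fr(1) zU]
        by (intro span_diff span_scale span_base) auto
      moreover have "?u \<in> perp {p}"
        by (simp add: perp_def lform_simps g_def lform_commute[of "\<tau> z" p] lform_commute[of "\<sigma> z" p])
      ultimately have "?u \<in> perp (\<nu> z)" using \<nu>(1) unfolding sphere_congruence_along_def by blast
      then have "lform ?u (n z) = 0" using n(2)[OF zU] by (auto simp: perp_def)
      then have "g z * lform (n z) (\<tau> z) = lform p (\<tau> z) * lform (n z) (\<sigma> z)"
        by (simp add: lform_simps lform_commute[of "\<tau> z" "n z"] lform_commute[of "\<sigma> z" "n z"])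
      moreover have "g z * lform (m z) (\<tau> z) = g z * lform (n z) (\<tau> z) - lform p (\<tau> z) * lform (n z) (\<sigma> z)"
        using z by (simp add: m_def t_def lform_simps V_def algebra_simps)
      ultimately show ?thesis using z by (simp add: V_def)
    qed
    have dm: "dfield A X m z \<in> span {m z}" if z: "z \<in> V" for z
    proof -
      have zU: "z \<in> U" using z V by blast
      obtain \<rho> where \<rho>: "dder A n z (X z) = \<rho> *\<^sub>R n z" using n(5)[OF zU] by (auto simp: dfield_def span_singleton)
      let ?t' = "dder A t z (X z)"
      have dm: "dfield A X m z = \<rho> *\<^sub>R n z + ?t' *\<^sub>R p"
        unfolding dfield_def m_def dder_add[OF smV(3) tp_smooth V(1) z] \<rho>
          dder_bilinear[OF bounded_bilinear_scaleR t_smooth smooth_map_const V(1) z] dder_const by simp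
      have "lform (m z) (dfield A X \<sigma> z) = 0"
        using F.curvature(1)[OF zU] m\<sigma>[OF z] m\<tau>[OF z] by (rule lform_span_pair)
      then have "lform (dfield A X m z) (\<sigma> z) = 0"
        using dfield_orthogonal[OF V(1) m_smooth smV(1) m\<sigma> z] by simp
      then have 1: "\<rho> * lform (n z) (\<sigma> z) + ?t' * g z = 0" unfolding dm by (simp add: lform_simps g_def)
      have g0: "g z \<noteq> 0" using z by (simp add: V_def)
      have tg: "t z * g z = - lform (n z) (\<sigma> z)" using g0 by (simp add: t_def)
      have "(?t' - \<rho> * t z) * g z = (\<rho> * lform (n z) (\<sigma> z) + ?t' * g z) - \<rho> * (lform (n z) (\<sigma> z) + t z * g z)"
        by (simp add: algebra_simps)
      also have "\<dots> = 0" unfolding 1 tg by simp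
      finally have "?t' = \<rho> * t z" using g0 by simp
      then have "dfield A X m z = \<rho> *\<^sub>R m z" unfolding dm m_def by (simp add: scaleR_add_right)
      then show ?thesis by (simp add: span_base span_scale)
    qed
    have yU: "y \<in> U" using y V by blast
    have "L y = span {m y}"
      by (rule parallel_spans_complex[OF i L fr(1) V y m_smooth m\<sigma> m\<tau> dm n(3)[OF yU] n(4)[OF yU] m_def p(1)])
    moreover have "lform (m y) q = 0"
      using nq[OF yU] p(2) by (simp add: m_def lform_simps lform_commute[of p q])
    ultimately show ?thesis by (auto simp: perp_def span_singleton lform_simps)
  qed
  \<comment> \<open>These points are dense: on an open set where \<open>p\<close> is orthogonal to \<open>\<sigma>\<close>, differentiation along \<open>X\<close> shows that it is also orthogonal to \<open>\<tau>\<close>.\<close>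
  have dense: "\<exists>z\<in>W. z \<in> V" if W: "open W" "y \<in> W" "W \<subseteq> U" for W y
  proof (rule ccontr)
    assume "\<not> (\<exists>z\<in>W. z \<in> V)"
    then have g0: "lform p (\<sigma> z) = 0" if "z \<in> W" for z using that W(3) by (auto simp: V_def g_def)
    have yU: "y \<in> U" using W by blast
    have "lform (dfield A X (\<lambda>_. p) y) (\<sigma> y) = - lform p (dfield A X \<sigma> y)"
      by (rule dfield_orthogonal[OF W(1) smooth_map_const smooth_map_subset[OF F.\<sigma>_smooth W(3)] g0 W(2)])
    then have "lform p (dfield A X \<sigma> y) = 0" by (simp add: dfield_def dder_const lform_simps)
    moreover obtain \<alpha> \<beta> where ab: "dfield A X \<sigma> y = \<alpha> *\<^sub>R \<sigma> y + \<beta> *\<^sub>R \<tau> y"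
      using F.curvature(1)[OF yU] unfolding in_span_pair by blast
    moreover have "\<beta> \<noteq> 0" using F.regular(1)[OF yU] ab by (auto simp: span_singleton)
    ultimately have "lform p (\<tau> y) = 0" using g0[OF W(2)] by (simp add: lform_simps)
    then have "lform p u = 0" if "u \<in> f y" for u
      using that g0[OF W(2)] unfolding adapted_frame_f[OF i fr(1) yU] by (rule_tac lform_span_pair)
    then have "f y \<subseteq> perp {p}" by (auto simp: perp_def lform_commute[of _ p])
    then show False using timelike_not_perp_f[OF p(1)] by blast
  qed
  obtain W e where W: "open W" "x \<in> W" "smooth_map A W e" "\<And>y. y \<in> W \<Longrightarrow> e y \<noteq> 0" "\<And>y. y \<in> W \<Longrightarrow> L y = span {e y}"
    by (rule line_subbundle_frame[of L x]) (use L osculating_sphere_complex_def in blast, rule that)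
  \<comment> \<open>By continuity the orthogonality extends from the dense set.\<close>
  have "lform (e x) q = 0"
  proof (rule ccontr)
    assume "lform (e x) q \<noteq> 0"
    define W' where "W' = (U \<inter> W) \<inter> (\<lambda>z. lform (e z) q) -` (- {0})"
    have "continuous_on (U \<inter> W) (\<lambda>z. lform (e z) q)"
      using smooth_map_continuous_on[OF smooth_map_lform[OF W(1,3) smooth_map_const] W(1)] continuous_on_subset by blast
    then have "open W'" unfolding W'_def by (rule continuous_open_preimage) (use W F.U in auto)
    moreover have "x \<in> W'" using \<open>lform (e x) q \<noteq> 0\<close> W fr by (simp add: W'_def)
    ultimately obtain z where z: "z \<in> W'" "z \<in> V" using dense[of W' x] by (auto simp: W'_def)
    then have "e z \<in> L z" using W(5)[of z] by (auto simp: W'_def span_base)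
    then have "lform (e z) q = 0" using Lq[OF z(2)] by (auto simp: perp_def)
    then show False using z(1) by (simp add: W'_def)
  qed
  then show ?thesis unfolding W(5)[OF W(2)] by (auto simp: perp_def span_singleton lform_simps)
qed

lemma orthogonal_spherical_imp_perp:
  assumes i: "i \<in> {1,2}" and L: "osculating_sphere_complex A s T i L"
    and p: "timelike p" and os: "orthogonal_spherical_curvature_lines A f (T i) p"
  shows "L x \<subseteq> perp {p}"
proof -
  obtain \<nu> where \<nu>: "sphere_congruence_along A f (T i) p \<nu>" "\<And>x. oproj (perp {p}) ` \<nu> x \<subseteq> perp (f x)"
    using os unfolding orthogonal_spherical_curvature_lines_def by blast
  obtain U \<sigma> \<tau> X Y n where fr: "adapted_frame i U \<sigma> \<tau> X Y" "x \<in> U" and n: "smooth_map A U n"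
    "\<And>y. y \<in> U \<Longrightarrow> n y \<in> \<nu> y" "\<And>y. y \<in> U \<Longrightarrow> n y \<noteq> 0" "\<And>y. y \<in> U \<Longrightarrow> lform (n y) (n y) = 0"
    "\<And>y. y \<in> U \<Longrightarrow> dfield A X n y \<in> span {n y}"
    by (rule sphere_congruence_frame[OF i \<nu>(1), of x], rule that)
  interpret F: legendre_frame_pair A U \<sigma> \<tau> X Y by (rule adapted_frame_pair[OF i fr(1)])
  have pp: "lform p p \<noteq> 0" using p by (simp add: timelike_def)
  define k where "k = - inverse (lform p p)"
  define m where "m z = n z + (k * lform (n z) p) *\<^sub>R p" for z
  have m_oproj: "m z = oproj (perp {p}) (n z)" for z
    unfolding oproj_perp_vector[OF pp] m_def k_def by (simp add: divide_inverse mult.commute)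
  have t_smooth: "smooth_map A U (\<lambda>z. k * lform (n z) p)"
    by (intro smooth_map_bilinear[OF F.U bounded_bilinear_mult] smooth_map_const smooth_map_lform F.U n(1))
  have tp_smooth: "smooth_map A U (\<lambda>z. (k * lform (n z) p) *\<^sub>R p)"
    by (intro smooth_map_scale F.U t_smooth smooth_map_const)
  have m_smooth: "smooth_map A U m" unfolding m_def by (intro smooth_map_add F.U n(1) tp_smooth)
  have mf: "lform (m z) (\<sigma> z) = 0" "lform (m z) (\<tau> z) = 0" if z: "z \<in> U" for z
  proof -
    have "m z \<in> perp (f z)" using \<nu>(2)[of z] n(2)[OF z] unfolding m_oproj by blast
    then show "lform (m z) (\<sigma> z) = 0" "lform (m z) (\<tau> z) = 0"
      unfolding adapted_frame_f[OF i fr(1) z] perp_span by (auto simp: perp_def)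
  qed
  have dm: "dfield A X m z \<in> span {m z}" if z: "z \<in> U" for z
  proof -
    obtain \<rho> where \<rho>: "dder A n z (X z) = \<rho> *\<^sub>R n z" using n(5)[OF z] by (auto simp: dfield_def span_singleton)
    have 1: "dder A (\<lambda>z. lform (n z) p) z (X z) = \<rho> * lform (n z) p"
      unfolding dder_bilinear[OF bounded_bilinear_lform n(1) smooth_map_const F.U z] dder_const \<rho>
      by (simp add: lform_simps)
    have 2: "dder A (\<lambda>z. k * lform (n z) p) z (X z) = k * (\<rho> * lform (n z) p)"
      unfolding dder_bilinear[OF bounded_bilinear_mult smooth_map_const
          smooth_map_lform[OF F.U n(1) smooth_map_const] F.U z] dder_const 1 by simp
    have "dfield A X m z = \<rho> *\<^sub>R n z + (k * (\<rho> * lform (n z) p)) *\<^sub>R p"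
      unfolding dfield_def m_def dder_add[OF n(1) tp_smooth F.U z] \<rho>
        dder_bilinear[OF bounded_bilinear_scaleR t_smooth smooth_map_const F.U z] dder_const 2 by simp
    also have "\<dots> = \<rho> *\<^sub>R m z" by (simp add: m_def scaleR_add_right mult_ac)
    finally show ?thesis by (simp add: span_base span_scale)
  qed
  have "L x = span {m x}"
    by (rule parallel_spans_complex[OF i L fr(1) F.U subset_refl fr(2) m_smooth mf dm n(3)[OF fr(2)] n(4)[OF fr(2)] m_def p])
  moreover have "lform (m x) p = 0" using pp by (simp add: m_def k_def lform_simps)
  ultimately show ?thesis by (auto simp: perp_def span_singleton lform_simps)
qed

end

theorem proposition4p24:
  fixes A :: "('a::{t2_space, second_countable_topology}) chart set"
    and f :: "'a \<Rightarrow> R42 set"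
    and s L :: "nat \<Rightarrow> 'a \<Rightarrow> R42 set"
    and T :: "nat \<Rightarrow> 'a \<Rightarrow> 'a tvec set"
    and i :: nat
  assumes "smooth_surface A"
    and "simply_connected (UNIV :: 'a set)"
    and "legendre_map A f"
    and "curvature_data A f s T"
    and "regular_legendre A s"
    and "\<And>j. j \<in> {1,2} \<Longrightarrow> osculating_sphere_complex A s T j (L j)"
    and "i \<in> {1,2}"
  shows "(\<forall>q. q \<noteq> 0 \<longrightarrow>
            ((\<forall>p. timelike p \<and> lform q p = 0 \<longrightarrow> planar_curvature_lines A f (T i) p q) \<longleftrightarrow>
             (\<forall>x. L i x \<subseteq> perp {q}))) \<and>
         (\<forall>p. timelike p \<longrightarrow>
            (orthogonal_spherical_curvature_lines A f (T i) p \<longleftrightarrow>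
             (\<forall>x. L i x \<subseteq> perp {p})))"
proof -
  interpret legendre_surface A f s T
    by unfold_locales (use assms in blast)+
  note i = assms(7) and sc = assms(2) and Li = assms(6)[OF assms(7)]
  have planar: "(\<forall>p. timelike p \<and> lform q p = 0 \<longrightarrow> planar_curvature_lines A f (T i) p q) \<longleftrightarrow> (\<forall>x. L i x \<subseteq> perp {q})"
    if q: "q \<noteq> 0" for q
  proof (intro iffI allI impI; (elim conjE)?)
    fix x assume *: "\<forall>p. timelike p \<and> lform q p = 0 \<longrightarrow> planar_curvature_lines A f (T i) p q"
    obtain p where "timelike p" "lform q p = 0" using timelike_perp_exists by blast
    then show "L i x \<subseteq> perp {q}" using planar_imp_perp[OF i Li] * by blast
  next
    fix p assume Lq: "\<forall>x. L i x \<subseteq> perp {q}" and p: "timelike p" "lform q p = 0"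
    obtain \<nu> where \<nu>: "sphere_congruence_along A f (T i) p \<nu>"
      "\<And>x n. n \<in> \<nu> x \<Longrightarrow> \<exists>l\<in>L i x. \<exists>c. n = l + c *\<^sub>R p"
      by (rule sphere_congruence_exists[OF i sc Li q spec[OF Lq] p(1)], rule that)
    have "n \<in> perp {q}" if n: "n \<in> \<nu> x" for x n
    proof -
      obtain l c where "l \<in> L i x" "n = l + c *\<^sub>R p" using \<nu>(2)[OF n] by blast
      then show ?thesis using Lq p(2) by (auto simp: perp_def lform_simps lform_commute[of p q])
    qed
    then show "planar_curvature_lines A f (T i) p q"
      unfolding planar_curvature_lines_def using \<nu>(1) by blast
  qed
  have spherical: "orthogonal_spherical_curvature_lines A f (T i) p \<longleftrightarrow> (\<forall>x. L i x \<subseteq> perp {p})"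
    if p: "timelike p" for p
  proof (intro iffI allI)
    show "L i x \<subseteq> perp {p}" if "orthogonal_spherical_curvature_lines A f (T i) p" for x
      by (rule orthogonal_spherical_imp_perp[OF i Li p that])
  next
    assume Lp: "\<forall>x. L i x \<subseteq> perp {p}"
    have p0: "p \<noteq> 0" "lform p p \<noteq> 0" using p by (auto simp: timelike_def lform_simps)
    obtain \<nu> where \<nu>: "sphere_congruence_along A f (T i) p \<nu>"
      "\<And>x n. n \<in> \<nu> x \<Longrightarrow> \<exists>l\<in>L i x. \<exists>c. n = l + c *\<^sub>R p"
      by (rule sphere_congruence_exists[OF i sc Li p0(1) spec[OF Lp] p], rule that)
    have "oproj (perp {p}) n \<in> perp (f x)" if n: "n \<in> \<nu> x" for x n
    proof -
      obtain l c where l: "l \<in> L i x" "n = l + c *\<^sub>R p" using \<nu>(2)[OF n] by blast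
      then have "lform l p = 0" using Lp by (auto simp: perp_def)
      then have "oproj (perp {p}) n = l"
        unfolding oproj_perp_vector[OF p0(2)] l(2) using p0(2) by (simp add: lform_simps)
      then show ?thesis using complex_perp_f[OF i Li l(1)] by simp
    qed
    then show "orthogonal_spherical_curvature_lines A f (T i) p"
      unfolding orthogonal_spherical_curvature_lines_def using \<nu>(1) by blast
  qed
  show ?thesis using planar spherical by blast
qed

end
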